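(* (Soundness.) Let $\vdash t : A$ be a closed, well-typed term of the guarded $\lambda$-calculus and suppose $t \twoheadrightarrow u$ (call-by-name reduction). Then $[\![t]\!] = [\![u]\!]$ as morphisms of the topos of trees.
   Context: The guarded $\lambda$-calculus ($\mathsf{g}\lambda$). Types: $A ::= \alpha \mid \mathbf{N} \mid \mathbf{1} \mid A\times A \mid \mathbf{0} \mid A+A \mid A\to A \mid \mu\alpha.A \mid \blacktriangleright A \mid \blacksquare A$. A judgement $\nabla\vdash A$ ($\nabla$ a finite set of type variables) is derived by: $\alpha\in\nabla$ gives $\nabla\vdash\alpha$; $\nabla\vdash\mathbf N,\mathbf 1,\mathbf 0$; $\times,+,\to$ are formed from well-formed components; $\nabla\vdash\mu\alpha.A$ if $\nabla,\alpha\vdash A$ and $\alpha$ is guarded in $A$ (every occurrence of $\alpha$ lies beneath an occurrence of $\blacktriangleright$); $\nabla\vdash\blacktriangleright A$ if $\nabla\vdash A$; $\nabla\vdash\blacksquare A$ if $\emptyset\vdash A$. Types are closed unless stated otherwise. A type is constant if every occurrence of $\blacktriangleright$ in it lies beneath an occurrence of $\blacksquare$. Terms: $t ::= x \mid \mathsf{zero} \mid \mathsf{succ}\,t \mid \langle\rangle \mid \langle t,t\rangle \mid \pi_1 t \mid \pi_2 t \mid \mathsf{abort}\,t \mid \mathsf{in}_1 t \mid \mathsf{in}_2 t \mid \mathsf{case}\,t\,\mathsf{of}\,x_1.t;x_2.t \mid \lambda x.t \mid t\,t \mid \mathsf{fold}\,t \mid \mathsf{unfold}\,t \mid \mathsf{next}\,t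 \mid \mathsf{prev}\,\sigma.t \mid t\circledast t \mid \mathsf{box}\,\sigma.t \mid \mathsf{unbox}\,t \mid \mathsf{box}^+\sigma.t$, where $\sigma=[x_1\leftarrow t_1,\dots,x_n\leftarrow t_n]$ is an explicit substitution binding $x_1,\dots,x_n$ in the body but not in the $t_k$; $\mathsf{prev}\,t$, $\mathsf{box}\,t$, $\mathsf{box}^+t$ denote the case $n=0$. Typing: the usual rules for variables, $\mathsf{zero}:\mathbf N$, $\mathsf{succ}$, $\langle\rangle:\mathbf 1$, pairs/projections, $\mathsf{abort}$ (from $\mathbf 0$ to any type), injections and case, abstraction and application; $\mathsf{fold}\,t:\mu\alpha.A$ if $t:A[\mu\alpha.A/\alpha]$ and $\mathsf{unfold}\,t:A[\mu\alpha.A/\alpha]$ if $t:\mu\alpha.A$; $\mathsf{next}\,t:\blacktriangleright A$ if $t:A$; $t_1\circledast t_2:\blacktriangleright B$ if $t_1:\blacktriangleright(A\to B)$, $t_2:\blacktriangleright A$; $\mathsf{unbox}\,t:A$ if $t:\blacksquare A$; and, when $A_1,\dots,A_n$ are constant and $\Gamma\vdash t_k:A_k$ for all $k$: $\Gamma\vdash\mathsf{prev}[\vec x\leftarrow\vec t].t:A$ if $x_1{:}A_1,\dots,x_n{:}A_n\vdash t:\blacktriangleright A$; $\Gamma\vdash\mathsf{box}[\vec x\leftarrow\vec t].t:\blacksquare A$ if $\vec x{:}\vec A\vdash t:A$; $\Gamma\vdash\mathsf{box}^+[\vec x\leftarrow\vec t].t:\blacksquare B_1+\blacksquare B_2$ if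 $\vec x{:}\vec A\vdash t:B_1+B_2$. Reduction rules on closed terms: $\pi_d\langle t_1,t_2\rangle\mapsto t_d$; $\mathsf{case}\,\mathsf{in}_d t\,\mathsf{of}\,x_1.t_1;x_2.t_2\mapsto t_d[t/x_d]$; $(\lambda x.t_1)t_2\mapsto t_1[t_2/x]$; $\mathsf{unfold}\,\mathsf{fold}\,t\mapsto t$; $\mathsf{prev}[\vec x\leftarrow\vec t].t\mapsto\mathsf{prev}(t[\vec t/\vec x])$ ($\vec x$ nonempty); $\mathsf{prev}\,\mathsf{next}\,t\mapsto t$; $\mathsf{next}\,t_1\circledast\mathsf{next}\,t_2\mapsto\mathsf{next}(t_1t_2)$; $\mathsf{unbox}(\mathsf{box}[\vec x\leftarrow\vec t].t)\mapsto t[\vec t/\vec x]$; $\mathsf{box}^+[\vec x\leftarrow\vec t].t\mapsto\mathsf{box}^+(t[\vec t/\vec x])$ ($\vec x$ nonempty); $\mathsf{box}^+(\mathsf{in}_d t)\mapsto\mathsf{in}_d(\mathsf{box}\,t)$. Values: $\mathsf{succ}^n\mathsf{zero}$, $\langle\rangle$, $\langle t,t'\rangle$, $\mathsf{in}_d t$, $\lambda x.t$, $\mathsf{fold}\,t$, $\mathsf{next}\,t$, $\mathsf{box}\,\sigma.t$. Evaluation contexts: $E::=\cdot\mid\mathsf{succ}\,E\mid\pi_1E\mid\pi_2E\mid\mathsf{case}\,E\,\mathsf{of}\,x_1.t_1;x_2.t_2\mid E\,t\mid\mathsf{unfold}\,E\mid\mathsf{prev}\,E\mid E\circledast t\mid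 v\circledast E\ (v\text{ a value})\mid\mathsf{unbox}\,E\mid\mathsf{box}^+E$. Call-by-name reduction: $E[t]\mapsto E[u]$ whenever $t\mapsto u$ is a reduction rule; $\twoheadrightarrow$ is its reflexive–transitive closure. The topos of trees $\mathcal S$: objects $X$ are families of sets $X_1,X_2,\dots$ with restriction maps $r^X_i:X_{i+1}\to X_i$; morphisms $f:X\to Y$ are families $f_i:X_i\to Y_i$ with $f_i\circ r^X_i=r^Y_i\circ f_{i+1}$. For $i\le j$, $\restriction_i:X_j\to X_i$ is the composite restriction. Products and coproducts are pointwise; $(Y^X)_i$ is the set of tuples $(f_1,\dots,f_i)$, $f_j:X_j\to Y_j$, commuting with restrictions, restricted by projection. $\Delta Z$ has all sets $Z$ and identity restrictions; an object is constant if all its restriction maps are bijections (an element of $X_i$ is then identified with its preimages at higher stages). $\blacksquare X=\Delta(\mathrm{Hom}_{\mathcal S}(1,X))$ with $\mathsf{unbox}:\blacksquare X\to X$, $\mathsf{unbox}_i(x)=x_i$. $(\blacktriangleright X)_1=\{*\}$, $(\blacktriangleright X)_{i+1}=X_i$ with inherited restrictions; $\mathsf{next}:X\to\blacktriangleright X$ has $\mathsf{next}_1$ the unique map and $\mathsf{next}_{i+1}=r^X_i$. Denotation of types: a type with $n$ free variables denotes a mixed-variance functor $(\mathcal S^{op}\times\mathcal S)^n\to\mathcal S$: variables project to their covariant argument; $[\![\mathbf N]\!]=\Delta\mathbb N$, $[\![\mathbf 1]\!]=\Delta\{*\}$, $[\![\mathbf 0]\!]=\Delta\emptyset$; $\times,+$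 pointwise, $\to$ by exponential; $\blacktriangleright,\blacksquare$ by composing with the functors above; $[\![\mu\alpha.A]\!](\vec W)$ is the unique-up-to-isomorphism $X$ with $[\![A]\!](\vec W,X,X)\cong X$. Denotation of terms: a context $x_1{:}A_1,\dots,x_n{:}A_n$ denotes $[\![A_1]\!]\times\dots\times[\![A_n]\!]$ and $\Gamma\vdash t:A$ denotes $[\![t]\!]:[\![\Gamma]\!]\to[\![A]\!]$: variables are projections; zero/succ as expected; products, sums and functions via the cartesian closed and coproduct structure ($[\![\lambda x.t]\!]_i(\gamma)_j(a)=[\![t]\!]_j(\restriction_j\gamma,a)$, $[\![t_1t_2]\!]_i(\gamma)=[\![t_1]\!]_i(\gamma)_i([\![t_2]\!]_i(\gamma))$); fold/unfold via the isomorphism $[\![\mu\alpha.A]\!]\cong[\![A[\mu\alpha.A/\alpha]]\!]$; next and unbox by composing with $\mathsf{next}$ and $\mathsf{unbox}$; $[\![t_1\circledast t_2]\!]_{i+1}(\gamma)=[\![t_1]\!]_{i+1}(\gamma)_i([\![t_2]\!]_{i+1}(\gamma))$ (stage 1 trivial); $[\![\mathsf{prev}[\vec x\leftarrow\vec t].t]\!]_i(\gamma)=[\![t]\!]_{i+1}([\![t_1]\!]_i(\gamma),\dots,[\![t_n]\!]_i(\gamma))$; $[\![\mathsf{box}[\vec x\leftarrow\vec t].t]\!]_i(\gamma)$ is the global element with $j$-th component $[\![t]\!]_j([\![t_1]\!]_i(\gamma),\dots)$; $[\![\mathsf{box}^+[\vec x\leftarrow\vec t].t]\!]_i(\gamma)=[a,d]$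 where $[\![t]\!]_j([\![t_1]\!]_i(\gamma),\dots)=[a_j,d]$ for all $j$ (same $d$) and $a$ is the global element with components $a_j$. *)

theory Defs
  imports "HOL-Library.FuncSet" "HOL-Library.Countable_Set"
begin

section \<open>Syntax\<close>

text \<open>
  Type and term variables are de Bruijn indices, so that syntax is identified up to
  renaming of bound variables.
\<close>

datatype ty =
    TVar nat
  | TNat
  | TUnit
  | TProd ty ty
  | TVoid
  | TSum ty ty
  | TFun ty ty
  | TMu ty
  | TLater ty
  | TBox ty

primrec tlift :: "nat \<Rightarrow> ty \<Rightarrow> ty" where
  "tlift k (TVar i) = TVar (if i < k then i else Suc i)"
| "tlift k TNat = TNat"
| "tlift k TUnit = TUnit"
| "tlift k (TProd A B) = TProd (tlift k A) (tlift k B)"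
| "tlift k TVoid = TVoid"
| "tlift k (TSum A B) = TSum (tlift k A) (tlift k B)"
| "tlift k (TFun A B) = TFun (tlift k A) (tlift k B)"
| "tlift k (TMu A) = TMu (tlift (Suc k) A)"
| "tlift k (TLater A) = TLater (tlift k A)"
| "tlift k (TBox A) = TBox (tlift k A)"

primrec tsubst :: "nat \<Rightarrow> ty \<Rightarrow> ty \<Rightarrow> ty" where
  "tsubst k C (TVar i) = (if i < k then TVar i else if i = k then C else TVar (i - 1))"
| "tsubst k C TNat = TNat"
| "tsubst k C TUnit = TUnit"
| "tsubst k C (TProd A B) = TProd (tsubst k C A) (tsubst k C B)"
| "tsubst k C TVoid = TVoid"
| "tsubst k C (TSum A B) = TSum (tsubst k C A) (tsubst k C B)"
| "tsubst k C (TFun A B) = TFun (tsubst k C A) (tsubst k C B)"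
| "tsubst k C (TMu A) = TMu (tsubst (Suc k) (tlift 0 C) A)"
| "tsubst k C (TLater A) = TLater (tsubst k C A)"
| "tsubst k C (TBox A) = TBox (tsubst k C A)"

abbreviation unfold_mu :: "ty \<Rightarrow> ty" where
  "unfold_mu A \<equiv> tsubst 0 (TMu A) A"

primrec guarded :: "nat \<Rightarrow> ty \<Rightarrow> bool" where
  "guarded k (TVar i) \<longleftrightarrow> i \<noteq> k"
| "guarded k TNat \<longleftrightarrow> True"
| "guarded k TUnit \<longleftrightarrow> True"
| "guarded k (TProd A B) \<longleftrightarrow> guarded k A \<and> guarded k B"
| "guarded k TVoid \<longleftrightarrow> True"
| "guarded k (TSum A B) \<longleftrightarrow> guarded k A \<and> guarded k B"
| "guarded k (TFun A B) \<longleftrightarrow> guarded k A \<and> guarded k B"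
| "guarded k (TMu A) \<longleftrightarrow> guarded (Suc k) A"
| "guarded k (TLater A) \<longleftrightarrow> True"
| "guarded k (TBox A) \<longleftrightarrow> guarded k A"

text \<open>\<open>wft n A\<close>: the type \<open>A\<close> is well-formed over the type variables \<open>0, \<dots>, n - 1\<close>.\<close>

inductive wft :: "nat \<Rightarrow> ty \<Rightarrow> bool" where
  "i < n \<Longrightarrow> wft n (TVar i)"
| "wft n TNat"
| "wft n TUnit"
| "wft n A \<Longrightarrow> wft n B \<Longrightarrow> wft n (TProd A B)"
| "wft n TVoid"
| "wft n A \<Longrightarrow> wft n B \<Longrightarrow> wft n (TSum A B)"
| "wft n A \<Longrightarrow> wft n B \<Longrightarrow> wft n (TFun A B)"
| "wft (Suc n) A \<Longrightarrow> guarded 0 A \<Longrightarrow> wft n (TMu A)"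
| "wft n A \<Longrightarrow> wft n (TLater A)"
| "wft 0 A \<Longrightarrow> wft n (TBox A)"

primrec const_ty :: "ty \<Rightarrow> bool" where
  "const_ty (TVar i) \<longleftrightarrow> True"
| "const_ty TNat \<longleftrightarrow> True"
| "const_ty TUnit \<longleftrightarrow> True"
| "const_ty (TProd A B) \<longleftrightarrow> const_ty A \<and> const_ty B"
| "const_ty TVoid \<longleftrightarrow> True"
| "const_ty (TSum A B) \<longleftrightarrow> const_ty A \<and> const_ty B"
| "const_ty (TFun A B) \<longleftrightarrow> const_ty A \<and> const_ty B"
| "const_ty (TMu A) \<longleftrightarrow> const_ty A"
| "const_ty (TLater A) \<longleftrightarrow> False"
| "const_ty (TBox A) \<longleftrightarrow> True"

text \<open>
  \<open>Case t s1 s2\<close> binds index \<open>0\<close> in \<open>s1\<close> and in \<open>s2\<close>.  In \<open>Prev ts t\<close>, \<open>Box ts t\<close> and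
  \<open>BoxPlus ts t\<close> the list \<open>ts = [t\<^sub>1, \<dots>, t\<^sub>n]\<close> is the explicit substitution: the indices
  \<open>0, \<dots>, n - 1\<close> are bound in \<open>t\<close> (index \<open>k\<close> standing for the variable that is assigned
  \<open>ts ! k\<close>), and nothing is bound in \<open>ts\<close>.
\<close>

datatype tm =
    Var nat
  | Zero
  | Succ tm
  | Unit
  | Pair tm tm
  | Fst tm
  | Snd tm
  | Abort tm
  | In1 tm
  | In2 tm
  | Case tm tm tm
  | Lam tm
  | App tm tm
  | Fold tm
  | Unfold tm
  | Next tm
  | Prev "tm list" tm
  | LApp tm tm  (infixl \<open>\<circledast>\<close> 70)
  | Box "tm list" tm
  | Unbox tm
  | BoxPlus "tm list" tm

definition upr :: "(nat \<Rightarrow> nat) \<Rightarrow> nat \<Rightarrow> nat" where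
  "upr \<rho> = case_nat 0 (\<lambda>i. Suc (\<rho> i))"

primrec rename :: "(nat \<Rightarrow> nat) \<Rightarrow> tm \<Rightarrow> tm" where
  "rename \<rho> (Var i) = Var (\<rho> i)"
| "rename \<rho> Zero = Zero"
| "rename \<rho> (Succ t) = Succ (rename \<rho> t)"
| "rename \<rho> Unit = Unit"
| "rename \<rho> (Pair s t) = Pair (rename \<rho> s) (rename \<rho> t)"
| "rename \<rho> (Fst t) = Fst (rename \<rho> t)"
| "rename \<rho> (Snd t) = Snd (rename \<rho> t)"
| "rename \<rho> (Abort t) = Abort (rename \<rho> t)"
| "rename \<rho> (In1 t) = In1 (rename \<rho> t)"
| "rename \<rho> (In2 t) = In2 (rename \<rho> t)"
| "rename \<rho> (Case t s1 s2) = Case (rename \<rho> t) (rename (upr \<rho>) s1) (rename (upr \<rho>) s2)"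
| "rename \<rho> (Lam t) = Lam (rename (upr \<rho>) t)"
| "rename \<rho> (App s t) = App (rename \<rho> s) (rename \<rho> t)"
| "rename \<rho> (Fold t) = Fold (rename \<rho> t)"
| "rename \<rho> (Unfold t) = Unfold (rename \<rho> t)"
| "rename \<rho> (Next t) = Next (rename \<rho> t)"
| "rename \<rho> (Prev ts t) = Prev (map (rename \<rho>) ts) (rename ((upr ^^ length ts) \<rho>) t)"
| "rename \<rho> (s \<circledast> t) = rename \<rho> s \<circledast> rename \<rho> t"
| "rename \<rho> (Box ts t) = Box (map (rename \<rho>) ts) (rename ((upr ^^ length ts) \<rho>) t)"
| "rename \<rho> (Unbox t) = Unbox (rename \<rho> t)"
| "rename \<rho> (BoxPlus ts t) = BoxPlus (map (rename \<rho>) ts) (rename ((upr ^^ length ts) \<rho>) t)"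

definition ups :: "(nat \<Rightarrow> tm) \<Rightarrow> nat \<Rightarrow> tm" where
  "ups \<theta> = case_nat (Var 0) (\<lambda>i. rename Suc (\<theta> i))"

primrec subst :: "(nat \<Rightarrow> tm) \<Rightarrow> tm \<Rightarrow> tm" where
  "subst \<theta> (Var i) = \<theta> i"
| "subst \<theta> Zero = Zero"
| "subst \<theta> (Succ t) = Succ (subst \<theta> t)"
| "subst \<theta> Unit = Unit"
| "subst \<theta> (Pair s t) = Pair (subst \<theta> s) (subst \<theta> t)"
| "subst \<theta> (Fst t) = Fst (subst \<theta> t)"
| "subst \<theta> (Snd t) = Snd (subst \<theta> t)"
| "subst \<theta> (Abort t) = Abort (subst \<theta> t)"
| "subst \<theta> (In1 t) = In1 (subst \<theta> t)"
| "subst \<theta> (In2 t) = In2 (subst \<theta> t)"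
| "subst \<theta> (Case t s1 s2) = Case (subst \<theta> t) (subst (ups \<theta>) s1) (subst (ups \<theta>) s2)"
| "subst \<theta> (Lam t) = Lam (subst (ups \<theta>) t)"
| "subst \<theta> (App s t) = App (subst \<theta> s) (subst \<theta> t)"
| "subst \<theta> (Fold t) = Fold (subst \<theta> t)"
| "subst \<theta> (Unfold t) = Unfold (subst \<theta> t)"
| "subst \<theta> (Next t) = Next (subst \<theta> t)"
| "subst \<theta> (Prev ts t) = Prev (map (subst \<theta>) ts) (subst ((ups ^^ length ts) \<theta>) t)"
| "subst \<theta> (s \<circledast> t) = subst \<theta> s \<circledast> subst \<theta> t"
| "subst \<theta> (Box ts t) = Box (map (subst \<theta>) ts) (subst ((ups ^^ length ts) \<theta>) t)"
| "subst \<theta> (Unbox t) = Unbox (subst \<theta> t)"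
| "subst \<theta> (BoxPlus ts t) = BoxPlus (map (subst \<theta>) ts) (subst ((ups ^^ length ts) \<theta>) t)"

text \<open>Simultaneous substitution of \<open>ts\<close> for the indices \<open>0, \<dots>, length ts - 1\<close>.\<close>

definition inst :: "tm \<Rightarrow> tm list \<Rightarrow> tm" where
  "inst t ts = subst (\<lambda>i. if i < length ts then ts ! i else Var (i - length ts)) t"


section \<open>Typing\<close>

text \<open>
  All types are closed and well-formed; \<open>wft 0\<close> is required wherever a rule introduces a type
  that does not already occur in a premise.
\<close>

inductive typing :: "ty list \<Rightarrow> tm \<Rightarrow> ty \<Rightarrow> bool"  (\<open>_ \<turnstile> _ \<^bold>: _\<close> [50, 50, 50] 50) where
  "k < length \<Gamma> \<Longrightarrow> wft 0 (\<Gamma> ! k) \<Longrightarrow> \<Gamma> \<turnstile> Var k \<^bold>: \<Gamma> ! k"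
| "\<Gamma> \<turnstile> Zero \<^bold>: TNat"
| "\<Gamma> \<turnstile> t \<^bold>: TNat \<Longrightarrow> \<Gamma> \<turnstile> Succ t \<^bold>: TNat"
| "\<Gamma> \<turnstile> Unit \<^bold>: TUnit"
| "\<Gamma> \<turnstile> s \<^bold>: A \<Longrightarrow> \<Gamma> \<turnstile> t \<^bold>: B \<Longrightarrow> \<Gamma> \<turnstile> Pair s t \<^bold>: TProd A B"
| "\<Gamma> \<turnstile> t \<^bold>: TProd A B \<Longrightarrow> \<Gamma> \<turnstile> Fst t \<^bold>: A"
| "\<Gamma> \<turnstile> t \<^bold>: TProd A B \<Longrightarrow> \<Gamma> \<turnstile> Snd t \<^bold>: B"
| "\<Gamma> \<turnstile> t \<^bold>: TVoid \<Longrightarrow> wft 0 A \<Longrightarrow> \<Gamma> \<turnstile> Abort t \<^bold>: A"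
| "\<Gamma> \<turnstile> t \<^bold>: A \<Longrightarrow> wft 0 B \<Longrightarrow> \<Gamma> \<turnstile> In1 t \<^bold>: TSum A B"
| "\<Gamma> \<turnstile> t \<^bold>: B \<Longrightarrow> wft 0 A \<Longrightarrow> \<Gamma> \<turnstile> In2 t \<^bold>: TSum A B"
| "\<Gamma> \<turnstile> t \<^bold>: TSum A B \<Longrightarrow> A # \<Gamma> \<turnstile> s1 \<^bold>: C \<Longrightarrow> B # \<Gamma> \<turnstile> s2 \<^bold>: C \<Longrightarrow> \<Gamma> \<turnstile> Case t s1 s2 \<^bold>: C"
| "A # \<Gamma> \<turnstile> t \<^bold>: B \<Longrightarrow> wft 0 A \<Longrightarrow> \<Gamma> \<turnstile> Lam t \<^bold>: TFun A B"
| "\<Gamma> \<turnstile> s \<^bold>: TFun A B \<Longrightarrow> \<Gamma> \<turnstile> t \<^bold>: A \<Longrightarrow> \<Gamma> \<turnstile> App s t \<^bold>: B"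
| "\<Gamma> \<turnstile> t \<^bold>: unfold_mu A \<Longrightarrow> wft 0 (TMu A) \<Longrightarrow> \<Gamma> \<turnstile> Fold t \<^bold>: TMu A"
| "\<Gamma> \<turnstile> t \<^bold>: TMu A \<Longrightarrow> \<Gamma> \<turnstile> Unfold t \<^bold>: unfold_mu A"
| "\<Gamma> \<turnstile> t \<^bold>: A \<Longrightarrow> \<Gamma> \<turnstile> Next t \<^bold>: TLater A"
| "length As = length ts \<Longrightarrow> \<forall>k<length ts. const_ty (As ! k) \<Longrightarrow>
   \<forall>k<length ts. \<Gamma> \<turnstile> ts ! k \<^bold>: As ! k \<Longrightarrow> As \<turnstile> t \<^bold>: TLater A \<Longrightarrow> \<Gamma> \<turnstile> Prev ts t \<^bold>: A"
| "\<Gamma> \<turnstile> s \<^bold>: TLater (TFun A B) \<Longrightarrow> \<Gamma> \<turnstile> t \<^bold>: TLater A \<Longrightarrow> \<Gamma> \<turnstile> s \<circledast> t \<^bold>: TLater B"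
| "length As = length ts \<Longrightarrow> \<forall>k<length ts. const_ty (As ! k) \<Longrightarrow>
   \<forall>k<length ts. \<Gamma> \<turnstile> ts ! k \<^bold>: As ! k \<Longrightarrow> As \<turnstile> t \<^bold>: A \<Longrightarrow> \<Gamma> \<turnstile> Box ts t \<^bold>: TBox A"
| "\<Gamma> \<turnstile> t \<^bold>: TBox A \<Longrightarrow> \<Gamma> \<turnstile> Unbox t \<^bold>: A"
| "length As = length ts \<Longrightarrow> \<forall>k<length ts. const_ty (As ! k) \<Longrightarrow>
   \<forall>k<length ts. \<Gamma> \<turnstile> ts ! k \<^bold>: As ! k \<Longrightarrow> As \<turnstile> t \<^bold>: TSum B1 B2 \<Longrightarrow>
   \<Gamma> \<turnstile> BoxPlus ts t \<^bold>: TSum (TBox B1) (TBox B2)"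


section \<open>Call-by-name reduction\<close>

inductive numeral_tm :: "tm \<Rightarrow> bool" where
  "numeral_tm Zero"
| "numeral_tm t \<Longrightarrow> numeral_tm (Succ t)"

inductive is_value :: "tm \<Rightarrow> bool" where
  "numeral_tm t \<Longrightarrow> is_value t"
| "is_value Unit"
| "is_value (Pair s t)"
| "is_value (In1 t)"
| "is_value (In2 t)"
| "is_value (Lam t)"
| "is_value (Fold t)"
| "is_value (Next t)"
| "is_value (Box ts t)"

inductive redex :: "tm \<Rightarrow> tm \<Rightarrow> bool"  (infix \<open>\<mapsto>\<^sub>0\<close> 50) where
  "Fst (Pair s t) \<mapsto>\<^sub>0 s"
| "Snd (Pair s t) \<mapsto>\<^sub>0 t"
| "Case (In1 t) s1 s2 \<mapsto>\<^sub>0 inst s1 [t]"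
| "Case (In2 t) s1 s2 \<mapsto>\<^sub>0 inst s2 [t]"
| "App (Lam s) t \<mapsto>\<^sub>0 inst s [t]"
| "Unfold (Fold t) \<mapsto>\<^sub>0 t"
| "ts \<noteq> [] \<Longrightarrow> Prev ts t \<mapsto>\<^sub>0 Prev [] (inst t ts)"
| "Prev [] (Next t) \<mapsto>\<^sub>0 t"
| "Next s \<circledast> Next t \<mapsto>\<^sub>0 Next (App s t)"
| "Unbox (Box ts t) \<mapsto>\<^sub>0 inst t ts"
| "ts \<noteq> [] \<Longrightarrow> BoxPlus ts t \<mapsto>\<^sub>0 BoxPlus [] (inst t ts)"
| "BoxPlus [] (In1 t) \<mapsto>\<^sub>0 In1 (Box [] t)"
| "BoxPlus [] (In2 t) \<mapsto>\<^sub>0 In2 (Box [] t)"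

text \<open>An evaluation context is represented by the function that fills its hole.\<close>

inductive eval_ctx :: "(tm \<Rightarrow> tm) \<Rightarrow> bool" where
  "eval_ctx (\<lambda>r. r)"
| "eval_ctx E \<Longrightarrow> eval_ctx (\<lambda>r. Succ (E r))"
| "eval_ctx E \<Longrightarrow> eval_ctx (\<lambda>r. Fst (E r))"
| "eval_ctx E \<Longrightarrow> eval_ctx (\<lambda>r. Snd (E r))"
| "eval_ctx E \<Longrightarrow> eval_ctx (\<lambda>r. Case (E r) s1 s2)"
| "eval_ctx E \<Longrightarrow> eval_ctx (\<lambda>r. App (E r) t)"
| "eval_ctx E \<Longrightarrow> eval_ctx (\<lambda>r. Unfold (E r))"
| "eval_ctx E \<Longrightarrow> eval_ctx (\<lambda>r. Prev [] (E r))"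
| "eval_ctx E \<Longrightarrow> eval_ctx (\<lambda>r. E r \<circledast> t)"
| "is_value v \<Longrightarrow> eval_ctx E \<Longrightarrow> eval_ctx (\<lambda>r. v \<circledast> E r)"
| "eval_ctx E \<Longrightarrow> eval_ctx (\<lambda>r. Unbox (E r))"
| "eval_ctx E \<Longrightarrow> eval_ctx (\<lambda>r. BoxPlus [] (E r))"

inductive step :: "tm \<Rightarrow> tm \<Rightarrow> bool"  (infix \<open>\<mapsto>\<close> 50) where
  "eval_ctx E \<Longrightarrow> t \<mapsto>\<^sub>0 u \<Longrightarrow> E t \<mapsto> E u"

abbreviation steps :: "tm \<Rightarrow> tm \<Rightarrow> bool"  (infix \<open>\<Zsurj>\<close> 50) where
  "t \<Zsurj> u \<equiv> step\<^sup>*\<^sup>* t u"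


section \<open>The universe of sets\<close>

text \<open>
  The sets denoted by the types of the calculus have unbounded size: already iterated function
  types over the naturals exceed every fixed HOL type built from \<open>nat\<close>.  The semantics is
  therefore given relative to an arbitrary type \<open>'v\<close> of sets with a membership relation that is
  closed under the usual operations.  In ZFC the set \<open>V\<^sub>\<omega>\<^sub>1\<close> (sets of countable rank) with its
  membership relation satisfies all the assumptions, and so does \<open>V\<^sub>\<kappa>\<close> for every ordinal
  \<open>\<kappa>\<close> of uncountable cofinality.
\<close>

class set_universe =
  fixes elts :: "'a \<Rightarrow> 'a set"
  assumes elts_inject: "elts x = elts y \<Longrightarrow> x = y"
    and elts_subset: "X \<subseteq> elts x \<Longrightarrow> X \<in> range elts"
    and elts_Pow: "{y. elts y \<subseteq> elts x} \<in> range elts"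
    and elts_Union: "(\<Union>y\<in>elts x. elts y) \<in> range elts"
    and elts_countable: "countable X \<Longrightarrow> X \<in> range elts"

text \<open>\<open>vset\<close> is meaningful only for collections in \<open>range elts\<close>.\<close>

definition vset :: "'v::set_universe set \<Rightarrow> 'v" where
  "vset X = (THE x. elts x = X)"

definition vpair :: "'v::set_universe \<Rightarrow> 'v \<Rightarrow> 'v" where
  "vpair a b = vset {vset {a}, vset {a, b}}"

definition vfst :: "'v::set_universe \<Rightarrow> 'v" where
  "vfst p = (THE a. \<exists>b. p = vpair a b)"

definition vsnd :: "'v::set_universe \<Rightarrow> 'v" where
  "vsnd p = (THE b. \<exists>a. p = vpair a b)"

definition vsucc :: "'v::set_universe \<Rightarrow> 'v" where
  "vsucc x = vset {x}"

primrec vnat :: "nat \<Rightarrow> 'v::set_universe" where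
  "vnat 0 = vset {}"
| "vnat (Suc n) = vsucc (vnat n)"

definition vunit :: "'v::set_universe" where
  "vunit = vset {}"

definition vinl :: "'v::set_universe \<Rightarrow> 'v" where
  "vinl a = vpair (vnat 0) a"

definition vinr :: "'v::set_universe \<Rightarrow> 'v" where
  "vinr b = vpair (vnat 1) b"

definition voutl :: "'v::set_universe \<Rightarrow> 'v" where
  "voutl x = (THE a. x = vinl a)"

definition voutr :: "'v::set_universe \<Rightarrow> 'v" where
  "voutr x = (THE b. x = vinr b)"

definition vcase :: "('v::set_universe \<Rightarrow> 'b) \<Rightarrow> ('v \<Rightarrow> 'b) \<Rightarrow> 'v \<Rightarrow> 'b" where
  "vcase f g x = (if \<exists>a. x = vinl a then f (voutl x) else g (voutr x))"

definition vgraph :: "'v::set_universe set \<Rightarrow> ('v \<Rightarrow> 'v) \<Rightarrow> 'v" where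
  "vgraph X f = vset ((\<lambda>a. vpair a (f a)) ` X)"

definition vapp :: "'v::set_universe \<Rightarrow> 'v \<Rightarrow> 'v" where
  "vapp g a = (THE b. vpair a b \<in> elts g)"

text \<open>Finite or infinite tuples \<open>(x\<^sub>j)\<^sub>j\<^sub>\<in>\<^sub>J\<close> with \<open>J \<subseteq> \<nat>\<close>, and their components.\<close>

definition vtup :: "nat set \<Rightarrow> (nat \<Rightarrow> 'v::set_universe) \<Rightarrow> 'v" where
  "vtup J x = vset ((\<lambda>j. vpair (vnat j) (x j)) ` J)"

definition vcomp :: "'v::set_universe \<Rightarrow> nat \<Rightarrow> 'v" where
  "vcomp x j = vapp x (vnat j)"


section \<open>The topos of trees\<close>

text \<open>
  Stages are numbered from \<open>0\<close>: \<open>stg X i\<close> is what is usually written \<open>X\<^sub>i\<^sub>+\<^sub>1\<close>, and \<open>res X i\<close> is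
  the restriction map from \<open>stg X (Suc i)\<close> to \<open>stg X i\<close>.
\<close>

record 'e tree =
  stg :: "nat \<Rightarrow> 'e set"
  res :: "nat \<Rightarrow> 'e \<Rightarrow> 'e"

definition hom :: "'a tree \<Rightarrow> 'b tree \<Rightarrow> (nat \<Rightarrow> 'a \<Rightarrow> 'b) set" where
  "hom X Y = {f. (\<forall>i. f i \<in> stg X i \<rightarrow>\<^sub>E stg Y i) \<and>
                 (\<forall>i. \<forall>x\<in>stg X (Suc i). f i (res X i x) = res Y i (f (Suc i) x))}"

text \<open>For \<open>i \<le> j\<close>, \<open>restr X i j\<close> is the composite restriction from \<open>stg X j\<close> to \<open>stg X i\<close>.\<close>

primrec restr :: "'e tree \<Rightarrow> nat \<Rightarrow> nat \<Rightarrow> 'e \<Rightarrow> 'e" where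
  "restr X i 0 x = x"
| "restr X i (Suc j) x = (if i \<le> j then restr X i j (res X j x) else x)"

text \<open>
  For constant \<open>X\<close>, \<open>transport X i j\<close> is the identification of \<open>stg X i\<close> with \<open>stg X j\<close>.
\<close>

definition transport :: "'e tree \<Rightarrow> nat \<Rightarrow> nat \<Rightarrow> 'e \<Rightarrow> 'e" where
  "transport X i j x =
     (if j \<le> i then restr X j i x else (THE y. y \<in> stg X j \<and> restr X i j y = x))"

definition Delta :: "'e set \<Rightarrow> 'e tree" where
  "Delta Z = \<lparr>stg = \<lambda>i. Z, res = \<lambda>i x. x\<rparr>"

definition nat_obj :: "'v::set_universe tree" where
  "nat_obj = Delta (range vnat)"

definition one_obj :: "'v::set_universe tree" where
  "one_obj = Delta {vunit}"

definition zero_obj :: "'v::set_universe tree" where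
  "zero_obj = Delta {}"

definition prod_obj :: "'v::set_universe tree \<Rightarrow> 'v tree \<Rightarrow> 'v tree" where
  "prod_obj X Y =
     \<lparr>stg = \<lambda>i. {vpair a b | a b. a \<in> stg X i \<and> b \<in> stg Y i},
      res = \<lambda>i p. vpair (res X i (vfst p)) (res Y i (vsnd p))\<rparr>"

definition sum_obj :: "'v::set_universe tree \<Rightarrow> 'v tree \<Rightarrow> 'v tree" where
  "sum_obj X Y =
     \<lparr>stg = \<lambda>i. vinl ` stg X i \<union> vinr ` stg Y i,
      res = \<lambda>i. vcase (\<lambda>a. vinl (res X i a)) (\<lambda>b. vinr (res Y i b))\<rparr>"

definition exp_obj :: "'v::set_universe tree \<Rightarrow> 'v tree \<Rightarrow> 'v tree" where
  "exp_obj X Y =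
     \<lparr>stg = \<lambda>i. {vtup {..i} (\<lambda>j. vgraph (stg X j) (f j)) | f.
                  (\<forall>j\<le>i. f j \<in> stg X j \<rightarrow> stg Y j) \<and>
                  (\<forall>j<i. \<forall>x\<in>stg X (Suc j). f j (res X j x) = res Y j (f (Suc j) x))},
      res = \<lambda>i g. vtup {..i} (vcomp g)\<rparr>"

definition later_obj :: "'v::set_universe tree \<Rightarrow> 'v tree" where
  "later_obj X =
     \<lparr>stg = case_nat {vunit} (stg X), res = case_nat (\<lambda>x. vunit) (res X)\<rparr>"

definition next_map :: "'v::set_universe tree \<Rightarrow> nat \<Rightarrow> 'v \<Rightarrow> 'v" where
  "next_map X i x = (case i of 0 \<Rightarrow> vunit | Suc j \<Rightarrow> res X j x)"

text \<open>A global element is encoded as the sequence of its components.\<close>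

definition box_obj :: "'v::set_universe tree \<Rightarrow> 'v tree" where
  "box_obj X = Delta {vtup UNIV (\<lambda>i. x i vunit) | x. x \<in> hom (one_obj :: 'v tree) X}"

definition unbox_map :: "nat \<Rightarrow> 'v::set_universe \<Rightarrow> 'v" where
  "unbox_map i x = vcomp x i"

text \<open>
  If the first \<open>n + 1\<close> stages of \<open>F X\<close> depend only on the first \<open>n\<close> stages of \<open>X\<close>, then the
  iterates of \<open>F\<close> stabilise stage by stage, and \<open>fix_obj F\<close> collects the stable parts.
\<close>

definition fix_obj :: "('v::set_universe tree \<Rightarrow> 'v tree) \<Rightarrow> 'v tree" where
  "fix_obj F = \<lparr>stg = \<lambda>i. stg ((F ^^ Suc i) one_obj) i,
                res = \<lambda>i. res ((F ^^ Suc (Suc i)) one_obj) i\<rparr>"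


section \<open>Denotation of types\<close>

text \<open>
  The action on objects of the mixed-variance functor denoted by a type: \<open>N\<close> and \<open>P\<close> give the
  contravariant and the covariant arguments.
\<close>

primrec ty_den :: "ty \<Rightarrow> (nat \<Rightarrow> 'v::set_universe tree) \<Rightarrow> (nat \<Rightarrow> 'v tree) \<Rightarrow> 'v tree" where
  "ty_den (TVar i) N P = P i"
| "ty_den TNat N P = nat_obj"
| "ty_den TUnit N P = one_obj"
| "ty_den (TProd A B) N P = prod_obj (ty_den A N P) (ty_den B N P)"
| "ty_den TVoid N P = zero_obj"
| "ty_den (TSum A B) N P = sum_obj (ty_den A N P) (ty_den B N P)"
| "ty_den (TFun A B) N P = exp_obj (ty_den A P N) (ty_den B N P)"
| "ty_den (TMu A) N P = fix_obj (\<lambda>X. ty_den A (case_nat X N) (case_nat X P))"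
| "ty_den (TLater A) N P = later_obj (ty_den A N P)"
| "ty_den (TBox A) N P = box_obj (ty_den A N P)"

text \<open>Closed types; the arguments for the (absent) type variables are irrelevant.\<close>

definition tden :: "ty \<Rightarrow> 'v::set_universe tree" where
  "tden A = ty_den A (\<lambda>_. one_obj) (\<lambda>_. one_obj)"


subsection \<open>Recursive types denote fixed points\<close>

definition agree :: "nat \<Rightarrow> 'e tree \<Rightarrow> 'e tree \<Rightarrow> bool" where
  "agree n X Y \<longleftrightarrow> (\<forall>i<n. stg X i = stg Y i) \<and> (\<forall>i. Suc i < n \<longrightarrow> res X i = res Y i)"

lemma agree_refl [simp]: "agree n X X"
  by (simp add: agree_def)

lemma agree_mono: "agree n X Y \<Longrightarrow> m \<le> n \<Longrightarrow> agree m X Y"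
  by (auto simp: agree_def)

lemma agree_eqI:
  assumes "\<And>n. agree n X Y"
  shows "X = (Y :: 'e tree)"
proof -
  have "stg X i = stg Y i \<and> res X i = res Y i" for i
    using assms[of "Suc (Suc i)"] by (simp add: agree_def)
  then show ?thesis by (intro tree.equality ext) auto
qed

lemma agree_prod: "agree n X X' \<Longrightarrow> agree n Y Y' \<Longrightarrow> agree n (prod_obj X Y) (prod_obj X' Y')"
  by (simp add: agree_def prod_obj_def)

lemma agree_sum: "agree n X X' \<Longrightarrow> agree n Y Y' \<Longrightarrow> agree n (sum_obj X Y) (sum_obj X' Y')"
  by (simp add: agree_def sum_obj_def)

lemma agree_exp:
  assumes "agree n X X'" and "agree n Y Y'"
  shows "agree n (exp_obj X Y) (exp_obj X' Y')"
proof -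
  have "stg (exp_obj X Y) i \<subseteq> stg (exp_obj X' Y') i"
    if "i < n" "agree n X X'" "agree n Y Y'" for i and X X' Y Y' :: "'a tree"
  proof
    fix g assume "g \<in> stg (exp_obj X Y) i"
    then obtain f where f: "g = vtup {..i} (\<lambda>j. vgraph (stg X j) (f j))"
        "\<forall>j\<le>i. f j \<in> stg X j \<rightarrow> stg Y j"
        "\<forall>j<i. \<forall>x\<in>stg X (Suc j). f j (res X j x) = res Y j (f (Suc j) x)"
      by (auto simp: exp_obj_def)
    have "g = vtup {..i} (\<lambda>j. vgraph (stg X' j) (f j))"
      unfolding f(1) vtup_def using that by (auto simp: agree_def intro!: arg_cong[of _ _ vset])
    moreover have "\<forall>j\<le>i. f j \<in> stg X' j \<rightarrow> stg Y' j"
      using f(2) that by (auto simp: agree_def)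
    moreover have "\<forall>j<i. \<forall>x\<in>stg X' (Suc j). f j (res X' j x) = res Y' j (f (Suc j) x)"
      using f(3) that by (auto simp: agree_def)
    ultimately show "g \<in> stg (exp_obj X' Y') i"
      by (auto simp: exp_obj_def)
  qed
  moreover have "agree n X' X" "agree n Y' Y"
    using assms by (simp_all add: agree_def)
  ultimately have "stg (exp_obj X Y) i = stg (exp_obj X' Y') i" if "i < n" for i
    using assms that by blast
  moreover have "res (exp_obj X Y) = res (exp_obj X' Y')"
    by (simp add: exp_obj_def)
  ultimately show ?thesis
    by (simp add: agree_def)
qed

lemma agree_later: "agree n X Y \<Longrightarrow> agree (Suc n) (later_obj X) (later_obj Y)"
  by (auto simp: agree_def later_obj_def split: nat.split)

lemma agree_fix:
  assumes "\<And>m X Y. m \<le> n \<Longrightarrow> agree m X Y \<Longrightarrow> agree m (F X) (G Y)"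
  shows "agree n (fix_obj F) (fix_obj G)"
proof -
  have "agree n ((F ^^ k) one_obj) ((G ^^ k) one_obj)" for k
    by (induction k) (use assms in auto)
  then show ?thesis
    by (simp add: agree_def fix_obj_def del: funpow.simps)
qed

lemma ty_den_agree:
  "wft k A \<Longrightarrow> \<forall>i<k. agree n (N i) (N' i) \<and> agree n (P i) (P' i) \<Longrightarrow>
   agree n (ty_den A N P) (ty_den A N' P')"
proof (induction k A arbitrary: n N N' P P' rule: wft.induct)
  case (7 k A B)
  then show ?case by (auto intro!: agree_exp)
next
  case (8 k A)
  show ?case unfolding ty_den.simps
  proof (rule agree_fix)
    fix m and X Y :: "'a tree"
    assume m: "m \<le> n" and a: "agree m X Y"
    show "agree m (ty_den A (case_nat X N) (case_nat X P)) (ty_den A (case_nat Y N') (case_nat Y P'))"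
      by (rule 8(3)) (use 8(4) m a in \<open>auto split: nat.split intro: agree_mono\<close>)
  qed
next
  case (9 k A)
  then have "agree n (ty_den A N P) (ty_den A N' P')" by auto
  from agree_later[OF this] show ?case by (simp add: agree_mono)
next
  case (10 A k)
  have "agree m (ty_den A N P) (ty_den A N' P')" for m
    by (rule 10(2)) simp
  then have "ty_den A N P = ty_den A N' P'"
    by (rule agree_eqI)
  then show ?case by simp
qed (auto intro!: agree_prod agree_sum)

lemma ty_den_closed: "wft 0 A \<Longrightarrow> ty_den A N P = tden A"
  unfolding tden_def by (rule agree_eqI, rule ty_den_agree) auto

lemma ty_den_guarded:
  "wft k A \<Longrightarrow> guarded l A \<Longrightarrow>
   \<forall>i<k. if i = l then agree n (N i) (N' i) \<and> agree n (P i) (P' i)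
         else agree (Suc n) (N i) (N' i) \<and> agree (Suc n) (P i) (P' i) \<Longrightarrow>
   agree (Suc n) (ty_den A N P) (ty_den A N' P')"
proof (induction k A arbitrary: l n N N' P P' rule: wft.induct)
  case (7 k A B)
  show ?case unfolding ty_den.simps
    by (intro agree_exp 7(3)[where l = l] 7(4)[where l = l]) (use 7(5,6) in \<open>auto split: if_splits\<close>)
next
  case (8 k A)
  show ?case unfolding ty_den.simps
  proof (rule agree_fix)
    fix m and X Y :: "'a tree"
    assume m: "m \<le> Suc n" and a: "agree m X Y"
    show "agree m (ty_den A (case_nat X N) (case_nat X P)) (ty_den A (case_nat Y N') (case_nat Y P'))"
    proof (cases m)
      case 0
      then show ?thesis by (simp add: agree_def)
    next
      case (Suc m')
      show ?thesis unfolding Suc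
        by (rule 8(3)[of "Suc l"])
          (use 8(4,5) m a Suc in \<open>auto split: nat.split if_splits intro: agree_mono\<close>)
    qed
  qed
next
  case (9 k A)
  have "agree n (ty_den A N P) (ty_den A N' P')"
  proof (rule ty_den_agree[OF 9(1)], intro allI impI)
    fix i assume "i < k"
    then show "agree n (N i) (N' i) \<and> agree n (P i) (P' i)"
      using 9(4)[rule_format, of i] by (auto split: if_splits intro: agree_mono[of "Suc n"])
  qed
  from agree_later[OF this] show ?case by simp
next
  case (10 A k)
  then show ?case by (simp add: ty_den_closed)
next
  case (4 k A B)
  then show ?case unfolding ty_den.simps guarded.simps by (intro agree_prod) blast+
next
  case (6 k A B)
  then show ?case unfolding ty_den.simps guarded.simps by (intro agree_sum) blast+
qed (auto split: if_splits)

lemma fix_obj_fixpoint: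
  assumes F: "\<And>n X Y. agree n X Y \<Longrightarrow> agree (Suc n) (F X) (F Y)"
  shows "F (fix_obj F) = fix_obj F"
proof -
  have iter: "agree n ((F ^^ n) one_obj) ((F ^^ m) one_obj)" if "n \<le> m" for n m
    using that
  proof (induction n arbitrary: m)
    case (Suc n)
    then show ?case by (cases m) (auto intro: F)
  qed (simp add: agree_def)
  have fx: "agree n (fix_obj F) ((F ^^ n) one_obj)" for n
  proof -
    have "stg (fix_obj F) i = stg ((F ^^ n) one_obj) i" if "i < n" for i
      using iter[of "Suc i" n] that by (simp add: agree_def fix_obj_def del: funpow.simps)
    moreover have "res (fix_obj F) i = res ((F ^^ n) one_obj) i" if "Suc i < n" for i
      using iter[of "Suc (Suc i)" n] that
      by (simp add: agree_def fix_obj_def del: funpow.simps)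
    ultimately show ?thesis by (simp add: agree_def)
  qed
  have "agree n (F (fix_obj F)) (fix_obj F)" for n
    using F[OF fx[of n]] fx[of "Suc n"] by (auto simp: agree_def)
  then show ?thesis
    by (rule agree_eqI)
qed

lemma ty_den_tlift:
  "ty_den (tlift k A) N P =
   ty_den A (\<lambda>i. N (if i < k then i else Suc i)) (\<lambda>i. P (if i < k then i else Suc i))"
proof (induction A arbitrary: k N P)
  case (TMu A)
  have "(\<lambda>i. case_nat X M (if i < Suc k then i else Suc i)) =
        case_nat X (\<lambda>i. M (if i < k then i else Suc i))" for X and M :: "nat \<Rightarrow> 'a tree"
    by (auto split: nat.split)
  then show ?case by (simp add: TMu)
qed auto

definition env_insert :: "nat \<Rightarrow> 'e \<Rightarrow> (nat \<Rightarrow> 'e) \<Rightarrow> nat \<Rightarrow> 'e" where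
  "env_insert k x M i = (if i < k then M i else if i = k then x else M (i - 1))"

lemma ty_den_tsubst:
  "ty_den (tsubst k C A) N P =
   ty_den A (env_insert k (ty_den C P N) N) (env_insert k (ty_den C N P) P)"
proof (induction A arbitrary: k C N P)
  case (TMu A)
  have "env_insert (Suc k) Z (case_nat X M) = case_nat X (env_insert k Z M)"
    for X Z and M :: "nat \<Rightarrow> 'a tree"
    by (auto simp: env_insert_def fun_eq_iff split: nat.split)
  then show ?case by (simp add: TMu ty_den_tlift)
qed (auto simp: env_insert_def)

lemma tden_unfold_mu:
  assumes "wft 0 (TMu A)"
  shows "tden (unfold_mu A) = (tden (TMu A) :: 'v::set_universe tree)"
proof -
  define M :: "nat \<Rightarrow> 'v tree" where "M = (\<lambda>_. one_obj)"
  define F where "F = (\<lambda>X. ty_den A (case_nat X M) (case_nat X M))"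
  have A: "wft (Suc 0) A" "guarded 0 A"
    using assms by (auto elim: wft.cases)
  have "agree n X Y \<Longrightarrow> agree (Suc n) (F X) (F Y)" for n X Y
    unfolding F_def by (rule ty_den_guarded[OF A]) simp
  then have "F (fix_obj F) = fix_obj F"
    by (rule fix_obj_fixpoint)
  moreover have "tden (TMu A) = fix_obj F"
    by (simp add: tden_def F_def M_def)
  moreover have "tden (unfold_mu A) = F (tden (TMu A))"
  proof -
    have "env_insert 0 X M = case_nat X M" for X
      by (auto simp: env_insert_def fun_eq_iff split: nat.split)
    then show ?thesis
      by (simp add: tden_def F_def M_def[symmetric] ty_den_tsubst del: ty_den.simps)
  qed
  ultimately show ?thesis by simp
qed


section \<open>Denotation of terms\<close>

text \<open>Elements of the product denoted by a context are lists.\<close>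

definition ctx_den :: "ty list \<Rightarrow> 'v::set_universe list tree" where
  "ctx_den \<Gamma> =
     \<lparr>stg = \<lambda>i. {\<gamma>. length \<gamma> = length \<Gamma> \<and> (\<forall>k<length \<Gamma>. \<gamma> ! k \<in> stg (tden (\<Gamma> ! k)) i)},
      res = \<lambda>i \<gamma>. map2 (\<lambda>A. res (tden A) i) \<Gamma> \<gamma>\<rparr>"

definition arr :: "ty list \<Rightarrow> (nat \<Rightarrow> 'v::set_universe list \<Rightarrow> 'v) \<Rightarrow> nat \<Rightarrow> 'v list \<Rightarrow> 'v" where
  "arr \<Gamma> f = (\<lambda>i. restrict (f i) (stg (ctx_den \<Gamma>) i))"

text \<open>
  The values of an explicit substitution with denotations \<open>fs\<close> of constant types \<open>As\<close>, computed
  at stage \<open>i\<close> and regarded as an element of stage \<open>j\<close>.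
\<close>

definition sub_den ::
  "ty list \<Rightarrow> (nat \<Rightarrow> 'v::set_universe list \<Rightarrow> 'v) list \<Rightarrow> nat \<Rightarrow> nat \<Rightarrow> 'v list \<Rightarrow> 'v list" where
  "sub_den As fs i j \<gamma> = map2 (\<lambda>A f. transport (tden A) i j (f i \<gamma>)) As fs"

definition boxplus_den :: "(nat \<Rightarrow> 'v::set_universe) \<Rightarrow> 'v" where
  "boxplus_den x =
     (if \<forall>j. \<exists>a. x j = vinl a then vinl (vtup UNIV (\<lambda>j. voutl (x j)))
      else vinr (vtup UNIV (\<lambda>j. voutr (x j))))"

text \<open>
  Since terms carry no type annotations, the denotation is defined along typing derivations:
  \<open>denotes \<Gamma> t A f\<close> holds if some derivation of \<open>\<Gamma> \<turnstile> t \<^bold>: A\<close> has denotation \<open>f\<close>.  The rules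
  correspond one-to-one to the typing rules.  By \<open>tden_unfold_mu\<close> the isomorphism between the
  denotations of a recursive type and of its unfolding is the identity, hence the rules for
  \<open>Fold\<close> and \<open>Unfold\<close>.  In the rule for \<open>Abort\<close> the stages of the context are empty, so that the
  value is immaterial.
\<close>

inductive denotes :: "ty list \<Rightarrow> tm \<Rightarrow> ty \<Rightarrow> (nat \<Rightarrow> 'v::set_universe list \<Rightarrow> 'v) \<Rightarrow> bool" where
  "k < length \<Gamma> \<Longrightarrow> wft 0 (\<Gamma> ! k) \<Longrightarrow> denotes \<Gamma> (Var k) (\<Gamma> ! k) (arr \<Gamma> (\<lambda>i \<gamma>. \<gamma> ! k))"
| "denotes \<Gamma> Zero TNat (arr \<Gamma> (\<lambda>i \<gamma>. vnat 0))"
| "denotes \<Gamma> t TNat f \<Longrightarrow> denotes \<Gamma> (Succ t) TNat (arr \<Gamma> (\<lambda>i \<gamma>. vsucc (f i \<gamma>)))"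
| "denotes \<Gamma> Unit TUnit (arr \<Gamma> (\<lambda>i \<gamma>. vunit))"
| "denotes \<Gamma> s A f \<Longrightarrow> denotes \<Gamma> t B g \<Longrightarrow>
   denotes \<Gamma> (Pair s t) (TProd A B) (arr \<Gamma> (\<lambda>i \<gamma>. vpair (f i \<gamma>) (g i \<gamma>)))"
| "denotes \<Gamma> t (TProd A B) f \<Longrightarrow> denotes \<Gamma> (Fst t) A (arr \<Gamma> (\<lambda>i \<gamma>. vfst (f i \<gamma>)))"
| "denotes \<Gamma> t (TProd A B) f \<Longrightarrow> denotes \<Gamma> (Snd t) B (arr \<Gamma> (\<lambda>i \<gamma>. vsnd (f i \<gamma>)))"
| "denotes \<Gamma> t TVoid f \<Longrightarrow> wft 0 A \<Longrightarrow> denotes \<Gamma> (Abort t) A (arr \<Gamma> (\<lambda>i \<gamma>. undefined))"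
| "denotes \<Gamma> t A f \<Longrightarrow> wft 0 B \<Longrightarrow>
   denotes \<Gamma> (In1 t) (TSum A B) (arr \<Gamma> (\<lambda>i \<gamma>. vinl (f i \<gamma>)))"
| "denotes \<Gamma> t B f \<Longrightarrow> wft 0 A \<Longrightarrow>
   denotes \<Gamma> (In2 t) (TSum A B) (arr \<Gamma> (\<lambda>i \<gamma>. vinr (f i \<gamma>)))"
| "denotes \<Gamma> t (TSum A B) f \<Longrightarrow> denotes (A # \<Gamma>) s1 C g \<Longrightarrow> denotes (B # \<Gamma>) s2 C h \<Longrightarrow>
   denotes \<Gamma> (Case t s1 s2) C
     (arr \<Gamma> (\<lambda>i \<gamma>. vcase (\<lambda>a. g i (a # \<gamma>)) (\<lambda>b. h i (b # \<gamma>)) (f i \<gamma>)))"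
| "denotes (A # \<Gamma>) t B f \<Longrightarrow> wft 0 A \<Longrightarrow>
   denotes \<Gamma> (Lam t) (TFun A B)
     (arr \<Gamma> (\<lambda>i \<gamma>. vtup {..i} (\<lambda>j. vgraph (stg (tden A) j)
                                       (\<lambda>a. f j (a # restr (ctx_den \<Gamma>) j i \<gamma>)))))"
| "denotes \<Gamma> s (TFun A B) f \<Longrightarrow> denotes \<Gamma> t A g \<Longrightarrow>
   denotes \<Gamma> (App s t) B (arr \<Gamma> (\<lambda>i \<gamma>. vapp (vcomp (f i \<gamma>) i) (g i \<gamma>)))"
| "denotes \<Gamma> t (unfold_mu A) f \<Longrightarrow> wft 0 (TMu A) \<Longrightarrow> denotes \<Gamma> (Fold t) (TMu A) f"
| "denotes \<Gamma> t (TMu A) f \<Longrightarrow> denotes \<Gamma> (Unfold t) (unfold_mu A) f"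
| "denotes \<Gamma> t A f \<Longrightarrow>
   denotes \<Gamma> (Next t) (TLater A) (arr \<Gamma> (\<lambda>i \<gamma>. next_map (tden A) i (f i \<gamma>)))"
| "length As = length ts \<Longrightarrow> length fs = length ts \<Longrightarrow> \<forall>k<length ts. const_ty (As ! k) \<Longrightarrow>
   \<forall>k<length ts. denotes \<Gamma> (ts ! k) (As ! k) (fs ! k) \<Longrightarrow> denotes As t (TLater A) f \<Longrightarrow>
   denotes \<Gamma> (Prev ts t) A (arr \<Gamma> (\<lambda>i \<gamma>. f (Suc i) (sub_den As fs i (Suc i) \<gamma>)))"
| "denotes \<Gamma> s (TLater (TFun A B)) f \<Longrightarrow> denotes \<Gamma> t (TLater A) g \<Longrightarrow>
   denotes \<Gamma> (s \<circledast> t) (TLater B)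
     (arr \<Gamma> (\<lambda>i \<gamma>. case i of 0 \<Rightarrow> vunit | Suc j \<Rightarrow> vapp (vcomp (f i \<gamma>) j) (g i \<gamma>)))"
| "length As = length ts \<Longrightarrow> length fs = length ts \<Longrightarrow> \<forall>k<length ts. const_ty (As ! k) \<Longrightarrow>
   \<forall>k<length ts. denotes \<Gamma> (ts ! k) (As ! k) (fs ! k) \<Longrightarrow> denotes As t A f \<Longrightarrow>
   denotes \<Gamma> (Box ts t) (TBox A)
     (arr \<Gamma> (\<lambda>i \<gamma>. vtup UNIV (\<lambda>j. f j (sub_den As fs i j \<gamma>))))"
| "denotes \<Gamma> t (TBox A) f \<Longrightarrow> denotes \<Gamma> (Unbox t) A (arr \<Gamma> (\<lambda>i \<gamma>. unbox_map i (f i \<gamma>)))"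
| "length As = length ts \<Longrightarrow> length fs = length ts \<Longrightarrow> \<forall>k<length ts. const_ty (As ! k) \<Longrightarrow>
   \<forall>k<length ts. denotes \<Gamma> (ts ! k) (As ! k) (fs ! k) \<Longrightarrow> denotes As t (TSum B1 B2) f \<Longrightarrow>
   denotes \<Gamma> (BoxPlus ts t) (TSum (TBox B1) (TBox B2))
     (arr \<Gamma> (\<lambda>i \<gamma>. boxplus_den (\<lambda>j. f j (sub_den As fs i j \<gamma>))))"

text \<open>A judgement may have several derivations, but they all have the same denotation.\<close>

definition den :: "ty list \<Rightarrow> tm \<Rightarrow> ty \<Rightarrow> nat \<Rightarrow> 'v::set_universe list \<Rightarrow> 'v" where
  "den \<Gamma> t A = (THE f. denotes \<Gamma> t A f)"

end

theory Submission
  imports Defs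
begin

text \<open>
  Terms carry no type annotations, so a judgement may have many derivations, and soundness splits
  into two parts.  First, a derivation of \<open>t\<close> with denotation \<open>f\<close> is turned into a derivation of
  each reduct of \<open>t\<close> with the same denotation \<open>f\<close>; this is the usual argument by a semantic
  substitution lemma.  Second, all derivations of a closed judgement have the same denotation
  (coherence).  For this, \<open>rel A B i\<close> relates stage \<open>i\<close> of the denotations of two types \<open>A\<close> and
  \<open>B\<close>, following their common structure and being empty where that differs.  Any two derivations
  for one term, possibly at different types, have related denotations, whereas \<open>rel A A i\<close> is the
  equality.  The relation is well defined by recursion on the nesting depth of boxes, then the
  stage, then the part of the type that is not beneath a \<open>TLater\<close>.
\<close>

section \<open>The universe of sets\<close>

definition small :: "'v::set_universe set \<Rightarrow> bool" where
  "small X \<longleftrightarrow> X \<in> range elts"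

lemma elts_vset: "small X \<Longrightarrow> elts (vset X) = X"
  unfolding vset_def small_def by (rule theI') (auto dest: elts_inject)

lemma vset_inject: "small X \<Longrightarrow> small Y \<Longrightarrow> vset X = vset Y \<longleftrightarrow> X = Y"
  by (metis elts_vset)

lemma small_countable: "countable X \<Longrightarrow> small X"
  unfolding small_def by (rule elts_countable)

lemma small_finite: "finite X \<Longrightarrow> small X"
  by (simp add: small_countable countable_finite)

lemma small_subset: "small Y \<Longrightarrow> X \<subseteq> Y \<Longrightarrow> small X"
  using elts_subset by (auto simp: small_def)

lemma small_Pow: "small X \<Longrightarrow> small {y. elts y \<subseteq> X}"
  using elts_Pow by (auto simp: small_def)

lemma small_UN_elts: "small X \<Longrightarrow> small (\<Union>y\<in>X. elts y)"
  using elts_Union by (auto simp: small_def)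

lemma small_UN:
  assumes "countable I" and "\<And>i. i \<in> I \<Longrightarrow> small (X i)"
  shows "small (\<Union>i\<in>I. X i)"
proof -
  have "small (\<Union>y\<in>(\<lambda>i. vset (X i)) ` I. elts y)"
    by (intro small_UN_elts small_countable countable_image assms(1))
  then show ?thesis
    by (simp add: assms(2) elts_vset)
qed

lemma small_Un: "small X \<Longrightarrow> small Y \<Longrightarrow> small (X \<union> Y)"
  using small_UN[of "{X, Y}" "\<lambda>Z. Z"] by auto

lemma elts_vset_finite: "finite X \<Longrightarrow> elts (vset X) = X"
  by (simp add: elts_vset small_finite)

lemma vpair_eq_iff [simp]: "vpair a b = vpair a' b' \<longleftrightarrow> a = a' \<and> b = b'"
proof
  assume "vpair a b = vpair a' b'"
  then have "{vset {a}, vset {a, b}} = {vset {a'}, vset {a', b'}}"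
    by (simp add: vpair_def vset_inject small_finite)
  then show "a = a' \<and> b = b'"
    by (auto simp: doubleton_eq_iff vset_inject small_finite)
qed simp

lemma vfst_vpair [simp]: "vfst (vpair a b) = a"
  by (simp add: vfst_def)

lemma vsnd_vpair [simp]: "vsnd (vpair a b) = b"
  by (simp add: vsnd_def)

lemma vnat_inject [simp]: "vnat m = vnat n \<longleftrightarrow> m = n"
proof (induction m arbitrary: n)
  case 0
  show ?case by (cases n) (auto simp: vsucc_def vset_inject small_finite)
next
  case (Suc m)
  then show ?case by (cases n) (auto simp: vsucc_def vset_inject small_finite)
qed

declare vnat.simps [simp del]

lemma vsucc_in_range_vnat: "x \<in> range vnat \<Longrightarrow> vsucc x \<in> range vnat"
  by (auto simp flip: vnat.simps(2))

lemma vinl_eq_iff [simp]: "vinl a = vinl b \<longleftrightarrow> a = b"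
  by (simp add: vinl_def)

lemma vinr_eq_iff [simp]: "vinr a = vinr b \<longleftrightarrow> a = b"
  by (simp add: vinr_def)

lemma vinl_neq_vinr [simp]: "vinl a \<noteq> vinr b" "vinr b \<noteq> vinl a"
  by (auto simp: vinl_def vinr_def)

lemma voutl_vinl [simp]: "voutl (vinl a) = a"
  by (simp add: voutl_def)

lemma voutr_vinr [simp]: "voutr (vinr a) = a"
  by (simp add: voutr_def)

lemma vcase_simps [simp]: "vcase f g (vinl a) = f a" "vcase f g (vinr b) = g b"
  by (simp_all add: vcase_def)

lemma small_vpair:
  assumes "small X" "small Y"
  shows "small {vpair a b | a b. a \<in> X \<and> b \<in> Y}"
proof (rule small_subset)
  show "small {z. elts z \<subseteq> {y. elts y \<subseteq> X \<union> Y}}"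
    by (intro small_Pow small_Un assms)
  show "{vpair a b | a b. a \<in> X \<and> b \<in> Y} \<subseteq> {z. elts z \<subseteq> {y. elts y \<subseteq> X \<union> Y}}"
    by (auto simp: vpair_def elts_vset_finite)
qed

lemma elts_vtup: "elts (vtup J x) = (\<lambda>j. vpair (vnat j) (x j)) ` J"
  unfolding vtup_def by (intro elts_vset small_countable) simp

lemma vcomp_vtup [simp]: "j \<in> J \<Longrightarrow> vcomp (vtup J x) j = x j"
  unfolding vcomp_def vapp_def by (rule the_equality) (auto simp: elts_vtup)

lemma vtup_cong: "(\<And>j. j \<in> J \<Longrightarrow> x j = y j) \<Longrightarrow> vtup J x = vtup J y"
  unfolding vtup_def by (metis (no_types, lifting) image_cong)

lemma vtup_eq_iff: "vtup J x = vtup J y \<longleftrightarrow> (\<forall>j\<in>J. x j = y j)"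
  by (metis vcomp_vtup vtup_cong)

lemma small_vtup:
  fixes X :: "nat \<Rightarrow> 'v::set_universe set"
  assumes "\<And>j. j \<in> J \<Longrightarrow> small (X j)"
  shows "small {vtup J x | x. \<forall>j\<in>J. x j \<in> X j}"
proof (rule small_subset)
  let ?P = "{vpair a b | a b. a \<in> range vnat \<and> b \<in> (\<Union>j\<in>J. X j)}"
  show "small {z. elts z \<subseteq> ?P}"
    by (intro small_Pow small_vpair small_UN assms small_countable) simp_all
  show "{vtup J x | x. \<forall>j\<in>J. x j \<in> X j} \<subseteq> {z. elts z \<subseteq> ?P}"
    by (fastforce simp: elts_vtup)
qed

lemma elts_vgraph:
  assumes "small X" "small Y" "f \<in> X \<rightarrow> Y"
  shows "elts (vgraph X f) = (\<lambda>a. vpair a (f a)) ` X"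
proof -
  have "(\<lambda>a. vpair a (f a)) ` X \<subseteq> {vpair a b | a b. a \<in> X \<and> b \<in> Y}"
    using assms(3) by auto
  then show ?thesis
    unfolding vgraph_def by (intro elts_vset small_subset[OF small_vpair[OF assms(1,2)]])
qed

lemma vapp_vgraph:
  assumes "small X" "small Y" "f \<in> X \<rightarrow> Y" "a \<in> X"
  shows "vapp (vgraph X f) a = f a"
  unfolding vapp_def using assms(4) by (intro the_equality) (auto simp: elts_vgraph[OF assms(1-3)])

lemma vgraph_cong: "(\<And>a. a \<in> X \<Longrightarrow> f a = g a) \<Longrightarrow> vgraph X f = vgraph X g"
  unfolding vgraph_def by (metis (no_types, lifting) image_cong)

lemma small_vgraph:
  assumes "small X" "small Y"
  shows "small {vgraph X f | f. f \<in> X \<rightarrow> Y}"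
proof (rule small_subset)
  let ?P = "{vpair a b | a b. a \<in> X \<and> b \<in> Y}"
  show "small {z. elts z \<subseteq> ?P}"
    by (intro small_Pow small_vpair assms)
  show "{vgraph X f | f. f \<in> X \<rightarrow> Y} \<subseteq> {z. elts z \<subseteq> ?P}"
    by (auto simp: elts_vgraph[OF assms] Pi_iff)
qed


section \<open>Trees\<close>

lemma stg_Delta [simp]: "stg (Delta Z) i = Z"
  and res_Delta [simp]: "res (Delta Z) i x = x"
  by (simp_all add: Delta_def)

lemma stg_prod [simp]: "stg (prod_obj X Y) i = {vpair a b | a b. a \<in> stg X i \<and> b \<in> stg Y i}"
  and res_prod [simp]: "res (prod_obj X Y) i (vpair a b) = vpair (res X i a) (res Y i b)"
  by (simp_all add: prod_obj_def)

lemma stg_sum [simp]: "stg (sum_obj X Y) i = vinl ` stg X i \<union> vinr ` stg Y i"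
  and res_sum [simp]:
    "res (sum_obj X Y) i (vinl a) = vinl (res X i a)"
    "res (sum_obj X Y) i (vinr b) = vinr (res Y i b)"
  by (simp_all add: sum_obj_def)

lemma stg_later [simp]: "stg (later_obj X) 0 = {vunit}" "stg (later_obj X) (Suc i) = stg X i"
  and res_later [simp]: "res (later_obj X) 0 x = vunit" "res (later_obj X) (Suc i) = res X i"
  by (simp_all add: later_obj_def)

definition res_closed :: "'e tree \<Rightarrow> bool" where
  "res_closed X \<longleftrightarrow> (\<forall>i. res X i \<in> stg X (Suc i) \<rightarrow> stg X i)"

lemma res_closed_in: "res_closed X \<Longrightarrow> x \<in> stg X (Suc i) \<Longrightarrow> res X i x \<in> stg X i"
  by (auto simp: res_closed_def)

definition wf_tree :: "'v::set_universe tree \<Rightarrow> bool" where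
  "wf_tree X \<longleftrightarrow> res_closed X \<and> (\<forall>i. small (stg X i))"

lemma wf_tree_small: "wf_tree X \<Longrightarrow> small (stg X i)"
  and wf_tree_res_closed: "wf_tree X \<Longrightarrow> res_closed X"
  by (simp_all add: wf_tree_def)

declare restr.simps(2) [simp del]

lemma restr_self [simp]: "restr X i i x = x"
  by (cases i) (simp_all add: restr.simps(2))

lemma restr_Suc: "i \<le> j \<Longrightarrow> restr X i (Suc j) x = restr X i j (res X j x)"
  by (simp add: restr.simps(2))

lemma restr_in:
  assumes "res_closed X" "i \<le> j" "x \<in> stg X j"
  shows "restr X i j x \<in> stg X i"
  using assms(2,3) by (induction j arbitrary: x rule: dec_induct)
    (simp_all add: restr_Suc res_closed_in[OF assms(1)])

lemma res_restr:
  assumes "Suc i \<le> j"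
  shows "res X i (restr X (Suc i) j x) = restr X i j x"
  using assms by (induction j arbitrary: x rule: dec_induct) (simp_all add: restr_Suc)


subsection \<open>Global elements\<close>

definition global_elt :: "'e tree \<Rightarrow> (nat \<Rightarrow> 'e) \<Rightarrow> bool" where
  "global_elt X x \<longleftrightarrow> (\<forall>j. x j \<in> stg X j \<and> res X j (x (Suc j)) = x j)"

lemma global_elt_in: "global_elt X x \<Longrightarrow> x j \<in> stg X j"
  and global_elt_res: "global_elt X x \<Longrightarrow> res X j (x (Suc j)) = x j"
  by (simp_all add: global_elt_def)

lemma restr_global_elt:
  assumes "global_elt X x" "i \<le> j"
  shows "restr X i j (x j) = x i"
  using assms(2) by (induction j rule: dec_induct)
    (simp_all add: restr_Suc global_elt_res[OF assms(1)])

lemma stg_box: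
  fixes X :: "'v::set_universe tree"
  shows "stg (box_obj X) i = {vtup UNIV x | x. global_elt X x}"
proof (intro equalityI subsetI)
  fix z assume "z \<in> stg (box_obj X) i"
  then obtain f where f: "z = vtup UNIV (\<lambda>i. f i vunit)" "f \<in> hom (one_obj :: 'v tree) X"
    by (auto simp: box_obj_def)
  have "f j vunit \<in> stg X j \<and> res X j (f (Suc j) vunit) = f j vunit" for j
  proof -
    have "f j \<in> stg one_obj j \<rightarrow>\<^sub>E stg X j"
      and "\<forall>u\<in>stg one_obj (Suc j). f j (res one_obj j u) = res X j (f (Suc j) u)"
      using f(2) unfolding hom_def by blast+
    then show ?thesis by (simp add: one_obj_def PiE_iff)
  qed
  then have "global_elt X (\<lambda>i. f i vunit)"
    by (simp add: global_elt_def)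
  with f(1) show "z \<in> {vtup UNIV x | x. global_elt X x}" by blast
next
  fix z assume "z \<in> {vtup UNIV x | x. global_elt X x}"
  then obtain x where x: "z = vtup UNIV x" "global_elt X x" by blast
  define f where "f i = (\<lambda>_\<in>{vunit :: 'v}. x i)" for i
  have "f \<in> hom one_obj X"
    using x(2) by (auto simp: f_def hom_def one_obj_def global_elt_def)
  moreover have "z = vtup UNIV (\<lambda>i. f i vunit)"
    by (simp add: x(1) f_def)
  ultimately show "z \<in> stg (box_obj X) i"
    unfolding box_obj_def by auto
qed

lemma res_box [simp]: "res (box_obj X) i x = x"
  by (simp add: box_obj_def)

lemma vtup_in_box_iff: "vtup UNIV x \<in> stg (box_obj X) i \<longleftrightarrow> global_elt X x"
  by (auto simp: stg_box vtup_eq_iff simp flip: fun_eq_iff)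

lemma global_elt_vinl_iff: "global_elt (sum_obj X Y) (\<lambda>j. vinl (a j)) \<longleftrightarrow> global_elt X a"
  and global_elt_vinr_iff: "global_elt (sum_obj X Y) (\<lambda>j. vinr (b j)) \<longleftrightarrow> global_elt Y b"
  by (auto simp: global_elt_def)

lemma global_elt_sumE:
  assumes "global_elt (sum_obj X Y) x"
  obtains (inl) a where "global_elt X a" "x = (\<lambda>j. vinl (a j))"
    | (inr) b where "global_elt Y b" "x = (\<lambda>j. vinr (b j))"
proof -
  have tag: "x j \<in> range vinl \<longleftrightarrow> x 0 \<in> range vinl" for j
  proof (induction j)
    case (Suc j)
    have "x (Suc j) \<in> range vinl \<longleftrightarrow> res (sum_obj X Y) j (x (Suc j)) \<in> range vinl"
      using global_elt_in[OF assms, of "Suc j"] by auto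
    then show ?case by (simp add: Suc global_elt_res[OF assms])
  qed simp
  have "x = (\<lambda>j. vinl (voutl (x j))) \<or> x = (\<lambda>j. vinr (voutr (x j)))"
  proof (cases "x 0 \<in> range vinl")
    case True
    then have "x j \<in> range vinl" for j using tag by blast
    then have "x j = vinl (voutl (x j))" for j by (metis imageE voutl_vinl)
    then show ?thesis by blast
  next
    case False
    then have "x j \<in> range vinr" for j
      using global_elt_in[OF assms, of j] tag[of j] by auto
    then have "x j = vinr (voutr (x j))" for j by (metis imageE voutr_vinr)
    then show ?thesis by blast
  qed
  then show thesis
    using assms inl inr by (metis global_elt_vinl_iff global_elt_vinr_iff)
qed


subsection \<open>Exponentials\<close>

abbreviation exp_app :: "'v::set_universe \<Rightarrow> nat \<Rightarrow> 'v \<Rightarrow> 'v" where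
  "exp_app g j a \<equiv> vapp (vcomp g j) a"

abbreviation exp_lam :: "'v::set_universe tree \<Rightarrow> nat \<Rightarrow> (nat \<Rightarrow> 'v \<Rightarrow> 'v) \<Rightarrow> 'v" where
  "exp_lam X i f \<equiv> vtup {..i} (\<lambda>j. vgraph (stg X j) (f j))"

lemma exp_lam_cong:
  "(\<And>j a. j \<le> i \<Longrightarrow> a \<in> stg X j \<Longrightarrow> f j a = g j a) \<Longrightarrow> exp_lam X i f = exp_lam X i g"
  by (intro vtup_cong vgraph_cong) simp

lemma exp_app_exp_lam:
  assumes "wf_tree X" "wf_tree Y" "f j \<in> stg X j \<rightarrow> stg Y j" "j \<le> i" "a \<in> stg X j"
  shows "exp_app (exp_lam X i f) j a = f j a"
  using assms by (simp add: vapp_vgraph[OF wf_tree_small wf_tree_small])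

lemma exp_lam_in:
  assumes "\<And>j a. j \<le> i \<Longrightarrow> a \<in> stg X j \<Longrightarrow> f j a \<in> stg Y j"
    and "\<And>j a. j < i \<Longrightarrow> a \<in> stg X (Suc j) \<Longrightarrow> f j (res X j a) = res Y j (f (Suc j) a)"
  shows "exp_lam X i f \<in> stg (exp_obj X Y) i"
  using assms by (auto simp: exp_obj_def)

lemma exp_objE:
  assumes "g \<in> stg (exp_obj X Y) i"
  obtains f where "g = exp_lam X i f" and "\<forall>j\<le>i. f j \<in> stg X j \<rightarrow> stg Y j"
    and "\<forall>j<i. \<forall>a\<in>stg X (Suc j). f j (res X j a) = res Y j (f (Suc j) a)"
  using assms by (auto simp: exp_obj_def)

lemma
  assumes g: "g \<in> stg (exp_obj X Y) i" and X: "wf_tree X" and Y: "wf_tree Y"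
  shows exp_lam_exp_app: "exp_lam X i (exp_app g) = g"
    and exp_app_in: "j \<le> i \<Longrightarrow> a \<in> stg X j \<Longrightarrow> exp_app g j a \<in> stg Y j"
    and exp_app_res: "j < i \<Longrightarrow> a \<in> stg X (Suc j) \<Longrightarrow>
      exp_app g j (res X j a) = res Y j (exp_app g (Suc j) a)"
proof -
  from g obtain f where f: "g = exp_lam X i f"
      "\<forall>j\<le>i. f j \<in> stg X j \<rightarrow> stg Y j"
      "\<forall>j<i. \<forall>a\<in>stg X (Suc j). f j (res X j a) = res Y j (f (Suc j) a)"
    by (rule exp_objE)
  have app: "exp_app g j a = f j a" if "j \<le> i" "a \<in> stg X j" for j a
    unfolding f(1) using that by (intro exp_app_exp_lam[OF X Y]) (simp_all add: f(2))
  then have "exp_lam X i (exp_app g) = exp_lam X i f" by (intro exp_lam_cong)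
  with f(1) show "exp_lam X i (exp_app g) = g" by simp
  show "exp_app g j a \<in> stg Y j" if "j \<le> i" "a \<in> stg X j"
    using f(2) that by (auto simp: app)
  show "exp_app g j (res X j a) = res Y j (exp_app g (Suc j) a)" if "j < i" "a \<in> stg X (Suc j)"
    using that f(3) by (simp add: app res_closed_in wf_tree_res_closed[OF X])
qed

lemma exp_obj_eqI:
  assumes "g \<in> stg (exp_obj X Y) i" "h \<in> stg (exp_obj X Y) i" "wf_tree X" "wf_tree Y"
    and "\<And>j a. j \<le> i \<Longrightarrow> a \<in> stg X j \<Longrightarrow> exp_app g j a = exp_app h j a"
  shows "g = h"
  using exp_lam_cong[of i X "exp_app g" "exp_app h", OF assms(5)] assms(1-4)
  by (simp add: exp_lam_exp_app)

lemma vcomp_res_exp [simp]: "j \<le> i \<Longrightarrow> vcomp (res (exp_obj X Y) i g) j = vcomp g j"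
  by (simp add: exp_obj_def)

lemma res_exp_vtup: "res (exp_obj X Y) i (vtup {..Suc i} g) = vtup {..i} g"
  by (auto simp: exp_obj_def intro!: vtup_cong)

lemma res_exp_in:
  assumes "g \<in> stg (exp_obj X Y) (Suc i)"
  shows "res (exp_obj X Y) i g \<in> stg (exp_obj X Y) i"
  using assms by (rule exp_objE) (auto simp: res_exp_vtup Pi_iff intro!: exp_lam_in)

lemma small_exp:
  assumes "\<And>j. j \<le> i \<Longrightarrow> small (stg X j)" "\<And>j. j \<le> i \<Longrightarrow> small (stg Y j)"
  shows "small (stg (exp_obj X Y) i)"
proof (rule small_subset)
  let ?Z = "\<lambda>j. {vgraph (stg X j) f | f. f \<in> stg X j \<rightarrow> stg Y j}"
  show "small {vtup {..i} x | x. \<forall>j\<in>{..i}. x j \<in> ?Z j}"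
    using small_vgraph[OF assms] by (intro small_vtup) simp
  show "stg (exp_obj X Y) i \<subseteq> {vtup {..i} x | x. \<forall>j\<in>{..i}. x j \<in> ?Z j}"
  proof
    fix g assume "g \<in> stg (exp_obj X Y) i"
    then obtain f where "g = exp_lam X i f" "\<forall>j\<le>i. f j \<in> stg X j \<rightarrow> stg Y j"
      by (rule exp_objE)
    then show "g \<in> {vtup {..i} x | x. \<forall>j\<in>{..i}. x j \<in> ?Z j}" by blast
  qed
qed


subsection \<open>Constant trees and transport\<close>

definition const_tree :: "'e tree \<Rightarrow> bool" where
  "const_tree X \<longleftrightarrow> (\<forall>i. bij_betw (res X i) (stg X (Suc i)) (stg X i))"

lemma const_treeD: "const_tree X \<Longrightarrow> bij_betw (res X i) (stg X (Suc i)) (stg X i)"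
  by (simp add: const_tree_def)

lemma const_tree_res_closed: "const_tree X \<Longrightarrow> res_closed X"
  by (auto simp: const_tree_def res_closed_def bij_betw_def)

lemma const_tree_Delta: "const_tree (Delta Z)"
  by (simp add: const_tree_def bij_betw_def inj_on_def)

lemma const_tree_box: "const_tree (box_obj X)"
  unfolding box_obj_def by (rule const_tree_Delta)

lemma const_tree_prod:
  assumes X: "const_tree X" and Y: "const_tree Y"
  shows "const_tree (prod_obj X Y)"
  unfolding const_tree_def bij_betw_def
proof (intro allI conjI)
  fix i
  note bij = const_treeD[OF X, of i] const_treeD[OF Y, of i]
  show "inj_on (res (prod_obj X Y) i) (stg (prod_obj X Y) (Suc i))"
    using bij[THEN bij_betw_imp_inj_on] by (intro inj_onI) (auto dest: inj_onD)
  show "res (prod_obj X Y) i ` stg (prod_obj X Y) (Suc i) = stg (prod_obj X Y) i"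
    unfolding stg_prod bij[THEN bij_betw_imp_surj_on, symmetric] by (force simp: image_iff)
qed

lemma const_tree_sum:
  assumes X: "const_tree X" and Y: "const_tree Y"
  shows "const_tree (sum_obj X Y)"
  unfolding const_tree_def bij_betw_def
proof (intro allI conjI)
  fix i
  note bij = const_treeD[OF X, of i] const_treeD[OF Y, of i]
  show "inj_on (res (sum_obj X Y) i) (stg (sum_obj X Y) (Suc i))"
    using bij[THEN bij_betw_imp_inj_on] by (intro inj_onI) (auto dest: inj_onD)
  show "res (sum_obj X Y) i ` stg (sum_obj X Y) (Suc i) = stg (sum_obj X Y) i"
    unfolding stg_sum bij[THEN bij_betw_imp_surj_on, symmetric]
    by (simp add: image_Un image_image)
qed

lemma inj_on_res_exp:
  assumes X: "wf_tree X" and Y: "wf_tree Y" and inj: "inj_on (res Y i) (stg Y (Suc i))"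
  shows "inj_on (res (exp_obj X Y) i) (stg (exp_obj X Y) (Suc i))"
proof (rule inj_onI)
  fix g h assume g: "g \<in> stg (exp_obj X Y) (Suc i)" and h: "h \<in> stg (exp_obj X Y) (Suc i)"
    and eq: "res (exp_obj X Y) i g = res (exp_obj X Y) i h"
  have low: "vcomp g j = vcomp h j" if "j \<le> i" for j
    using arg_cong[OF eq, of "\<lambda>z. vcomp z j"] that by simp
  show "g = h"
  proof (rule exp_obj_eqI[OF g h X Y])
    fix j a assume "j \<le> Suc i" and a: "a \<in> stg X j"
    then consider (low) "j \<le> i" | (top) "j = Suc i" by linarith
    then show "exp_app g j a = exp_app h j a"
    proof cases
      case top
      have "res Y i (exp_app g (Suc i) a) = res Y i (exp_app h (Suc i) a)"
        using a top low[of i] by (simp flip: exp_app_res[OF g X Y] exp_app_res[OF h X Y])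
      then show ?thesis
        using a top inj_onD[OF inj] exp_app_in[OF g X Y] exp_app_in[OF h X Y] by simp
    qed (simp add: low)
  qed
qed

lemma surj_on_res_exp:
  assumes X: "wf_tree X" and Y: "wf_tree Y" and surj: "res Y i ` stg Y (Suc i) = stg Y i"
    and g: "g \<in> stg (exp_obj X Y) i"
  shows "g \<in> res (exp_obj X Y) i ` stg (exp_obj X Y) (Suc i)"
proof -
  have "\<exists>b\<in>stg Y (Suc i). res Y i b = exp_app g i (res X i a)" if "a \<in> stg X (Suc i)" for a
    using exp_app_in[OF g X Y, of i "res X i a"] that surj wf_tree_res_closed[OF X]
    by (metis imageE order_refl res_closed_in)
  then obtain top where top: "\<And>a. a \<in> stg X (Suc i) \<Longrightarrow>
      top a \<in> stg Y (Suc i) \<and> res Y i (top a) = exp_app g i (res X i a)"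
    by metis
  define f where "f j = (if j \<le> i then exp_app g j else top)" for j
  have "exp_lam X (Suc i) f \<in> stg (exp_obj X Y) (Suc i)"
  proof (rule exp_lam_in)
    show "f j a \<in> stg Y j" if "j \<le> Suc i" "a \<in> stg X j" for j a
      using that top exp_app_in[OF g X Y] by (cases "j = Suc i") (auto simp: f_def)
    show "f j (res X j a) = res Y j (f (Suc j) a)" if "j < Suc i" "a \<in> stg X (Suc j)" for j a
      using that top exp_app_res[OF g X Y] by (cases "j = i") (auto simp: f_def)
  qed
  moreover have "res (exp_obj X Y) i (exp_lam X (Suc i) f) = exp_lam X i (exp_app g)"
    unfolding res_exp_vtup by (rule exp_lam_cong) (simp add: f_def)
  ultimately show ?thesis
    using exp_lam_exp_app[OF g X Y] by force
qed

lemma const_tree_exp: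
  assumes "wf_tree X" "wf_tree Y" "const_tree Y"
  shows "const_tree (exp_obj X Y)"
  unfolding const_tree_def bij_betw_def
  using assms inj_on_res_exp[OF assms(1,2)] surj_on_res_exp[OF assms(1,2)]
  by (auto simp: const_tree_def bij_betw_def res_exp_in)

lemma const_tree_restr_bij:
  assumes "const_tree X" "i \<le> j"
  shows "bij_betw (restr X i j) (stg X j) (stg X i)"
  using assms(2)
proof (induction j rule: dec_induct)
  case base
  then show ?case by (simp add: bij_betw_def inj_on_def)
next
  case (step j)
  have "bij_betw (restr X i j \<circ> res X j) (stg X (Suc j)) (stg X i)"
    using const_treeD[OF assms(1)] step.IH by (rule bij_betw_trans)
  then show ?case
    using step.hyps by (simp add: restr_Suc comp_def cong: bij_betw_cong)
qed

lemma transport_eq: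
  assumes X: "const_tree X" and y: "y \<in> stg X j" "restr X i j y = x" and "i \<le> j"
  shows "transport X i j x = y"
proof (cases "i = j")
  case False
  have "(THE z. z \<in> stg X j \<and> restr X i j z = x) = y"
    using y const_tree_restr_bij[OF X \<open>i \<le> j\<close>] by (auto simp: bij_betw_def inj_on_def)
  with False \<open>i \<le> j\<close> show ?thesis by (simp add: transport_def)
qed (use y in \<open>simp add: transport_def\<close>)

lemma transport_up:
  assumes X: "const_tree X" and "i \<le> j" "x \<in> stg X i"
  shows "transport X i j x \<in> stg X j" "restr X i j (transport X i j x) = x"
proof -
  obtain y where "y \<in> stg X j" "restr X i j y = x"
    using const_tree_restr_bij[OF assms(1,2)] assms(3) by (metis bij_betw_def imageE)
  then show "transport X i j x \<in> stg X j" "restr X i j (transport X i j x) = x"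
    using transport_eq[OF X _ _ assms(2)] by auto
qed

lemma transport_down: "j \<le> i \<Longrightarrow> transport X i j x = restr X j i x"
  by (simp add: transport_def)

lemma transport_self [simp]: "transport X i i x = x"
  by (simp add: transport_down)

lemma transport_global_elt:
  assumes "const_tree X" "global_elt X x"
  shows "transport X i j (x i) = x j"
proof (cases "i \<le> j")
  case True
  then show ?thesis
    using assms by (intro transport_eq) (simp_all add: restr_global_elt global_elt_in)
next
  case False
  then show ?thesis using assms by (simp add: transport_down restr_global_elt)
qed

lemma transport_in: "const_tree X \<Longrightarrow> x \<in> stg X i \<Longrightarrow> transport X i j x \<in> stg X j"
  by (cases "i \<le> j") (simp_all add: transport_up transport_down restr_in const_tree_res_closed)

lemma global_elt_transport:
  assumes X: "const_tree X" and x: "x \<in> stg X i"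
  shows "global_elt X (\<lambda>j. transport X i j x)"
  unfolding global_elt_def
proof (intro allI conjI)
  fix j
  show "transport X i j x \<in> stg X j"
    using assms by (rule transport_in)
  show "res X j (transport X i (Suc j) x) = transport X i j x"
  proof (cases "i \<le> j")
    case True
    note up = transport_up[OF X _ x, of "Suc j"]
    have "transport X i j x = res X j (transport X i (Suc j) x)"
      using True up by (intro transport_eq[OF X])
        (simp_all add: res_closed_in const_tree_res_closed[OF X] flip: restr_Suc)
    then show ?thesis ..
  next
    case False
    then show ?thesis by (simp add: transport_down res_restr)
  qed
qed

lemma transport_res:
  assumes X: "const_tree X" and x: "x \<in> stg X (Suc i)"
  shows "transport X i j (res X i x) = transport X (Suc i) j x"
proof -
  have "transport X (Suc i) i x = res X i x"
    by (simp add: transport_down restr_Suc)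
  then show ?thesis
    using transport_global_elt[OF X global_elt_transport[OF X x], of i j] by simp
qed


section \<open>Closed types\<close>

inductive_simps wft_simps [simp]:
  "wft n (TVar i)" "wft n TNat" "wft n TUnit" "wft n (TProd A B)" "wft n TVoid" "wft n (TSum A B)"
  "wft n (TFun A B)" "wft n (TLater A)" "wft n (TBox A)"

inductive_simps wft_TMu_iff: "wft n (TMu A)"

lemma wft_mono: "wft n A \<Longrightarrow> n \<le> m \<Longrightarrow> wft m A"
  by (induction arbitrary: m rule: wft.induct) (auto simp: wft_TMu_iff)

lemma wft_guarded: "wft n A \<Longrightarrow> n \<le> k \<Longrightarrow> guarded k A"
  by (induction arbitrary: k rule: wft.induct) auto

lemma tlift_wft: "wft n A \<Longrightarrow> n \<le> k \<Longrightarrow> tlift k A = A"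
  by (induction arbitrary: k rule: wft.induct) auto

lemma tsubst_wft: "wft n A \<Longrightarrow> n \<le> k \<Longrightarrow> tsubst k C A = A"
  by (induction arbitrary: k C rule: wft.induct) auto

lemma guarded_tsubst: "wft 0 C \<Longrightarrow> guarded l A \<Longrightarrow> l < k \<Longrightarrow> guarded l (tsubst k C A)"
  by (induction A arbitrary: k l) (auto simp: tlift_wft intro: wft_guarded)

lemma wft_tsubst:
  assumes "wft 0 C"
  shows "wft (Suc k) A \<Longrightarrow> wft k (tsubst k C A)"
proof (induction "Suc k" A arbitrary: k rule: wft.induct[case_names TVar])
  case (TVar i)
  then show ?case using assms by (auto intro: wft_mono)
qed (auto simp: assms wft_TMu_iff tlift_wft[OF assms] tsubst_wft guarded_tsubst)

lemma wft_unfold_mu: "wft 0 (TMu A) \<Longrightarrow> wft 0 (unfold_mu A)"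
  using wft_tsubst[of "TMu A" 0 A] by (simp add: wft_TMu_iff)

lemma const_ty_tsubst: "wft 0 C \<Longrightarrow> const_ty C \<Longrightarrow> const_ty A \<Longrightarrow> const_ty (tsubst k C A)"
  by (induction A arbitrary: k) (auto simp: tlift_wft)

lemma const_ty_unfold_mu: "wft 0 (TMu A) \<Longrightarrow> const_ty (TMu A) \<Longrightarrow> const_ty (unfold_mu A)"
  by (rule const_ty_tsubst) auto

primrec box_depth :: "ty \<Rightarrow> nat" where
  "box_depth (TVar i) = 0"
| "box_depth TNat = 0"
| "box_depth TUnit = 0"
| "box_depth (TProd A B) = max (box_depth A) (box_depth B)"
| "box_depth TVoid = 0"
| "box_depth (TSum A B) = max (box_depth A) (box_depth B)"
| "box_depth (TFun A B) = max (box_depth A) (box_depth B)"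
| "box_depth (TMu A) = box_depth A"
| "box_depth (TLater A) = box_depth A"
| "box_depth (TBox A) = Suc (box_depth A)"

primrec unguarded_size :: "ty \<Rightarrow> nat" where
  "unguarded_size (TVar i) = 0"
| "unguarded_size TNat = 0"
| "unguarded_size TUnit = 0"
| "unguarded_size (TProd A B) = Suc (unguarded_size A + unguarded_size B)"
| "unguarded_size TVoid = 0"
| "unguarded_size (TSum A B) = Suc (unguarded_size A + unguarded_size B)"
| "unguarded_size (TFun A B) = Suc (unguarded_size A + unguarded_size B)"
| "unguarded_size (TMu A) = Suc (unguarded_size A)"
| "unguarded_size (TLater A) = 0"
| "unguarded_size (TBox A) = 0"

lemma box_depth_tsubst:
  "wft n A \<Longrightarrow> wft 0 C \<Longrightarrow> box_depth A \<le> d \<Longrightarrow> box_depth C \<le> d \<Longrightarrow>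
   box_depth (tsubst k C A) \<le> d"
  by (induction arbitrary: k rule: wft.induct) (auto simp: tlift_wft tsubst_wft)

lemma unguarded_size_tsubst:
  "guarded k A \<Longrightarrow> unguarded_size (tsubst k C A) = unguarded_size A"
  by (induction A arbitrary: k C) auto

definition ty_order :: "((ty \<times> nat) \<times> (ty \<times> nat)) set" where
  "ty_order = inv_image (less_than <*lex*> less_than <*lex*> less_than)
     (\<lambda>(A, i). (box_depth A, i, unguarded_size A))"

lemma wf_ty_order: "wf ty_order"
  unfolding ty_order_def by (intro wf_inv_image wf_lex_prod wf_less_than)

lemma ty_order_iff:
  "((A, i), (B, j)) \<in> ty_order \<longleftrightarrow> box_depth A < box_depth B \<or>
     box_depth A = box_depth B \<and> (i < j \<or> i = j \<and> unguarded_size A < unguarded_size B)"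
  by (simp add: ty_order_def)

lemma ty_order_component [simp]:
  "((A, i), (TProd A B, i)) \<in> ty_order" "((B, i), (TProd A B, i)) \<in> ty_order"
  "((A, i), (TSum A B, i)) \<in> ty_order" "((B, i), (TSum A B, i)) \<in> ty_order"
  "j \<le> i \<Longrightarrow> ((A, j), (TFun A B, i)) \<in> ty_order" "j \<le> i \<Longrightarrow> ((B, j), (TFun A B, i)) \<in> ty_order"
  "j < i \<Longrightarrow> ((A, j), (TLater A, i)) \<in> ty_order" "((A, j), (TBox A, i)) \<in> ty_order"
  by (auto simp: ty_order_iff)

text \<open>
  Unfolding a recursive type is decreasing because its variable is guarded, so it does not count
  for \<open>unguarded_size\<close>, and cannot occur beneath a box, so \<open>box_depth\<close> does not grow.
\<close>

lemma ty_order_unfold_mu: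
  assumes "wft 0 (TMu A)"
  shows "((unfold_mu A, i), (TMu A, i)) \<in> ty_order"
proof -
  have "wft (Suc 0) A" "guarded 0 A"
    using assms by (simp_all add: wft_TMu_iff)
  then show ?thesis
    using box_depth_tsubst[of "Suc 0" A "TMu A" "box_depth A" 0] assms
    by (auto simp: ty_order_iff unguarded_size_tsubst)
qed

lemma closed_ty_induct [consumes 1, case_names Nat Unit Void Prod Sum Fun Mu Later Box]:
  fixes P :: "ty \<Rightarrow> nat \<Rightarrow> bool"
  assumes "wft 0 A"
    and Nat: "\<And>i. P TNat i" and Unit: "\<And>i. P TUnit i" and Void: "\<And>i. P TVoid i"
    and Prod: "\<And>A B i. wft 0 A \<Longrightarrow> wft 0 B \<Longrightarrow> P A i \<Longrightarrow> P B i \<Longrightarrow> P (TProd A B) i"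
    and Sum: "\<And>A B i. wft 0 A \<Longrightarrow> wft 0 B \<Longrightarrow> P A i \<Longrightarrow> P B i \<Longrightarrow> P (TSum A B) i"
    and Fun: "\<And>A B i. wft 0 A \<Longrightarrow> wft 0 B \<Longrightarrow> (\<And>j. j \<le> i \<Longrightarrow> P A j) \<Longrightarrow>
      (\<And>j. j \<le> i \<Longrightarrow> P B j) \<Longrightarrow> P (TFun A B) i"
    and Mu: "\<And>A i. wft 0 (TMu A) \<Longrightarrow> P (unfold_mu A) i \<Longrightarrow> P (TMu A) i"
    and Later: "\<And>A i. wft 0 A \<Longrightarrow> (\<And>j. j < i \<Longrightarrow> P A j) \<Longrightarrow> P (TLater A) i"
    and Box: "\<And>A i. wft 0 A \<Longrightarrow> (\<And>j. P A j) \<Longrightarrow> P (TBox A) i"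
  shows "P A i"
  using assms(1)
proof (induction "(A, i)" arbitrary: A i rule: wf_induct_rule[OF wf_ty_order, case_names less])
  case less
  note IH = less.hyps
  show ?case
  proof (cases A)
    case TVar
    then show ?thesis using less.prems by simp
  next
    case (TProd B C)
    then show ?thesis using less.prems by (simp add: Prod IH)
  next
    case (TSum B C)
    then show ?thesis using less.prems by (simp add: Sum IH)
  next
    case (TFun B C)
    then show ?thesis using less.prems by (simp add: Fun IH)
  next
    case (TMu B)
    then show ?thesis using less.prems by (simp add: Mu IH ty_order_unfold_mu wft_unfold_mu)
  next
    case (TLater B)
    then show ?thesis using less.prems by (simp add: Later IH)
  next
    case (TBox B)
    then show ?thesis using less.prems by (simp add: Box IH)
  qed (simp_all add: Nat Unit Void)
qed

lemma tden_simps [simp]: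
  "tden TNat = nat_obj" "tden TUnit = one_obj" "tden TVoid = zero_obj"
  "tden (TProd A B) = prod_obj (tden A) (tden B)"
  "tden (TSum A B) = sum_obj (tden A) (tden B)"
  "tden (TFun A B) = exp_obj (tden A) (tden B)"
  "tden (TLater A) = later_obj (tden A)"
  "tden (TBox A) = box_obj (tden A)"
  by (simp_all add: tden_def)

lemmas tden_TMu = tden_unfold_mu[symmetric]

lemma small_tden: "wft 0 A \<Longrightarrow> small (stg (tden A :: 'v::set_universe tree) i)"
proof (induction A i rule: closed_ty_induct)
  case (Prod A B i)
  then show ?case by (simp add: small_vpair)
next
  case (Sum A B i)
  let ?Z = "{vpair a b | a b. a \<in> range vnat \<and> b \<in> stg (tden A :: 'v tree) i \<union> stg (tden B) i}"
  have "small ?Z"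
    by (intro small_vpair small_Un Sum small_countable) simp
  then show ?case
    by (rule small_subset) (auto simp: vinl_def vinr_def)
next
  case (Fun A B i)
  then show ?case by (simp add: small_exp)
next
  case (Mu A i)
  then show ?case by (simp only: tden_TMu)
next
  case (Later A i)
  then show ?case by (cases i) (simp_all add: small_finite)
next
  case (Box A i)
  then have "small {vtup UNIV x | x. \<forall>j\<in>UNIV. x j \<in> stg (tden A :: 'v tree) j}"
    by (intro small_vtup)
  then show ?case
    by (rule small_subset) (auto simp: stg_box global_elt_in)
qed (simp_all add: nat_obj_def one_obj_def zero_obj_def small_countable)

lemma res_tden_in:
  "wft 0 A \<Longrightarrow> x \<in> stg (tden A) (Suc i) \<Longrightarrow> res (tden A) i x \<in> stg (tden A) i"
proof (induction A i arbitrary: x rule: closed_ty_induct)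
  case (Fun A B i)
  then show ?case by (simp add: res_exp_in)
next
  case (Mu A i)
  then show ?case by (simp only: tden_TMu)
next
  case (Later A i)
  then show ?case by (cases i) simp_all
next
  case (Box A i)
  then show ?case by (simp add: stg_box)
qed (auto simp: nat_obj_def one_obj_def zero_obj_def)

lemma wf_tree_tden: "wft 0 A \<Longrightarrow> wf_tree (tden A)"
  by (simp add: wf_tree_def res_closed_def small_tden res_tden_in)

lemmas res_closed_tden = wf_tree_tden[THEN wf_tree_res_closed]

lemma const_tree_tden: "wft 0 A \<Longrightarrow> const_ty A \<Longrightarrow> const_tree (tden A)"
proof (induction A "0::nat" rule: closed_ty_induct)
  case (Prod A B)
  then show ?case by (simp add: const_tree_prod)
next
  case (Sum A B)
  then show ?case by (simp add: const_tree_sum)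
next
  case (Fun A B)
  then show ?case by (simp add: const_tree_exp wf_tree_tden)
next
  case (Mu A)
  then show ?case using const_ty_unfold_mu by (simp only: tden_TMu)
qed (simp_all add: nat_obj_def one_obj_def zero_obj_def const_tree_Delta const_tree_box)


section \<open>A logical relation between types\<close>

text \<open>
  Types with distinct head constructors are unrelated: two derivations for the same term agree on
  the head constructor wherever a typing rule inspects or determines it.
\<close>

function rel :: "ty \<Rightarrow> ty \<Rightarrow> nat \<Rightarrow> 'v::set_universe \<Rightarrow> 'v \<Rightarrow> bool" where
  "rel (TVar k) B i x y \<longleftrightarrow> False"
| "rel TNat B i x y \<longleftrightarrow> B = TNat \<and> x = y \<and> y \<in> range vnat"
| "rel TUnit B i x y \<longleftrightarrow> B = TUnit \<and> x = vunit \<and> y = vunit"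
| "rel (TProd A1 A2) B i x y \<longleftrightarrow> (\<exists>B1 B2 x1 x2 y1 y2. B = TProd B1 B2 \<and>
     x = vpair x1 x2 \<and> y = vpair y1 y2 \<and> rel A1 B1 i x1 y1 \<and> rel A2 B2 i x2 y2)"
| "rel TVoid B i x y \<longleftrightarrow> False"
| "rel (TSum A1 A2) B i x y \<longleftrightarrow> (\<exists>B1 B2. B = TSum B1 B2 \<and>
     ((\<exists>a b. x = vinl a \<and> y = vinl b \<and> rel A1 B1 i a b) \<or>
      (\<exists>a b. x = vinr a \<and> y = vinr b \<and> rel A2 B2 i a b)))"
| "rel (TFun A1 A2) B i x y \<longleftrightarrow> (\<exists>B1 B2. B = TFun B1 B2 \<and>
     x \<in> stg (exp_obj (tden A1) (tden A2)) i \<and> y \<in> stg (exp_obj (tden B1) (tden B2)) i \<and>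
     (\<forall>j\<in>{..i}. \<forall>a b. rel A1 B1 j a b \<longrightarrow> rel A2 B2 j (exp_app x j a) (exp_app y j b)))"
| rel_TMu: "rel (TMu A) B i x y \<longleftrightarrow>
     (if wft 0 (TMu A) then \<exists>B'. B = TMu B' \<and> rel (unfold_mu A) (unfold_mu B') i x y else False)"
| "rel (TLater A) B i x y \<longleftrightarrow> (\<exists>B'. B = TLater B' \<and>
     (case i of 0 \<Rightarrow> x = vunit \<and> y = vunit | Suc j \<Rightarrow> rel A B' j x y))"
| "rel (TBox A) B i x y \<longleftrightarrow> (\<exists>B'. B = TBox B' \<and>
     x \<in> stg (box_obj (tden A)) i \<and> y \<in> stg (box_obj (tden B')) i \<and>
     (\<forall>j. rel A B' j (vcomp x j) (vcomp y j)))"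
  by pat_completeness auto
termination
  by (relation "inv_image ty_order (\<lambda>(A, B, i, x, y). (A, i))")
    (simp_all add: wf_ty_order ty_order_unfold_mu)

declare rel_TMu [simp del]

lemma rel_TMu_iff:
  "wft 0 (TMu A) \<Longrightarrow>
   rel (TMu A) B i x y \<longleftrightarrow> (\<exists>B'. B = TMu B' \<and> rel (unfold_mu A) (unfold_mu B') i x y)"
  by (simp add: rel_TMu)

lemma rel_in:
  assumes "wft 0 A" "wft 0 B" "rel A B i x y"
  shows "x \<in> stg (tden A) i \<and> y \<in> stg (tden B) i"
  using assms
proof (induction A i arbitrary: B x y rule: closed_ty_induct)
  case (Mu A i)
  then obtain B' where "B = TMu B'" "rel (unfold_mu A) (unfold_mu B') i x y"
    by (auto simp: rel_TMu_iff)
  with Mu have "x \<in> stg (tden (unfold_mu A)) i \<and> y \<in> stg (tden (unfold_mu B')) i"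
    by (intro Mu.IH) (simp_all add: wft_unfold_mu)
  with Mu \<open>B = TMu B'\<close> show ?case by (simp add: tden_TMu)
next
  case (Later A i)
  then show ?case by (cases i) auto
qed (auto simp: nat_obj_def one_obj_def)

lemma rel_same: "wft 0 A \<Longrightarrow> rel A A i x y \<longleftrightarrow> x = y \<and> x \<in> stg (tden A) i"
proof (induction A i arbitrary: x y rule: closed_ty_induct)
  case (Fun A B i)
  note wf = Fun.hyps[THEN wf_tree_tden]
  have "rel (TFun A B) (TFun A B) i x y \<longleftrightarrow>
      x \<in> stg (exp_obj (tden A) (tden B)) i \<and> y \<in> stg (exp_obj (tden A) (tden B)) i \<and>
      (\<forall>j\<le>i. \<forall>a\<in>stg (tden A) j. exp_app x j a = exp_app y j a)"
    using exp_app_in[OF _ wf] by (auto simp: Fun.IH)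
  also have "\<dots> \<longleftrightarrow> x = y \<and> x \<in> stg (exp_obj (tden A) (tden B)) i"
    using exp_obj_eqI[OF _ _ wf] by blast
  finally show ?case by simp
next
  case (Mu A i)
  then show ?case by (simp add: rel_TMu_iff tden_TMu)
next
  case (Later A i)
  then show ?case by (cases i) auto
next
  case (Box A i)
  then show ?case by (auto simp: stg_box vtup_eq_iff global_elt_in)
qed (auto simp: nat_obj_def one_obj_def zero_obj_def)

lemma rel_res:
  fixes x y :: "'v::set_universe"
  assumes "wft 0 A" "wft 0 B" "rel A B (Suc i) x y"
  shows "rel A B i (res (tden A) i x) (res (tden B) i y)"
  using assms
proof (induction A i arbitrary: B x y rule: closed_ty_induct)
  case (Fun A1 A2 i)
  then show ?case by (auto simp: res_exp_in)
next
  case (Mu A i)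
  then obtain B' where B: "B = TMu B'" "rel (unfold_mu A) (unfold_mu B') (Suc i) x y"
    by (auto simp: rel_TMu_iff)
  with Mu show ?case
    using wft_unfold_mu by (simp add: rel_TMu_iff tden_TMu)
next
  case (Later A i)
  then show ?case by (cases i) auto
next
  case (Box A i)
  then show ?case by (auto simp: stg_box)
qed (auto simp: nat_obj_def one_obj_def)

lemma rel_restr:
  assumes "wft 0 A" "wft 0 B" "i \<le> j" "rel A B j x y"
  shows "rel A B i (restr (tden A) i j x) (restr (tden B) i j y)"
  using assms(3,4) by (induction j arbitrary: x y rule: dec_induct)
    (simp_all add: restr_Suc rel_res[OF assms(1,2)])

lemma rel_of_rel_res:
  fixes x y :: "'v::set_universe"
  assumes "wft 0 A" "wft 0 B" "const_ty A" "const_ty B"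
    "x \<in> stg (tden A) (Suc i)" "y \<in> stg (tden B) (Suc i)"
    "rel A B i (res (tden A) i x) (res (tden B) i y)"
  shows "rel A B (Suc i) x y"
  using assms
proof (induction A i arbitrary: B x y rule: closed_ty_induct)
  case (Fun A1 A2 i)
  then obtain B1 B2 where B: "B = TFun B1 B2" by auto
  have x: "x \<in> stg (exp_obj (tden A1) (tden A2)) (Suc i)"
    and y: "y \<in> stg (exp_obj (tden B1) (tden B2)) (Suc i)"
    using Fun.prems B by auto
  note wfA = Fun.hyps[THEN wf_tree_tden]
  have wftB: "wft 0 B1" "wft 0 B2" using Fun.prems(1) B by auto
  note wfB = this[THEN wf_tree_tden]
  have low: "rel A2 B2 j (exp_app x j a) (exp_app y j b)" if "j \<le> i" "rel A1 B1 j a b" for j a b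
    using Fun.prems(6) that by (auto simp: B)
  have "rel A2 B2 (Suc i) (exp_app x (Suc i) a) (exp_app y (Suc i) b)"
    if "rel A1 B1 (Suc i) a b" for a b
  proof (rule Fun.IH(2))
    note ab = rel_in[OF Fun.hyps(1) wftB(1) that]
    show "exp_app x (Suc i) a \<in> stg (tden A2) (Suc i)" "exp_app y (Suc i) b \<in> stg (tden B2) (Suc i)"
      using ab exp_app_in[OF x wfA] exp_app_in[OF y wfB] by auto
    have "rel A2 B2 i (exp_app x i (res (tden A1) i a)) (exp_app y i (res (tden B1) i b))"
      by (intro low rel_res Fun.hyps wftB that) simp
    then show "rel A2 B2 i (res (tden A2) i (exp_app x (Suc i) a))
        (res (tden B2) i (exp_app y (Suc i) b))"
      using ab by (simp add: exp_app_res[OF x wfA] exp_app_res[OF y wfB])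
  qed (use Fun.prems B wftB in auto)
  with low x y show ?case by (auto simp: B le_Suc_eq)
next
  case (Mu A i)
  then obtain B' where B: "B = TMu B'"
      "rel (unfold_mu A) (unfold_mu B') i (res (tden (TMu A)) i x) (res (tden B) i y)"
    by (auto simp: rel_TMu_iff)
  with Mu have "rel (unfold_mu A) (unfold_mu B') (Suc i) x y"
    by (intro Mu.IH) (simp_all add: wft_unfold_mu const_ty_unfold_mu flip: tden_TMu)
  with Mu B(1) show ?case by (simp add: rel_TMu_iff)
next
  case (Box A i)
  then show ?case by (auto simp: stg_box)
qed (auto simp: nat_obj_def one_obj_def)

lemma rel_of_rel_restr:
  assumes "wft 0 A" "wft 0 B" "const_ty A" "const_ty B" "i \<le> j"
    "x \<in> stg (tden A) j" "y \<in> stg (tden B) j"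
    "rel A B i (restr (tden A) i j x) (restr (tden B) i j y)"
  shows "rel A B j x y"
  using assms(5-8)
proof (induction j arbitrary: x y rule: dec_induct)
  case (step j)
  then show ?case
    using assms(1-4) by (intro rel_of_rel_res step.IH) (simp_all add: restr_Suc res_tden_in)
qed simp

lemma rel_transport:
  assumes "wft 0 A" "wft 0 B" "const_ty A" "const_ty B" "rel A B i x y"
  shows "rel A B j (transport (tden A) i j x) (transport (tden B) i j y)"
proof (cases "i \<le> j")
  case True
  with assms rel_in[OF assms(1,2,5)] show ?thesis
    by (intro rel_of_rel_restr[of A B i j]) (simp_all add: transport_up const_tree_tden)
next
  case False
  then show ?thesis using assms by (simp add: transport_down rel_restr)
qed


section \<open>Natural families of maps\<close>

text \<open>
  Unlike \<open>hom\<close>, naturality leaves the values outside the stages unspecified.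
\<close>

definition natural :: "'a tree \<Rightarrow> 'b tree \<Rightarrow> (nat \<Rightarrow> 'a \<Rightarrow> 'b) \<Rightarrow> bool" where
  "natural X Y f \<longleftrightarrow> (\<forall>i. \<forall>x\<in>stg X i. f i x \<in> stg Y i) \<and>
     (\<forall>i. \<forall>x\<in>stg X (Suc i). f i (res X i x) = res Y i (f (Suc i) x))"

definition natural2 :: "'a tree \<Rightarrow> 'b tree \<Rightarrow> 'c tree \<Rightarrow> (nat \<Rightarrow> 'a \<Rightarrow> 'b \<Rightarrow> 'c) \<Rightarrow> bool" where
  "natural2 X Y Z f \<longleftrightarrow> (\<forall>i. \<forall>x\<in>stg X i. \<forall>y\<in>stg Y i. f i x y \<in> stg Z i) \<and>
     (\<forall>i. \<forall>x\<in>stg X (Suc i). \<forall>y\<in>stg Y (Suc i).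
        f i (res X i x) (res Y i y) = res Z i (f (Suc i) x y))"

lemma naturalI:
  assumes "\<And>i x. x \<in> stg X i \<Longrightarrow> f i x \<in> stg Y i"
    and "\<And>i x. x \<in> stg X (Suc i) \<Longrightarrow> f i (res X i x) = res Y i (f (Suc i) x)"
  shows "natural X Y f"
  using assms by (simp add: natural_def)

lemma natural_in: "natural X Y f \<Longrightarrow> x \<in> stg X i \<Longrightarrow> f i x \<in> stg Y i"
  and natural_res: "natural X Y f \<Longrightarrow> x \<in> stg X (Suc i) \<Longrightarrow> f i (res X i x) = res Y i (f (Suc i) x)"
  by (simp_all add: natural_def)

lemma natural2_in: "natural2 X Y Z f \<Longrightarrow> x \<in> stg X i \<Longrightarrow> y \<in> stg Y i \<Longrightarrow> f i x y \<in> stg Z i"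
  and natural2_res: "natural2 X Y Z f \<Longrightarrow> x \<in> stg X (Suc i) \<Longrightarrow> y \<in> stg Y (Suc i) \<Longrightarrow>
    f i (res X i x) (res Y i y) = res Z i (f (Suc i) x y)"
  by (simp_all add: natural2_def)

lemma natural_restr:
  assumes "natural X Y f" "res_closed X" "i \<le> j" "x \<in> stg X j"
  shows "f i (restr X i j x) = restr Y i j (f j x)"
  using assms(3,4) by (induction j arbitrary: x rule: dec_induct)
    (simp_all add: restr_Suc res_closed_in[OF assms(2)] natural_res[OF assms(1)])

lemma global_elt_natural: "natural X Y f \<Longrightarrow> global_elt X x \<Longrightarrow> global_elt Y (\<lambda>j. f j (x j))"
  unfolding global_elt_def by (metis natural_in natural_res)

lemma natural_zero: "natural X nat_obj (\<lambda>i x. vnat 0)"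
  by (rule naturalI) (simp_all add: nat_obj_def)

lemma natural_succ: "natural X nat_obj f \<Longrightarrow> natural X nat_obj (\<lambda>i x. vsucc (f i x))"
  by (simp add: natural_def nat_obj_def vsucc_in_range_vnat)

lemma natural_unit: "natural X one_obj (\<lambda>i x. vunit)"
  by (rule naturalI) (simp_all add: one_obj_def)

lemma natural_abort: "natural X zero_obj f \<Longrightarrow> natural X Y g"
  by (simp add: natural_def zero_obj_def)

lemma natural_pair:
  "natural X Y f \<Longrightarrow> natural X Z g \<Longrightarrow> natural X (prod_obj Y Z) (\<lambda>i x. vpair (f i x) (g i x))"
  by (simp add: natural_def)

lemma natural_fst:
  assumes "natural X (prod_obj Y Z) f"
  shows "natural X Y (\<lambda>i x. vfst (f i x))"
proof (rule naturalI)
  show "vfst (f i x) \<in> stg Y i" if "x \<in> stg X i" for i x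
    using natural_in[OF assms that] by auto
  show "vfst (f i (res X i x)) = res Y i (vfst (f (Suc i) x))" if "x \<in> stg X (Suc i)" for i x
    using natural_in[OF assms that] natural_res[OF assms that] by auto
qed

lemma natural_snd:
  assumes "natural X (prod_obj Y Z) f"
  shows "natural X Z (\<lambda>i x. vsnd (f i x))"
proof (rule naturalI)
  show "vsnd (f i x) \<in> stg Z i" if "x \<in> stg X i" for i x
    using natural_in[OF assms that] by auto
  show "vsnd (f i (res X i x)) = res Z i (vsnd (f (Suc i) x))" if "x \<in> stg X (Suc i)" for i x
    using natural_in[OF assms that] natural_res[OF assms that] by auto
qed

lemma natural_inl: "natural X Y f \<Longrightarrow> natural X (sum_obj Y Z) (\<lambda>i x. vinl (f i x))"
  and natural_inr: "natural X Z g \<Longrightarrow> natural X (sum_obj Y Z) (\<lambda>i x. vinr (g i x))"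
  by (simp_all add: natural_def)

lemma natural_case:
  assumes f: "natural X (sum_obj Y Z) f" and g: "natural2 Y X W g" and h: "natural2 Z X W h"
  shows "natural X W (\<lambda>i x. vcase (\<lambda>a. g i a x) (\<lambda>b. h i b x) (f i x))"
proof (rule naturalI)
  show "vcase (\<lambda>a. g i a x) (\<lambda>b. h i b x) (f i x) \<in> stg W i" if "x \<in> stg X i" for i x
    using natural_in[OF f that] that by (auto simp: natural2_in[OF g] natural2_in[OF h])
  show "vcase (\<lambda>a. g i a (res X i x)) (\<lambda>b. h i b (res X i x)) (f i (res X i x)) =
      res W i (vcase (\<lambda>a. g (Suc i) a x) (\<lambda>b. h (Suc i) b x) (f (Suc i) x))"
    if "x \<in> stg X (Suc i)" for i x
    using natural_in[OF f that] that
    by (auto simp: natural_res[OF f] natural2_res[OF g] natural2_res[OF h])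
qed

lemma natural_lam:
  assumes f: "natural2 Y X Z f" and X: "res_closed X"
  shows "natural X (exp_obj Y Z) (\<lambda>i x. exp_lam Y i (\<lambda>j a. f j a (restr X j i x)))"
proof (rule naturalI)
  fix i x assume x: "x \<in> stg X i"
  show "exp_lam Y i (\<lambda>j a. f j a (restr X j i x)) \<in> stg (exp_obj Y Z) i"
  proof (rule exp_lam_in)
    show "f j a (restr X j i x) \<in> stg Z j" if "j \<le> i" "a \<in> stg Y j" for j a
      using that x by (simp add: natural2_in[OF f] restr_in[OF X])
    show "f j (res Y j a) (restr X j i x) = res Z j (f (Suc j) a (restr X (Suc j) i x))"
      if "j < i" "a \<in> stg Y (Suc j)" for j a
      using natural2_res[OF f that(2) restr_in[OF X _ x]] that by (simp add: res_restr)
  qed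
next
  fix i x assume "x \<in> stg X (Suc i)"
  show "exp_lam Y i (\<lambda>j a. f j a (restr X j i (res X i x))) =
      res (exp_obj Y Z) i (exp_lam Y (Suc i) (\<lambda>j a. f j a (restr X j (Suc i) x)))"
    unfolding res_exp_vtup by (rule exp_lam_cong) (simp add: restr_Suc)
qed

lemma natural_app:
  assumes f: "natural X (exp_obj Y Z) f" and g: "natural X Y g" and wf: "wf_tree Y" "wf_tree Z"
  shows "natural X Z (\<lambda>i x. exp_app (f i x) i (g i x))"
proof (rule naturalI)
  show "exp_app (f i x) i (g i x) \<in> stg Z i" if "x \<in> stg X i" for i x
    using exp_app_in[OF natural_in[OF f that] wf] natural_in[OF g that] by simp
  show "exp_app (f i (res X i x)) i (g i (res X i x)) =
      res Z i (exp_app (f (Suc i) x) (Suc i) (g (Suc i) x))"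
    if "x \<in> stg X (Suc i)" for i x
    using exp_app_res[OF natural_in[OF f that] wf] natural_in[OF g that]
    by (simp add: natural_res[OF f that] natural_res[OF g that])
qed

lemma natural_next:
  assumes f: "natural X Y f" and Y: "res_closed Y"
  shows "natural X (later_obj Y) (\<lambda>i x. next_map Y i (f i x))"
proof (rule naturalI)
  show "next_map Y i (f i x) \<in> stg (later_obj Y) i" if "x \<in> stg X i" for i x
    using natural_in[OF f that] by (cases i) (simp_all add: next_map_def res_closed_in[OF Y])
  show "next_map Y i (f i (res X i x)) = res (later_obj Y) i (next_map Y (Suc i) (f (Suc i) x))"
    if "x \<in> stg X (Suc i)" for i x
    using natural_res[OF f that] by (cases i) (simp_all add: next_map_def)
qed

lemma natural_later_app:
  assumes f: "natural X (later_obj (exp_obj Y Z)) f" and g: "natural X (later_obj Y) g"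
    and wf: "wf_tree Y" "wf_tree Z"
  shows "natural X (later_obj Z) (\<lambda>i x. case i of 0 \<Rightarrow> vunit | Suc j \<Rightarrow> exp_app (f i x) j (g i x))"
    (is "natural _ _ ?h")
proof (rule naturalI)
  show "?h i x \<in> stg (later_obj Z) i" if "x \<in> stg X i" for i x
    using exp_app_in[OF _ wf, of "f i x"] natural_in[OF f that] natural_in[OF g that]
    by (cases i) simp_all
  show "?h i (res X i x) = res (later_obj Z) i (?h (Suc i) x)" if "x \<in> stg X (Suc i)" for i x
  proof (cases i)
    case (Suc n)
    then have "f (Suc i) x \<in> stg (exp_obj Y Z) (Suc n)" "g (Suc i) x \<in> stg Y (Suc n)"
      using natural_in[OF f that] natural_in[OF g that] by simp_all
    then show ?thesis
      using exp_app_res[OF _ wf] natural_res[OF f that] natural_res[OF g that] by (simp add: Suc)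
  qed simp
qed

lemma natural_unbox:
  assumes f: "natural X (box_obj Y) f"
  shows "natural X Y (\<lambda>i x. unbox_map i (f i x))"
proof (rule naturalI)
  show "unbox_map i (f i x) \<in> stg Y i" if "x \<in> stg X i" for i x
    using natural_in[OF f that] by (auto simp: stg_box unbox_map_def global_elt_in)
  show "unbox_map i (f i (res X i x)) = res Y i (unbox_map (Suc i) (f (Suc i) x))"
    if "x \<in> stg X (Suc i)" for i x
    using natural_in[OF f that]
    by (auto simp: natural_res[OF f that] stg_box unbox_map_def global_elt_res)
qed

definition natural_global :: "'a tree \<Rightarrow> 'b tree \<Rightarrow> (nat \<Rightarrow> 'a \<Rightarrow> nat \<Rightarrow> 'b) \<Rightarrow> bool" where
  "natural_global X Y f \<longleftrightarrow> (\<forall>i. \<forall>x\<in>stg X i. global_elt Y (f i x)) \<and>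
     (\<forall>i. \<forall>x\<in>stg X (Suc i). f i (res X i x) = f (Suc i) x)"

lemma natural_global_elt: "natural_global X Y f \<Longrightarrow> x \<in> stg X i \<Longrightarrow> global_elt Y (f i x)"
  and natural_global_res: "natural_global X Y f \<Longrightarrow> x \<in> stg X (Suc i) \<Longrightarrow> f i (res X i x) = f (Suc i) x"
  by (simp_all add: natural_global_def)

lemma natural_global_comp:
  "natural_global X Y f \<Longrightarrow> natural Y Z g \<Longrightarrow> natural_global X Z (\<lambda>i x j. g j (f i x j))"
  by (simp add: natural_global_def global_elt_natural)

lemma natural_prev:
  assumes "natural_global X (later_obj Y) f"
  shows "natural X Y (\<lambda>i x. f i x (Suc i))"
proof (rule naturalI)
  show "f i x (Suc i) \<in> stg Y i" if "x \<in> stg X i" for i x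
    using global_elt_in[OF natural_global_elt[OF assms that], of "Suc i"] by simp
  show "f i (res X i x) (Suc i) = res Y i (f (Suc i) x (Suc (Suc i)))"
    if "x \<in> stg X (Suc i)" for i x
    using global_elt_res[OF natural_global_elt[OF assms that], of "Suc i"]
    by (simp add: natural_global_res[OF assms that])
qed

lemma natural_box: "natural_global X Y f \<Longrightarrow> natural X (box_obj Y) (\<lambda>i x. vtup UNIV (f i x))"
  by (rule naturalI) (simp_all add: vtup_in_box_iff natural_global_elt natural_global_res)

lemma boxplus_den_simps [simp]:
  "boxplus_den (\<lambda>j. vinl (a j)) = vinl (vtup UNIV a)"
  "boxplus_den (\<lambda>j. vinr (b j)) = vinr (vtup UNIV b)"
  by (simp_all add: boxplus_den_def)

lemma boxplus_den_in:
  assumes "global_elt (sum_obj X Y) x"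
  shows "boxplus_den x \<in> stg (sum_obj (box_obj X) (box_obj Y)) i"
  using assms by (cases rule: global_elt_sumE) (simp_all add: vtup_in_box_iff)

lemma res_sum_box:
  "x \<in> stg (sum_obj (box_obj X) (box_obj Y)) i \<Longrightarrow> res (sum_obj (box_obj X) (box_obj Y)) j x = x"
  by auto

lemma natural_boxplus:
  assumes f: "natural_global X (sum_obj Y Z) f"
  shows "natural X (sum_obj (box_obj Y) (box_obj Z)) (\<lambda>i x. boxplus_den (f i x))"
proof (rule naturalI)
  show "boxplus_den (f i x) \<in> stg (sum_obj (box_obj Y) (box_obj Z)) i" if "x \<in> stg X i" for i x
    using natural_global_elt[OF f that] by (rule boxplus_den_in)
  show "boxplus_den (f i (res X i x)) =
      res (sum_obj (box_obj Y) (box_obj Z)) i (boxplus_den (f (Suc i) x))"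
    if "x \<in> stg X (Suc i)" for i x
    unfolding natural_global_res[OF f that]
    by (rule res_sum_box[symmetric, OF boxplus_den_in[OF natural_global_elt[OF f that]]])
qed


section \<open>Contexts\<close>

type_synonym 'v mor = "nat \<Rightarrow> 'v list \<Rightarrow> 'v"

abbreviation wf_ctx :: "ty list \<Rightarrow> bool" where
  "wf_ctx \<Gamma> \<equiv> list_all (wft 0) \<Gamma>"

lemma wf_ctx_nth: "wf_ctx \<Gamma> \<Longrightarrow> k < length \<Gamma> \<Longrightarrow> wft 0 (\<Gamma> ! k)"
  by (simp add: list_all_length)

lemma ctx_den_iff:
  "\<gamma> \<in> stg (ctx_den \<Gamma>) i \<longleftrightarrow> length \<gamma> = length \<Gamma> \<and> (\<forall>k<length \<Gamma>. \<gamma> ! k \<in> stg (tden (\<Gamma> ! k)) i)"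
  by (simp add: ctx_den_def)

lemma ctx_den_Nil [simp]: "stg (ctx_den []) i = {[]}" "res (ctx_den []) i \<gamma> = []"
  by (auto simp: ctx_den_def)

lemma ctx_den_Cons [simp]:
  "a # \<gamma> \<in> stg (ctx_den (A # \<Gamma>)) i \<longleftrightarrow> a \<in> stg (tden A) i \<and> \<gamma> \<in> stg (ctx_den \<Gamma>) i"
  "res (ctx_den (A # \<Gamma>)) i (a # \<gamma>) = res (tden A) i a # res (ctx_den \<Gamma>) i \<gamma>"
  by (auto simp: ctx_den_def nth_Cons split: nat.splits)

lemma length_ctx_den: "\<gamma> \<in> stg (ctx_den \<Gamma>) i \<Longrightarrow> length \<gamma> = length \<Gamma>"
  by (simp add: ctx_den_iff)

lemma res_ctx_nth:
  "length \<gamma> = length \<Gamma> \<Longrightarrow> k < length \<Gamma> \<Longrightarrow> res (ctx_den \<Gamma>) i \<gamma> ! k = res (tden (\<Gamma> ! k)) i (\<gamma> ! k)"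
  by (simp add: ctx_den_def)

lemma length_res_ctx [simp]: "length \<gamma> = length \<Gamma> \<Longrightarrow> length (res (ctx_den \<Gamma>) i \<gamma>) = length \<Gamma>"
  by (simp add: ctx_den_def)

lemma length_restr_ctx [simp]:
  "length \<gamma> = length \<Gamma> \<Longrightarrow> length (restr (ctx_den \<Gamma>) i j \<gamma>) = length \<Gamma>"
  by (induction j arbitrary: \<gamma>) (simp_all add: restr.simps(2))

lemma restr_ctx_nth:
  assumes "length \<gamma> = length \<Gamma>" "k < length \<Gamma>" "i \<le> j"
  shows "restr (ctx_den \<Gamma>) i j \<gamma> ! k = restr (tden (\<Gamma> ! k)) i j (\<gamma> ! k)"
  using assms(3,1) by (induction j arbitrary: \<gamma> rule: dec_induct)
    (simp_all add: restr_Suc res_ctx_nth assms(2))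

lemma res_closed_ctx: "wf_ctx \<Gamma> \<Longrightarrow> res_closed (ctx_den \<Gamma>)"
  by (simp add: res_closed_def ctx_den_iff res_ctx_nth res_tden_in wf_ctx_nth)

lemma res_ctx_in: "wf_ctx \<Gamma> \<Longrightarrow> \<gamma> \<in> stg (ctx_den \<Gamma>) (Suc i) \<Longrightarrow> res (ctx_den \<Gamma>) i \<gamma> \<in> stg (ctx_den \<Gamma>) i"
  by (rule res_closed_in[OF res_closed_ctx])

lemma restr_ctx_in:
  "wf_ctx \<Gamma> \<Longrightarrow> i \<le> j \<Longrightarrow> \<gamma> \<in> stg (ctx_den \<Gamma>) j \<Longrightarrow> restr (ctx_den \<Gamma>) i j \<gamma> \<in> stg (ctx_den \<Gamma>) i"
  by (rule restr_in[OF res_closed_ctx])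

lemma global_elt_ctx_iff:
  "global_elt (ctx_den \<Gamma>) x \<longleftrightarrow>
   (\<forall>j. length (x j) = length \<Gamma>) \<and> (\<forall>k<length \<Gamma>. global_elt (tden (\<Gamma> ! k)) (\<lambda>j. x j ! k))"
proof -
  have "res (ctx_den \<Gamma>) j (x (Suc j)) = x j \<longleftrightarrow>
      (\<forall>k<length \<Gamma>. res (tden (\<Gamma> ! k)) j (x (Suc j) ! k) = x j ! k)"
    if "\<forall>j. length (x j) = length \<Gamma>" for j
    using that by (simp add: list_eq_iff_nth_eq res_ctx_nth)
  then show ?thesis
    unfolding global_elt_def ctx_den_iff by blast
qed

lemma natural_nth: "k < length \<Gamma> \<Longrightarrow> natural (ctx_den \<Gamma>) (tden (\<Gamma> ! k)) (\<lambda>i \<gamma>. \<gamma> ! k)"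
  by (simp add: natural_def ctx_den_iff res_ctx_nth)

lemma natural2_Cons:
  "natural (ctx_den (A # \<Gamma>)) Y f \<Longrightarrow> natural2 (tden A) (ctx_den \<Gamma>) Y (\<lambda>i a \<gamma>. f i (a # \<gamma>))"
  unfolding natural2_def by (metis ctx_den_Cons natural_in natural_res)

lemma arr_eq: "\<gamma> \<in> stg (ctx_den \<Gamma>) i \<Longrightarrow> arr \<Gamma> f i \<gamma> = f i \<gamma>"
  by (simp add: arr_def)

lemma arr_arr [simp]: "arr \<Gamma> (arr \<Gamma> f) = arr \<Gamma> f"
  by (simp add: arr_def)

lemma arr_cong: "(\<And>i \<gamma>. \<gamma> \<in> stg (ctx_den \<Gamma>) i \<Longrightarrow> f i \<gamma> = g i \<gamma>) \<Longrightarrow> arr \<Gamma> f = arr \<Gamma> g"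
  by (auto simp: arr_def fun_eq_iff restrict_def)

lemma natural_arr_iff: "wf_ctx \<Gamma> \<Longrightarrow> natural (ctx_den \<Gamma>) Y (arr \<Gamma> f) \<longleftrightarrow> natural (ctx_den \<Gamma>) Y f"
  by (simp add: natural_def arr_eq res_ctx_in)


subsection \<open>Tuples of morphisms\<close>

abbreviation natural_sub :: "ty list \<Rightarrow> ty list \<Rightarrow> 'v::set_universe mor list \<Rightarrow> bool" where
  "natural_sub \<Delta> \<Gamma> gs \<equiv> list_all2 (\<lambda>A. natural (ctx_den \<Delta>) (tden A)) \<Gamma> gs"

abbreviation sub_eval :: "('i \<Rightarrow> 'a \<Rightarrow> 'b) list \<Rightarrow> 'i \<Rightarrow> 'a \<Rightarrow> 'b list" where
  "sub_eval gs i \<delta> \<equiv> map (\<lambda>g. g i \<delta>) gs"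

lemma natural_sub_eval:
  assumes "natural_sub \<Delta> \<Gamma> gs"
  shows "natural (ctx_den \<Delta>) (ctx_den \<Gamma>) (sub_eval gs)"
proof (rule naturalI)
  show "sub_eval gs i \<delta> \<in> stg (ctx_den \<Gamma>) i" if "\<delta> \<in> stg (ctx_den \<Delta>) i" for i \<delta>
    using assms that by (auto simp: ctx_den_iff[of _ \<Gamma>] list_all2_conv_all_nth natural_in)
  show "sub_eval gs i (res (ctx_den \<Delta>) i \<delta>) = res (ctx_den \<Gamma>) i (sub_eval gs (Suc i) \<delta>)"
    if "\<delta> \<in> stg (ctx_den \<Delta>) (Suc i)" for i \<delta>
    using assms that
    by (auto simp: list_eq_iff_nth_eq list_all2_conv_all_nth natural_res res_ctx_nth)
qed

lemma length_sub_den [simp]: "length (sub_den As fs i j \<gamma>) = min (length As) (length fs)"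
  by (simp add: sub_den_def)

lemma sub_den_nth:
  "k < length As \<Longrightarrow> k < length fs \<Longrightarrow>
   sub_den As fs i j \<gamma> ! k = transport (tden (As ! k)) i j ((fs ! k) i \<gamma>)"
  by (simp add: sub_den_def)

lemma sub_den_self: "length fs = length As \<Longrightarrow> sub_den As fs i i \<gamma> = sub_eval fs i \<gamma>"
  by (simp add: list_eq_iff_nth_eq sub_den_nth)

lemma sub_den_Nil [simp]: "sub_den [] fs i j \<gamma> = []"
  by (simp add: sub_den_def)

lemma natural_global_sub_den:
  assumes "wf_ctx As" "list_all const_ty As" "natural_sub \<Gamma> As fs"
  shows "natural_global (ctx_den \<Gamma>) (ctx_den As) (\<lambda>i \<gamma> j. sub_den As fs i j \<gamma>)"
proof -
  have len: "length fs = length As" and const: "\<And>k. k < length As \<Longrightarrow> const_tree (tden (As ! k))"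
    and nat: "\<And>k. k < length As \<Longrightarrow> natural (ctx_den \<Gamma>) (tden (As ! k)) (fs ! k)"
    using assms by (auto simp: list_all2_conv_all_nth list_all_length const_tree_tden)
  show ?thesis
    by (auto simp: natural_global_def global_elt_ctx_iff fun_eq_iff list_eq_iff_nth_eq len
        sub_den_nth natural_in[OF nat] natural_res[OF nat] global_elt_transport[OF const]
        transport_res[OF const])
qed


section \<open>Derivations of denotations\<close>

lemmas denotes_induct [consumes 1, case_names Var Zero Succ Unit Pair Fst Snd Abort In1 In2 Case
    Lam App Fold Unfold Next Prev LApp Box Unbox BoxPlus] = denotes.induct

lemmas denotes_Var = denotes.intros(1) and denotes_Zero = denotes.intros(2)
  and denotes_Succ = denotes.intros(3) and denotes_Unit = denotes.intros(4)
  and denotes_Pair = denotes.intros(5) and denotes_Fst = denotes.intros(6)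
  and denotes_Snd = denotes.intros(7) and denotes_Abort = denotes.intros(8)
  and denotes_In1 = denotes.intros(9) and denotes_In2 = denotes.intros(10)
  and denotes_Case = denotes.intros(11) and denotes_Lam = denotes.intros(12)
  and denotes_App = denotes.intros(13) and denotes_Fold = denotes.intros(14)
  and denotes_Unfold = denotes.intros(15) and denotes_Next = denotes.intros(16)
  and denotes_LApp = denotes.intros(18) and denotes_Unbox = denotes.intros(20)

definition denotes_const_sub ::
  "ty list \<Rightarrow> tm list \<Rightarrow> ty list \<Rightarrow> 'v::set_universe mor list \<Rightarrow> bool" where
  "denotes_const_sub \<Gamma> ts As fs \<longleftrightarrow> length As = length ts \<and> length fs = length ts \<and>
     (\<forall>k<length ts. const_ty (As ! k) \<and> denotes \<Gamma> (ts ! k) (As ! k) (fs ! k))"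

lemma denotes_const_sub_Nil [simp]: "denotes_const_sub \<Gamma> [] As fs \<longleftrightarrow> As = [] \<and> fs = []"
  by (auto simp: denotes_const_sub_def)

lemma denotes_Prev:
  "denotes_const_sub \<Gamma> ts As fs \<Longrightarrow> denotes As t (TLater A) f \<Longrightarrow>
   denotes \<Gamma> (Prev ts t) A (arr \<Gamma> (\<lambda>i \<gamma>. f (Suc i) (sub_den As fs i (Suc i) \<gamma>)))"
  by (rule denotes.intros) (simp_all add: denotes_const_sub_def)

lemma denotes_Box:
  "denotes_const_sub \<Gamma> ts As fs \<Longrightarrow> denotes As t A f \<Longrightarrow>
   denotes \<Gamma> (Box ts t) (TBox A) (arr \<Gamma> (\<lambda>i \<gamma>. vtup UNIV (\<lambda>j. f j (sub_den As fs i j \<gamma>))))"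
  by (rule denotes.intros) (simp_all add: denotes_const_sub_def)

lemma denotes_BoxPlus:
  "denotes_const_sub \<Gamma> ts As fs \<Longrightarrow> denotes As t (TSum B1 B2) f \<Longrightarrow>
   denotes \<Gamma> (BoxPlus ts t) (TSum (TBox B1) (TBox B2))
     (arr \<Gamma> (\<lambda>i \<gamma>. boxplus_den (\<lambda>j. f j (sub_den As fs i j \<gamma>))))"
  by (rule denotes.intros) (simp_all add: denotes_const_sub_def)

lemma denotes_Prev_Nil:
  "denotes [] t (TLater A) f \<Longrightarrow> denotes \<Gamma> (Prev [] t) A (arr \<Gamma> (\<lambda>i \<gamma>. f (Suc i) []))"
  using denotes_Prev[of \<Gamma> "[]" "[]" "[]"] by simp

lemma denotes_Box_Nil:
  "denotes [] t A f \<Longrightarrow> denotes \<Gamma> (Box [] t) (TBox A) (arr \<Gamma> (\<lambda>i \<gamma>. vtup UNIV (\<lambda>j. f j [])))"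
  using denotes_Box[of \<Gamma> "[]" "[]" "[]"] by simp

lemma denotes_BoxPlus_Nil:
  "denotes [] t (TSum A B) f \<Longrightarrow>
   denotes \<Gamma> (BoxPlus [] t) (TSum (TBox A) (TBox B)) (arr \<Gamma> (\<lambda>i \<gamma>. boxplus_den (\<lambda>j. f j [])))"
  using denotes_BoxPlus[of \<Gamma> "[]" "[]" "[]"] by simp

inductive_cases denotes_VarE: "denotes \<Gamma> (Var k) A f"
inductive_cases denotes_ZeroE: "denotes \<Gamma> Zero A f"
inductive_cases denotes_SuccE: "denotes \<Gamma> (Succ t) A f"
inductive_cases denotes_UnitE: "denotes \<Gamma> Unit A f"
inductive_cases denotes_PairE: "denotes \<Gamma> (Pair s t) A f"
inductive_cases denotes_FstE: "denotes \<Gamma> (Fst t) A f"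
inductive_cases denotes_SndE: "denotes \<Gamma> (Snd t) A f"
inductive_cases denotes_In1E: "denotes \<Gamma> (In1 t) A f"
inductive_cases denotes_In2E: "denotes \<Gamma> (In2 t) A f"
inductive_cases denotes_CaseE: "denotes \<Gamma> (Case t s1 s2) A f"
inductive_cases denotes_LamE: "denotes \<Gamma> (Lam t) A f"
inductive_cases denotes_AppE: "denotes \<Gamma> (App s t) A f"
inductive_cases denotes_FoldE: "denotes \<Gamma> (Fold t) A f"
inductive_cases denotes_UnfoldE: "denotes \<Gamma> (Unfold t) A f"
inductive_cases denotes_NextE: "denotes \<Gamma> (Next t) A f"
inductive_cases denotes_LAppE: "denotes \<Gamma> (s \<circledast> t) A f"
inductive_cases denotes_UnboxE: "denotes \<Gamma> (Unbox t) A f"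

lemma denotes_PrevE:
  assumes "denotes \<Gamma> (Prev ts t) A f"
  obtains As fs g where "denotes_const_sub \<Gamma> ts As fs" "denotes As t (TLater A) g"
    "f = arr \<Gamma> (\<lambda>i \<gamma>. g (Suc i) (sub_den As fs i (Suc i) \<gamma>))"
  using assms that unfolding denotes_const_sub_def by cases blast

lemma denotes_BoxE:
  assumes "denotes \<Gamma> (Box ts t) A f"
  obtains As fs B g where "A = TBox B" "denotes_const_sub \<Gamma> ts As fs" "denotes As t B g"
    "f = arr \<Gamma> (\<lambda>i \<gamma>. vtup UNIV (\<lambda>j. g j (sub_den As fs i j \<gamma>)))"
  using assms that unfolding denotes_const_sub_def by cases blast

lemma denotes_BoxPlusE:
  assumes "denotes \<Gamma> (BoxPlus ts t) A f"
  obtains As fs B C g where "A = TSum (TBox B) (TBox C)" "denotes_const_sub \<Gamma> ts As fs"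
    "denotes As t (TSum B C) g" "f = arr \<Gamma> (\<lambda>i \<gamma>. boxplus_den (\<lambda>j. g j (sub_den As fs i j \<gamma>)))"
  using assms that unfolding denotes_const_sub_def by cases blast


section \<open>Denotations are morphisms\<close>

lemma denotes_wft: "denotes \<Gamma> t A f \<Longrightarrow> wft 0 A"
  by (induction rule: denotes.induct) (auto simp: wft_unfold_mu)

lemma arr_denotes: "denotes \<Gamma> t A f \<Longrightarrow> arr \<Gamma> f = f"
  by (induction rule: denotes.induct) simp_all

lemma denotes_const_sub_wf_ctx: "denotes_const_sub \<Gamma> ts As fs \<Longrightarrow> wf_ctx As"
  by (auto simp: denotes_const_sub_def list_all_length intro: denotes_wft)

lemma denotes_const_sub_const_ty: "denotes_const_sub \<Gamma> ts As fs \<Longrightarrow> list_all const_ty As"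
  by (simp add: denotes_const_sub_def list_all_length)

lemma denotes_const_sub_natural_global:
  assumes "denotes_const_sub \<Gamma> ts As fs" "natural_sub \<Gamma> As fs"
    and "wf_ctx As \<Longrightarrow> natural (ctx_den As) Y f"
  shows "natural_global (ctx_den \<Gamma>) Y (\<lambda>i \<gamma> j. f j (sub_den As fs i j \<gamma>))"
  using assms(2,3) denotes_const_sub_wf_ctx[OF assms(1)] denotes_const_sub_const_ty[OF assms(1)]
  by (intro natural_global_comp[OF natural_global_sub_den])

lemma denotes_natural:
  "denotes \<Gamma> t A f \<Longrightarrow> wf_ctx \<Gamma> \<Longrightarrow> natural (ctx_den \<Gamma>) (tden A :: 'v::set_universe tree) f"
proof (induction rule: denotes_induct)
  case (Var k \<Gamma>)
  then show ?case by (simp add: natural_arr_iff natural_nth)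
next
  case (Abort \<Gamma> t f A)
  then show ?case by (auto intro: natural_abort)
next
  case (Case \<Gamma> t A B f s1 C g s2 h)
  then have "wft 0 A" "wft 0 B" using denotes_wft[OF Case.hyps(1)] by simp_all
  with Case show ?case by (simp add: natural_arr_iff natural_case natural2_Cons)
next
  case (Lam A \<Gamma> t B f)
  then show ?case
    by (simp add: natural_arr_iff natural_lam[OF natural2_Cons] res_closed_ctx)
next
  case (App \<Gamma> s A B f t g)
  then have "wft 0 A" "wft 0 B" using denotes_wft[OF App.hyps(1)] by simp_all
  with App show ?case by (auto simp: natural_arr_iff wf_tree_tden intro: natural_app)
next
  case (Fold \<Gamma> t A f)
  then show ?case by (simp add: tden_TMu)
next
  case (Unfold \<Gamma> t A f)
  then show ?case using denotes_wft[OF Unfold.hyps] by (simp add: tden_TMu)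
next
  case (Next \<Gamma> t A f)
  then show ?case
    using denotes_wft[OF Next.hyps] by (simp add: natural_arr_iff natural_next res_closed_tden)
next
  case (Prev As ts fs \<Gamma> t A f)
  then have "natural_global (ctx_den \<Gamma>) (later_obj (tden A)) (\<lambda>i \<gamma> j. f j (sub_den As fs i j \<gamma>))"
    by (intro denotes_const_sub_natural_global[of \<Gamma> ts])
      (simp_all add: denotes_const_sub_def list_all2_conv_all_nth)
  from natural_prev[OF this] Prev.prems show ?case by (simp add: natural_arr_iff)
next
  case (LApp \<Gamma> s A B f t g)
  then have "wft 0 A" "wft 0 B" using denotes_wft[OF LApp.hyps(1)] by simp_all
  with LApp show ?case by (auto simp: natural_arr_iff wf_tree_tden intro: natural_later_app)
next
  case (Box As ts fs \<Gamma> t A f)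
  then have "natural_global (ctx_den \<Gamma>) (tden A) (\<lambda>i \<gamma> j. f j (sub_den As fs i j \<gamma>))"
    by (intro denotes_const_sub_natural_global[of \<Gamma> ts])
      (simp_all add: denotes_const_sub_def list_all2_conv_all_nth)
  from natural_box[OF this] Box.prems show ?case by (simp add: natural_arr_iff)
next
  case (BoxPlus As ts fs \<Gamma> t B1 B2 f)
  then have "natural_global (ctx_den \<Gamma>) (sum_obj (tden B1) (tden B2))
      (\<lambda>i \<gamma> j. f j (sub_den As fs i j \<gamma>))"
    by (intro denotes_const_sub_natural_global[of \<Gamma> ts])
      (simp_all add: denotes_const_sub_def list_all2_conv_all_nth)
  from natural_boxplus[OF this] BoxPlus.prems show ?case by (simp add: natural_arr_iff)
qed (auto simp: natural_arr_iff intro: natural_zero natural_succ natural_unit natural_pair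
    natural_fst natural_snd natural_inl natural_inr natural_unbox)


section \<open>Coherence\<close>

definition rel_ctx :: "ty list \<Rightarrow> ty list \<Rightarrow> nat \<Rightarrow> 'v::set_universe list \<Rightarrow> 'v list \<Rightarrow> bool" where
  "rel_ctx \<Gamma> \<Gamma>' i \<gamma> \<gamma>' \<longleftrightarrow>
     length \<Gamma>' = length \<Gamma> \<and> length \<gamma> = length \<Gamma> \<and> length \<gamma>' = length \<Gamma> \<and>
     (\<forall>k<length \<Gamma>. rel (\<Gamma> ! k) (\<Gamma>' ! k) i (\<gamma> ! k) (\<gamma>' ! k))"

lemma rel_ctx_in:
  assumes "wf_ctx \<Gamma>" "wf_ctx \<Gamma>'" "rel_ctx \<Gamma> \<Gamma>' i \<gamma> \<gamma>'"
  shows "\<gamma> \<in> stg (ctx_den \<Gamma>) i" "\<gamma>' \<in> stg (ctx_den \<Gamma>') i"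
proof -
  have "\<gamma> ! k \<in> stg (tden (\<Gamma> ! k)) i \<and> \<gamma>' ! k \<in> stg (tden (\<Gamma>' ! k)) i" if "k < length \<Gamma>" for k
    using assms that by (intro rel_in) (simp_all add: rel_ctx_def wf_ctx_nth)
  then show "\<gamma> \<in> stg (ctx_den \<Gamma>) i" "\<gamma>' \<in> stg (ctx_den \<Gamma>') i"
    using assms(3) by (simp_all add: rel_ctx_def ctx_den_iff)
qed

lemma rel_ctx_Nil [simp]: "rel_ctx [] [] i [] []"
  by (simp add: rel_ctx_def)

lemma rel_ctx_Cons [simp]:
  "rel_ctx (A # \<Gamma>) (A' # \<Gamma>') i (a # \<gamma>) (a' # \<gamma>') \<longleftrightarrow> rel A A' i a a' \<and> rel_ctx \<Gamma> \<Gamma>' i \<gamma> \<gamma>'"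
  by (auto simp: rel_ctx_def nth_Cons split: nat.splits)

lemma rel_ctx_restr:
  assumes "wf_ctx \<Gamma>" "wf_ctx \<Gamma>'" "rel_ctx \<Gamma> \<Gamma>' i \<gamma> \<gamma>'" "j \<le> i"
  shows "rel_ctx \<Gamma> \<Gamma>' j (restr (ctx_den \<Gamma>) j i \<gamma>) (restr (ctx_den \<Gamma>') j i \<gamma>')"
  using assms by (simp add: rel_ctx_def restr_ctx_nth rel_restr wf_ctx_nth)

definition rel_mor ::
  "ty list \<Rightarrow> ty list \<Rightarrow> ty \<Rightarrow> ty \<Rightarrow> 'v::set_universe mor \<Rightarrow> 'v mor \<Rightarrow> bool" where
  "rel_mor \<Gamma> \<Gamma>' A A' f f' \<longleftrightarrow>
     (\<forall>i \<gamma> \<gamma>'. rel_ctx \<Gamma> \<Gamma>' i \<gamma> \<gamma>' \<longrightarrow> rel A A' i (f i \<gamma>) (f' i \<gamma>'))"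

lemma rel_morI:
  assumes "\<And>i \<gamma> \<gamma>'. rel_ctx \<Gamma> \<Gamma>' i \<gamma> \<gamma>' \<Longrightarrow> rel A A' i (f i \<gamma>) (f' i \<gamma>')"
  shows "rel_mor \<Gamma> \<Gamma>' A A' f f'"
  using assms by (simp add: rel_mor_def)

lemma rel_morD: "rel_mor \<Gamma> \<Gamma>' A A' f f' \<Longrightarrow> rel_ctx \<Gamma> \<Gamma>' i \<gamma> \<gamma>' \<Longrightarrow> rel A A' i (f i \<gamma>) (f' i \<gamma>')"
  by (simp add: rel_mor_def)

lemma rel_mor_arr_iff:
  "wf_ctx \<Gamma> \<Longrightarrow> wf_ctx \<Gamma>' \<Longrightarrow>
   rel_mor \<Gamma> \<Gamma>' A A' (arr \<Gamma> f) (arr \<Gamma>' f') \<longleftrightarrow> rel_mor \<Gamma> \<Gamma>' A A' f f'"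
  by (auto simp: rel_mor_def arr_eq rel_ctx_in)

lemma rel_mor_nth:
  "k < length \<Gamma> \<Longrightarrow> rel_mor \<Gamma> \<Gamma>' (\<Gamma> ! k) (\<Gamma>' ! k) (\<lambda>i \<gamma>. \<gamma> ! k) (\<lambda>i \<gamma>. \<gamma> ! k)"
  by (simp add: rel_mor_def rel_ctx_def)

lemma rel_mor_zero: "rel_mor \<Gamma> \<Gamma>' TNat TNat (\<lambda>i \<gamma>. vnat 0) (\<lambda>i \<gamma>. vnat 0)"
  by (simp add: rel_mor_def)

lemma rel_mor_succ:
  assumes "rel_mor \<Gamma> \<Gamma>' TNat TNat f f'"
  shows "rel_mor \<Gamma> \<Gamma>' TNat TNat (\<lambda>i \<gamma>. vsucc (f i \<gamma>)) (\<lambda>i \<gamma>. vsucc (f' i \<gamma>))"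
  using assms by (simp add: rel_mor_def vsucc_in_range_vnat)

lemma rel_mor_unit: "rel_mor \<Gamma> \<Gamma>' TUnit TUnit (\<lambda>i \<gamma>. vunit) (\<lambda>i \<gamma>. vunit)"
  by (simp add: rel_mor_def)

lemma rel_mor_pair:
  assumes "rel_mor \<Gamma> \<Gamma>' A A' f f'" "rel_mor \<Gamma> \<Gamma>' B B' g g'"
  shows "rel_mor \<Gamma> \<Gamma>' (TProd A B) (TProd A' B')
    (\<lambda>i \<gamma>. vpair (f i \<gamma>) (g i \<gamma>)) (\<lambda>i \<gamma>. vpair (f' i \<gamma>) (g' i \<gamma>))"
  using assms by (simp add: rel_mor_def)

lemma rel_mor_fst:
  assumes "rel_mor \<Gamma> \<Gamma>' (TProd A B) (TProd A' B') f f'"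
  shows "rel_mor \<Gamma> \<Gamma>' A A' (\<lambda>i \<gamma>. vfst (f i \<gamma>)) (\<lambda>i \<gamma>. vfst (f' i \<gamma>))"
  using assms by (fastforce simp: rel_mor_def)

lemma rel_mor_snd:
  assumes "rel_mor \<Gamma> \<Gamma>' (TProd A B) (TProd A' B') f f'"
  shows "rel_mor \<Gamma> \<Gamma>' B B' (\<lambda>i \<gamma>. vsnd (f i \<gamma>)) (\<lambda>i \<gamma>. vsnd (f' i \<gamma>))"
  using assms by (fastforce simp: rel_mor_def)

lemma rel_mor_inl:
  assumes "rel_mor \<Gamma> \<Gamma>' A A' f f'"
  shows "rel_mor \<Gamma> \<Gamma>' (TSum A B) (TSum A' B') (\<lambda>i \<gamma>. vinl (f i \<gamma>)) (\<lambda>i \<gamma>. vinl (f' i \<gamma>))"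
  using assms by (simp add: rel_mor_def)

lemma rel_mor_inr:
  assumes "rel_mor \<Gamma> \<Gamma>' B B' f f'"
  shows "rel_mor \<Gamma> \<Gamma>' (TSum A B) (TSum A' B') (\<lambda>i \<gamma>. vinr (f i \<gamma>)) (\<lambda>i \<gamma>. vinr (f' i \<gamma>))"
  using assms by (simp add: rel_mor_def)

lemma rel_mor_case:
  fixes f f' g g' h h' :: "'v::set_universe mor"
  assumes f: "rel_mor \<Gamma> \<Gamma>' (TSum A B) (TSum A' B') f f'"
    and g: "rel_mor (A # \<Gamma>) (A' # \<Gamma>') C C' g g'" and h: "rel_mor (B # \<Gamma>) (B' # \<Gamma>') C C' h h'"
  shows "rel_mor \<Gamma> \<Gamma>' C C'
    (\<lambda>i \<gamma>. vcase (\<lambda>a. g i (a # \<gamma>)) (\<lambda>b. h i (b # \<gamma>)) (f i \<gamma>))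
    (\<lambda>i \<gamma>. vcase (\<lambda>a. g' i (a # \<gamma>)) (\<lambda>b. h' i (b # \<gamma>)) (f' i \<gamma>))"
proof (rule rel_morI)
  fix i and \<gamma> \<gamma>' :: "'v list"
  assume ctx: "rel_ctx \<Gamma> \<Gamma>' i \<gamma> \<gamma>'"
  have "rel (TSum A B) (TSum A' B') i (f i \<gamma>) (f' i \<gamma>')"
    using f ctx by (rule rel_morD)
  then consider a a' where "f i \<gamma> = vinl a" "f' i \<gamma>' = vinl a'" "rel A A' i a a'"
    | b b' where "f i \<gamma> = vinr b" "f' i \<gamma>' = vinr b'" "rel B B' i b b'"
    by auto
  then show "rel C C' i (vcase (\<lambda>a. g i (a # \<gamma>)) (\<lambda>b. h i (b # \<gamma>)) (f i \<gamma>))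
      (vcase (\<lambda>a. g' i (a # \<gamma>')) (\<lambda>b. h' i (b # \<gamma>')) (f' i \<gamma>'))"
    by cases (simp_all add: ctx rel_morD[OF g] rel_morD[OF h])
qed

lemma rel_mor_lam:
  fixes f f' :: "'v::set_universe mor"
  assumes wf: "wf_ctx \<Gamma>" "wf_ctx \<Gamma>'" "wft 0 A" "wft 0 A'" "wft 0 B" "wft 0 B'"
    and f: "natural (ctx_den (A # \<Gamma>)) (tden B) f" and f': "natural (ctx_den (A' # \<Gamma>')) (tden B') f'"
    and rel: "rel_mor (A # \<Gamma>) (A' # \<Gamma>') B B' f f'"
  shows "rel_mor \<Gamma> \<Gamma>' (TFun A B) (TFun A' B')
    (\<lambda>i \<gamma>. exp_lam (tden A) i (\<lambda>j a. f j (a # restr (ctx_den \<Gamma>) j i \<gamma>)))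
    (\<lambda>i \<gamma>. exp_lam (tden A') i (\<lambda>j a. f' j (a # restr (ctx_den \<Gamma>') j i \<gamma>)))"
    (is "rel_mor _ _ _ _ ?lam ?lam'")
proof (rule rel_morI)
  fix i and \<gamma> \<gamma>' :: "'v list"
  assume ctx: "rel_ctx \<Gamma> \<Gamma>' i \<gamma> \<gamma>'"
  note in_ctx = rel_ctx_in[OF wf(1,2) ctx]
  have lam_in: "?lam i \<gamma> \<in> stg (exp_obj (tden A) (tden B)) i"
      "?lam' i \<gamma>' \<in> stg (exp_obj (tden A') (tden B')) i"
    using natural_in[OF natural_lam[OF natural2_Cons[OF f] res_closed_ctx[OF wf(1)]] in_ctx(1)]
      natural_in[OF natural_lam[OF natural2_Cons[OF f'] res_closed_ctx[OF wf(2)]] in_ctx(2)] .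
  have "rel B B' j (exp_app (?lam i \<gamma>) j a) (exp_app (?lam' i \<gamma>') j b)"
    if j: "j \<le> i" and ab: "rel A A' j a b" for j a b
  proof -
    note ab_in = rel_in[OF wf(3,4) ab]
      and restr_in = restr_ctx_in[OF wf(1) j in_ctx(1)] restr_ctx_in[OF wf(2) j in_ctx(2)]
    have "exp_app (?lam i \<gamma>) j a = f j (a # restr (ctx_den \<Gamma>) j i \<gamma>)"
      using wf ab_in restr_in natural_in[OF f]
      by (intro exp_app_exp_lam[OF wf_tree_tden wf_tree_tden[of B] _ j]) auto
    moreover have "exp_app (?lam' i \<gamma>') j b = f' j (b # restr (ctx_den \<Gamma>') j i \<gamma>')"
      using wf ab_in restr_in natural_in[OF f']
      by (intro exp_app_exp_lam[OF wf_tree_tden wf_tree_tden[of B'] _ j]) auto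
    ultimately show ?thesis
      using rel_morD[OF rel] ab rel_ctx_restr[OF wf(1,2) ctx j] by simp
  qed
  with lam_in show "rel (TFun A B) (TFun A' B') i (?lam i \<gamma>) (?lam' i \<gamma>')" by simp
qed

lemma rel_mor_app:
  assumes "rel_mor \<Gamma> \<Gamma>' (TFun A B) (TFun A' B') f f'" "rel_mor \<Gamma> \<Gamma>' A A' g g'"
  shows "rel_mor \<Gamma> \<Gamma>' B B' (\<lambda>i \<gamma>. exp_app (f i \<gamma>) i (g i \<gamma>)) (\<lambda>i \<gamma>. exp_app (f' i \<gamma>) i (g' i \<gamma>))"
  using assms by (simp add: rel_mor_def)

lemma rel_mor_next:
  assumes "wft 0 A" "wft 0 A'" "rel_mor \<Gamma> \<Gamma>' A A' f f'"
  shows "rel_mor \<Gamma> \<Gamma>' (TLater A) (TLater A')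
    (\<lambda>i \<gamma>. next_map (tden A) i (f i \<gamma>)) (\<lambda>i \<gamma>. next_map (tden A') i (f' i \<gamma>))"
proof (rule rel_morI)
  show "rel (TLater A) (TLater A') i (next_map (tden A) i (f i \<gamma>)) (next_map (tden A') i (f' i \<gamma>'))"
    if "rel_ctx \<Gamma> \<Gamma>' i \<gamma> \<gamma>'" for i \<gamma> \<gamma>'
    using rel_morD[OF assms(3) that] assms(1,2) by (cases i) (simp_all add: next_map_def rel_res)
qed

lemma rel_mor_later_app:
  assumes "rel_mor \<Gamma> \<Gamma>' (TLater (TFun A B)) (TLater (TFun A' B')) f f'"
    and "rel_mor \<Gamma> \<Gamma>' (TLater A) (TLater A') g g'"
  shows "rel_mor \<Gamma> \<Gamma>' (TLater B) (TLater B')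
    (\<lambda>i \<gamma>. case i of 0 \<Rightarrow> vunit | Suc j \<Rightarrow> exp_app (f i \<gamma>) j (g i \<gamma>))
    (\<lambda>i \<gamma>. case i of 0 \<Rightarrow> vunit | Suc j \<Rightarrow> exp_app (f' i \<gamma>) j (g' i \<gamma>))"
    (is "rel_mor _ _ _ _ ?h ?h'")
proof (rule rel_morI)
  show "rel (TLater B) (TLater B') i (?h i \<gamma>) (?h' i \<gamma>')" if "rel_ctx \<Gamma> \<Gamma>' i \<gamma> \<gamma>'" for i \<gamma> \<gamma>'
    using assms[THEN rel_morD, OF that] by (cases i) simp_all
qed

lemma rel_mor_unbox:
  assumes "rel_mor \<Gamma> \<Gamma>' (TBox A) (TBox A') f f'"
  shows "rel_mor \<Gamma> \<Gamma>' A A' (\<lambda>i \<gamma>. unbox_map i (f i \<gamma>)) (\<lambda>i \<gamma>. unbox_map i (f' i \<gamma>))"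
  using assms by (simp add: rel_mor_def unbox_map_def)

lemma rel_mor_TMu_iff:
  "wft 0 (TMu A) \<Longrightarrow>
   rel_mor \<Gamma> \<Gamma>' (TMu A) (TMu A') f f' \<longleftrightarrow> rel_mor \<Gamma> \<Gamma>' (unfold_mu A) (unfold_mu A') f f'"
  by (simp add: rel_mor_def rel_TMu_iff)

lemma denotes_const_sub_global_elt:
  assumes "denotes_const_sub \<Gamma> ts As fs" "denotes As t A f" "wf_ctx \<Gamma>" "\<gamma> \<in> stg (ctx_den \<Gamma>) i"
  shows "global_elt (tden A) (\<lambda>j. f j (sub_den As fs i j \<gamma>))"
proof -
  have "natural_sub \<Gamma> As fs"
    using assms(1,3)
    by (auto simp: denotes_const_sub_def list_all2_conv_all_nth intro: denotes_natural)
  then show ?thesis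
    using assms(4) denotes_natural[OF assms(2)]
    by (intro natural_global_elt[OF denotes_const_sub_natural_global[OF assms(1)]])
qed

definition rel_global ::
  "ty list \<Rightarrow> ty list \<Rightarrow> ty \<Rightarrow> ty \<Rightarrow> (nat \<Rightarrow> 'v::set_universe list \<Rightarrow> nat \<Rightarrow> 'v) \<Rightarrow>
   (nat \<Rightarrow> 'v list \<Rightarrow> nat \<Rightarrow> 'v) \<Rightarrow> bool" where
  "rel_global \<Gamma> \<Gamma>' A A' f f' \<longleftrightarrow> (\<forall>i \<gamma> \<gamma>'. rel_ctx \<Gamma> \<Gamma>' i \<gamma> \<gamma>' \<longrightarrow>
     global_elt (tden A) (f i \<gamma>) \<and> global_elt (tden A') (f' i \<gamma>') \<and>
     (\<forall>j. rel A A' j (f i \<gamma> j) (f' i \<gamma>' j)))"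

definition coherent :: "ty list \<Rightarrow> tm \<Rightarrow> ty \<Rightarrow> 'v::set_universe mor \<Rightarrow> bool" where
  "coherent \<Gamma> t A f \<longleftrightarrow> (\<forall>\<Gamma>' A' f'. wf_ctx \<Gamma> \<longrightarrow> wf_ctx \<Gamma>' \<longrightarrow> denotes \<Gamma>' t A' f' \<longrightarrow>
     rel_mor \<Gamma> \<Gamma>' A A' f f')"

lemma coherentI:
  assumes "\<And>\<Gamma>' A' f'. wf_ctx \<Gamma> \<Longrightarrow> wf_ctx \<Gamma>' \<Longrightarrow> denotes \<Gamma>' t A' f' \<Longrightarrow> rel_mor \<Gamma> \<Gamma>' A A' f f'"
  shows "coherent \<Gamma> t A f"
  using assms by (simp add: coherent_def)

lemma coherentD:
  "coherent \<Gamma> t A f \<Longrightarrow> denotes \<Gamma>' t A' f' \<Longrightarrow> wf_ctx \<Gamma> \<Longrightarrow> wf_ctx \<Gamma>' \<Longrightarrow> rel_mor \<Gamma> \<Gamma>' A A' f f'"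
  by (simp add: coherent_def)

lemma rel_global_sub_den:
  fixes f f' :: "'v::set_universe mor"
  assumes sub: "denotes_const_sub \<Gamma> ts As fs" "\<forall>k<length ts. coherent \<Gamma> (ts ! k) (As ! k) (fs ! k)"
    and t: "denotes As t A f" "coherent As t A f"
    and sub': "denotes_const_sub \<Gamma>' ts As' fs'" and t': "denotes As' t A' f'"
    and wf: "wf_ctx \<Gamma>" "wf_ctx \<Gamma>'"
  shows "rel_global \<Gamma> \<Gamma>' A A'
    (\<lambda>i \<gamma> j. f j (sub_den As fs i j \<gamma>)) (\<lambda>i \<gamma> j. f' j (sub_den As' fs' i j \<gamma>))"
  unfolding rel_global_def
proof (intro allI impI conjI)
  fix i j and \<gamma> \<gamma>' :: "'v list"
  assume ctx: "rel_ctx \<Gamma> \<Gamma>' i \<gamma> \<gamma>'"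
  show "global_elt (tden A) (\<lambda>j. f j (sub_den As fs i j \<gamma>))"
    using sub(1) t(1) wf(1) rel_ctx_in(1)[OF wf ctx] by (rule denotes_const_sub_global_elt)
  show "global_elt (tden A') (\<lambda>j. f' j (sub_den As' fs' i j \<gamma>'))"
    using sub' t' wf(2) rel_ctx_in(2)[OF wf ctx] by (rule denotes_const_sub_global_elt)
  have "rel_mor \<Gamma> \<Gamma>' (As ! k) (As' ! k) (fs ! k) (fs' ! k)" if "k < length ts" for k
    using sub(2) sub' wf that by (auto simp: denotes_const_sub_def intro: coherentD)
  note rel_sub = rel_morD[OF this ctx]
  have "rel (As ! k) (As' ! k) j (transport (tden (As ! k)) i j ((fs ! k) i \<gamma>))
      (transport (tden (As' ! k)) i j ((fs' ! k) i \<gamma>'))" if "k < length ts" for k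
    using sub(1) sub' rel_sub[OF that] that
    by (intro rel_transport) (auto simp: denotes_const_sub_def intro: denotes_wft)
  then have "rel_ctx As As' j (sub_den As fs i j \<gamma>) (sub_den As' fs' i j \<gamma>')"
    using sub(1) sub' by (simp add: rel_ctx_def denotes_const_sub_def sub_den_nth)
  then show "rel A A' j (f j (sub_den As fs i j \<gamma>)) (f' j (sub_den As' fs' i j \<gamma>'))"
    using coherentD[OF t(2) t'] sub(1) sub' denotes_const_sub_wf_ctx by (blast intro: rel_morD)
qed

lemma rel_mor_prev:
  fixes f f' :: "nat \<Rightarrow> 'v::set_universe list \<Rightarrow> nat \<Rightarrow> 'v"
  assumes "rel_global \<Gamma> \<Gamma>' (TLater A) (TLater A') f f'"
  shows "rel_mor \<Gamma> \<Gamma>' A A' (\<lambda>i \<gamma>. f i \<gamma> (Suc i)) (\<lambda>i \<gamma>. f' i \<gamma> (Suc i))"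
proof (rule rel_morI)
  fix i and \<gamma> \<gamma>' :: "'v list"
  assume "rel_ctx \<Gamma> \<Gamma>' i \<gamma> \<gamma>'"
  then have "rel (TLater A) (TLater A') (Suc i) (f i \<gamma> (Suc i)) (f' i \<gamma>' (Suc i))"
    using assms unfolding rel_global_def by blast
  then show "rel A A' i (f i \<gamma> (Suc i)) (f' i \<gamma>' (Suc i))" by simp
qed

lemma rel_mor_box:
  assumes "rel_global \<Gamma> \<Gamma>' A A' f f'"
  shows "rel_mor \<Gamma> \<Gamma>' (TBox A) (TBox A') (\<lambda>i \<gamma>. vtup UNIV (f i \<gamma>)) (\<lambda>i \<gamma>. vtup UNIV (f' i \<gamma>))"
  using assms by (simp add: rel_global_def rel_mor_def vtup_in_box_iff)

lemma rel_boxplus: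
  assumes x: "global_elt (sum_obj (tden A) (tden B)) x"
    and y: "global_elt (sum_obj (tden A') (tden B')) y"
    and rel: "\<And>j. rel (TSum A B) (TSum A' B') j (x j) (y j)"
  shows "rel (TSum (TBox A) (TBox B)) (TSum (TBox A') (TBox B')) i (boxplus_den x) (boxplus_den y)"
  using x
proof (cases rule: global_elt_sumE)
  case (inl a)
  from y inl rel obtain a' where "global_elt (tden A') a'" "y = (\<lambda>j. vinl (a' j))"
    by (cases rule: global_elt_sumE) auto
  with inl rel show ?thesis by (simp add: vtup_in_box_iff)
next
  case (inr b)
  from y inr rel obtain b' where "global_elt (tden B') b'" "y = (\<lambda>j. vinr (b' j))"
    by (cases rule: global_elt_sumE) auto
  with inr rel show ?thesis by (simp add: vtup_in_box_iff)
qed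

lemma rel_mor_boxplus:
  assumes "rel_global \<Gamma> \<Gamma>' (TSum A B) (TSum A' B') f f'"
  shows "rel_mor \<Gamma> \<Gamma>' (TSum (TBox A) (TBox B)) (TSum (TBox A') (TBox B'))
    (\<lambda>i \<gamma>. boxplus_den (f i \<gamma>)) (\<lambda>i \<gamma>. boxplus_den (f' i \<gamma>))"
  by (rule rel_morI, rule rel_boxplus) (use assms in \<open>simp_all add: rel_global_def del: rel.simps\<close>)

lemma coherent_Var: "k < length \<Gamma> \<Longrightarrow> coherent \<Gamma> (Var k) (\<Gamma> ! k) (arr \<Gamma> (\<lambda>i \<gamma>. \<gamma> ! k))"
  by (rule coherentI, erule denotes_VarE)
    (auto simp: rel_mor_arr_iff rel_mor_nth)

lemma coherent_Zero: "coherent \<Gamma> Zero TNat (arr \<Gamma> (\<lambda>i \<gamma>. vnat 0))"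
  by (rule coherentI, erule denotes_ZeroE)
    (auto simp: rel_mor_arr_iff rel_mor_zero)

lemma coherent_Succ:
  assumes "coherent \<Gamma> t TNat f"
  shows "coherent \<Gamma> (Succ t) TNat (arr \<Gamma> (\<lambda>i \<gamma>. vsucc (f i \<gamma>)))"
  by (rule coherentI, erule denotes_SuccE)
    (auto simp: rel_mor_arr_iff rel_mor_succ[OF assms[THEN coherentD]])

lemma coherent_Unit: "coherent \<Gamma> Unit TUnit (arr \<Gamma> (\<lambda>i \<gamma>. vunit))"
  by (rule coherentI, erule denotes_UnitE)
    (auto simp: rel_mor_arr_iff rel_mor_unit)

lemma coherent_Pair:
  assumes "coherent \<Gamma> s A f" and "coherent \<Gamma> t B g"
  shows "coherent \<Gamma> (Pair s t) (TProd A B) (arr \<Gamma> (\<lambda>i \<gamma>. vpair (f i \<gamma>) (g i \<gamma>)))"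
  by (rule coherentI, erule denotes_PairE)
    (auto simp: rel_mor_arr_iff rel_mor_pair[OF assms[THEN coherentD]])

lemma coherent_Fst:
  assumes "coherent \<Gamma> t (TProd A B) f"
  shows "coherent \<Gamma> (Fst t) A (arr \<Gamma> (\<lambda>i \<gamma>. vfst (f i \<gamma>)))"
  by (rule coherentI, erule denotes_FstE)
    (auto simp: rel_mor_arr_iff rel_mor_fst[OF assms[THEN coherentD]])

lemma coherent_Snd:
  assumes "coherent \<Gamma> t (TProd A B) f"
  shows "coherent \<Gamma> (Snd t) B (arr \<Gamma> (\<lambda>i \<gamma>. vsnd (f i \<gamma>)))"
  by (rule coherentI, erule denotes_SndE)
    (auto simp: rel_mor_arr_iff rel_mor_snd[OF assms[THEN coherentD]])

lemma coherent_Abort: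
  fixes f g :: "'v::set_universe mor"
  assumes "denotes \<Gamma> t TVoid f"
  shows "coherent \<Gamma> (Abort t) A g"
proof (rule coherentI)
  fix \<Gamma>' A' and f' :: "'v mor"
  assume wf: "wf_ctx \<Gamma>" "wf_ctx \<Gamma>'"
  have "stg (ctx_den \<Gamma> :: 'v list tree) i = {}" for i
    using denotes_natural[OF assms wf(1)] by (auto simp: natural_def zero_obj_def)
  then have "\<not> rel_ctx \<Gamma> \<Gamma>' i \<gamma> \<gamma>'" for i and \<gamma> \<gamma>' :: "'v list"
    using rel_ctx_in(1)[OF wf, of i \<gamma> \<gamma>'] by auto
  then show "rel_mor \<Gamma> \<Gamma>' A A' g f'" by (simp add: rel_mor_def)
qed

lemma coherent_In1:
  assumes "coherent \<Gamma> t A f"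
  shows "coherent \<Gamma> (In1 t) (TSum A B) (arr \<Gamma> (\<lambda>i \<gamma>. vinl (f i \<gamma>)))"
  by (rule coherentI, erule denotes_In1E)
    (auto simp: rel_mor_arr_iff rel_mor_inl[OF assms[THEN coherentD]])

lemma coherent_In2:
  assumes "coherent \<Gamma> t B f"
  shows "coherent \<Gamma> (In2 t) (TSum A B) (arr \<Gamma> (\<lambda>i \<gamma>. vinr (f i \<gamma>)))"
  by (rule coherentI, erule denotes_In2E)
    (auto simp: rel_mor_arr_iff rel_mor_inr[OF assms[THEN coherentD]])

lemma coherent_Case:
  fixes f g h :: "'v::set_universe mor"
  assumes t: "denotes \<Gamma> t (TSum A B) f" "coherent \<Gamma> t (TSum A B) f"
    and s1: "coherent (A # \<Gamma>) s1 C g" and s2: "coherent (B # \<Gamma>) s2 C h"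
  shows "coherent \<Gamma> (Case t s1 s2) C
    (arr \<Gamma> (\<lambda>i \<gamma>. vcase (\<lambda>a. g i (a # \<gamma>)) (\<lambda>b. h i (b # \<gamma>)) (f i \<gamma>)))"
proof (rule coherentI)
  fix \<Gamma>' A' and f' :: "'v mor"
  assume wf: "wf_ctx \<Gamma>" "wf_ctx \<Gamma>'" and "denotes \<Gamma>' (Case t s1 s2) A' f'"
  then obtain A1 B1 f1 g1 h1 where t1: "denotes \<Gamma>' t (TSum A1 B1) f1"
    and "denotes (A1 # \<Gamma>') s1 A' g1" "denotes (B1 # \<Gamma>') s2 A' h1"
    and f': "f' = arr \<Gamma>' (\<lambda>i \<gamma>. vcase (\<lambda>a. g1 i (a # \<gamma>)) (\<lambda>b. h1 i (b # \<gamma>)) (f1 i \<gamma>))"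
    by (elim denotes_CaseE)
  moreover have "wft 0 A" "wft 0 B" "wft 0 A1" "wft 0 B1"
    using denotes_wft[OF t(1)] denotes_wft[OF t1] by simp_all
  ultimately show "rel_mor \<Gamma> \<Gamma>' C A'
      (arr \<Gamma> (\<lambda>i \<gamma>. vcase (\<lambda>a. g i (a # \<gamma>)) (\<lambda>b. h i (b # \<gamma>)) (f i \<gamma>))) f'"
    using wf by (simp add: f' rel_mor_arr_iff
        rel_mor_case[OF coherentD[OF t(2) t1] coherentD[OF s1] coherentD[OF s2]])
qed

lemma coherent_Lam:
  fixes f :: "'v::set_universe mor"
  assumes t: "denotes (A # \<Gamma>) t B f" "coherent (A # \<Gamma>) t B f" and A: "wft 0 A"
  shows "coherent \<Gamma> (Lam t) (TFun A B)
    (arr \<Gamma> (\<lambda>i \<gamma>. exp_lam (tden A) i (\<lambda>j a. f j (a # restr (ctx_den \<Gamma>) j i \<gamma>))))"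
proof (rule coherentI)
  fix \<Gamma>' A' and f' :: "'v mor"
  assume wf: "wf_ctx \<Gamma>" "wf_ctx \<Gamma>'" and "denotes \<Gamma>' (Lam t) A' f'"
  then obtain A1 B1 f1 where A': "A' = TFun A1 B1" and t1: "denotes (A1 # \<Gamma>') t B1 f1" "wft 0 A1"
    and f': "f' = arr \<Gamma>' (\<lambda>i \<gamma>. exp_lam (tden A1) i (\<lambda>j a. f1 j (a # restr (ctx_den \<Gamma>') j i \<gamma>)))"
    by (elim denotes_LamE)
  show "rel_mor \<Gamma> \<Gamma>' (TFun A B) A'
      (arr \<Gamma> (\<lambda>i \<gamma>. exp_lam (tden A) i (\<lambda>j a. f j (a # restr (ctx_den \<Gamma>) j i \<gamma>)))) f'"
    using wf A t1(2) denotes_wft[OF t(1)] denotes_wft[OF t1(1)] denotes_natural[OF t(1)]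
      denotes_natural[OF t1(1)] coherentD[OF t(2) t1(1)]
    by (simp add: A' f' rel_mor_arr_iff rel_mor_lam)
qed

lemma coherent_App:
  assumes "coherent \<Gamma> s (TFun A B) f" and "coherent \<Gamma> t A g"
  shows "coherent \<Gamma> (App s t) B (arr \<Gamma> (\<lambda>i \<gamma>. exp_app (f i \<gamma>) i (g i \<gamma>)))"
  by (rule coherentI, erule denotes_AppE)
    (auto simp: rel_mor_arr_iff rel_mor_app[OF assms[THEN coherentD]])

lemma coherent_Fold:
  assumes "coherent \<Gamma> t (unfold_mu A) f" and "wft 0 (TMu A)"
  shows "coherent \<Gamma> (Fold t) (TMu A) f"
  by (rule coherentI, erule denotes_FoldE)
    (auto simp: rel_mor_TMu_iff[OF assms(2)] intro: coherentD[OF assms(1)])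

lemma coherent_Unfold:
  assumes "coherent \<Gamma> t (TMu A) f" and "wft 0 (TMu A)"
  shows "coherent \<Gamma> (Unfold t) (unfold_mu A) f"
  by (rule coherentI, erule denotes_UnfoldE)
    (auto simp flip: rel_mor_TMu_iff[OF assms(2)] intro: coherentD[OF assms(1)])

lemma coherent_Next:
  assumes t: "denotes \<Gamma> t A f" "coherent \<Gamma> t A f"
  shows "coherent \<Gamma> (Next t) (TLater A) (arr \<Gamma> (\<lambda>i \<gamma>. next_map (tden A) i (f i \<gamma>)))"
  by (rule coherentI, erule denotes_NextE)
    (auto simp: rel_mor_arr_iff intro!: rel_mor_next denotes_wft[OF t(1)] coherentD[OF t(2)]
      intro: denotes_wft)

lemma coherent_LApp:
  assumes "coherent \<Gamma> s (TLater (TFun A B)) f" and "coherent \<Gamma> t (TLater A) g"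
  shows "coherent \<Gamma> (s \<circledast> t) (TLater B)
    (arr \<Gamma> (\<lambda>i \<gamma>. case i of 0 \<Rightarrow> vunit | Suc j \<Rightarrow> exp_app (f i \<gamma>) j (g i \<gamma>)))"
  by (rule coherentI, erule denotes_LAppE)
    (auto simp: rel_mor_arr_iff rel_mor_later_app[OF assms[THEN coherentD]])

lemma coherent_Unbox:
  assumes "coherent \<Gamma> t (TBox A) f"
  shows "coherent \<Gamma> (Unbox t) A (arr \<Gamma> (\<lambda>i \<gamma>. unbox_map i (f i \<gamma>)))"
  by (rule coherentI, erule denotes_UnboxE)
    (auto simp: rel_mor_arr_iff rel_mor_unbox[OF assms[THEN coherentD]])

lemma coherent_Prev:
  assumes sub: "denotes_const_sub \<Gamma> ts As fs" "\<forall>k<length ts. coherent \<Gamma> (ts ! k) (As ! k) (fs ! k)"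
    and t: "denotes As t (TLater A) f" "coherent As t (TLater A) f"
  shows "coherent \<Gamma> (Prev ts t) A
    (arr \<Gamma> (\<lambda>i \<gamma>. f (Suc i) (sub_den As fs i (Suc i) \<gamma>)))"
  by (rule coherentI, erule denotes_PrevE)
    (auto simp: rel_mor_arr_iff intro!: rel_mor_prev rel_global_sub_den[OF sub t])

lemma coherent_Box:
  assumes sub: "denotes_const_sub \<Gamma> ts As fs" "\<forall>k<length ts. coherent \<Gamma> (ts ! k) (As ! k) (fs ! k)"
    and t: "denotes As t A f" "coherent As t A f"
  shows "coherent \<Gamma> (Box ts t) (TBox A)
    (arr \<Gamma> (\<lambda>i \<gamma>. vtup UNIV (\<lambda>j. f j (sub_den As fs i j \<gamma>))))"
  by (rule coherentI, erule denotes_BoxE)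
    (auto simp: rel_mor_arr_iff intro!: rel_mor_box rel_global_sub_den[OF sub t])

lemma coherent_BoxPlus:
  assumes sub: "denotes_const_sub \<Gamma> ts As fs" "\<forall>k<length ts. coherent \<Gamma> (ts ! k) (As ! k) (fs ! k)"
    and t: "denotes As t (TSum A B) f" "coherent As t (TSum A B) f"
  shows "coherent \<Gamma> (BoxPlus ts t) (TSum (TBox A) (TBox B))
    (arr \<Gamma> (\<lambda>i \<gamma>. boxplus_den (\<lambda>j. f j (sub_den As fs i j \<gamma>))))"
  by (rule coherentI, erule denotes_BoxPlusE)
    (auto simp: rel_mor_arr_iff intro!: rel_mor_boxplus rel_global_sub_den[OF sub t])

lemma denotes_coherent: "denotes \<Gamma> t A f \<Longrightarrow> coherent \<Gamma> t A f"
proof (induction rule: denotes_induct)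
  case (Unfold \<Gamma> t A f)
  then show ?case using denotes_wft[OF Unfold.hyps] by (simp add: coherent_Unfold)
next
  case (Prev As ts fs \<Gamma> t A f)
  then show ?case by (simp add: coherent_Prev denotes_const_sub_def)
next
  case (Box As ts fs \<Gamma> t A f)
  then show ?case by (simp add: coherent_Box denotes_const_sub_def)
next
  case (BoxPlus As ts fs \<Gamma> t B1 B2 f)
  then show ?case by (simp add: coherent_BoxPlus denotes_const_sub_def)
qed (simp_all add: coherent_Var coherent_Zero coherent_Succ coherent_Unit coherent_Pair coherent_Fst
    coherent_Snd coherent_Abort coherent_In1 coherent_In2 coherent_Case coherent_Lam coherent_App
    coherent_Fold coherent_Next coherent_LApp coherent_Unbox)

lemma denotes_unique:
  fixes f g :: "'v::set_universe mor"
  assumes f: "denotes [] t A f" and g: "denotes [] t A g"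
  shows "f = g"
proof -
  have "arr [] f = arr [] g"
  proof (rule arr_cong)
    fix i and \<gamma> :: "'v list"
    assume "\<gamma> \<in> stg (ctx_den []) i"
    then have "rel A A i (f i \<gamma>) (g i \<gamma>)"
      using rel_morD[OF coherentD[OF denotes_coherent[OF f] g], of i "[]" "[]"] by simp
    then show "f i \<gamma> = g i \<gamma>"
      by (simp add: rel_same[OF denotes_wft[OF f]])
  qed
  then show ?thesis
    by (simp add: arr_denotes[OF f] arr_denotes[OF g])
qed


section \<open>Substitution\<close>

definition pull :: "ty list \<Rightarrow> 'v::set_universe mor \<Rightarrow> 'v mor list \<Rightarrow> 'v mor" where
  "pull \<Delta> f gs = arr \<Delta> (\<lambda>i \<delta>. f i (sub_eval gs i \<delta>))"

lemma pull_eq: "\<delta> \<in> stg (ctx_den \<Delta>) i \<Longrightarrow> pull \<Delta> f gs i \<delta> = f i (sub_eval gs i \<delta>)"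
  by (simp add: pull_def arr_eq)

lemma pull_arr:
  "natural_sub \<Delta> \<Gamma> gs \<Longrightarrow> pull \<Delta> (arr \<Gamma> f) gs = arr \<Delta> (\<lambda>i \<delta>. f i (sub_eval gs i \<delta>))"
  unfolding pull_def by (rule arr_cong) (simp add: arr_eq natural_in[OF natural_sub_eval])

lemma sub_den_pull:
  assumes "length fs = length As" "\<delta> \<in> stg (ctx_den \<Delta>) i"
  shows "sub_den As (map (\<lambda>f. pull \<Delta> f gs) fs) i j \<delta> = sub_den As fs i j (sub_eval gs i \<delta>)"
  using assms by (simp add: list_eq_iff_nth_eq sub_den_nth pull_eq)

definition id_sub :: "ty list \<Rightarrow> 'v::set_universe mor list" where
  "id_sub \<Gamma> = map (\<lambda>k. arr \<Gamma> (\<lambda>i \<gamma>. \<gamma> ! k)) [0..<length \<Gamma>]"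

lemma sub_eval_id_sub:
  assumes "\<gamma> \<in> stg (ctx_den \<Gamma>) i"
  shows "sub_eval (id_sub \<Gamma>) i \<gamma> = \<gamma>"
  using assms by (intro nth_equalityI) (simp_all add: id_sub_def arr_eq length_ctx_den[OF assms])

lemma pull_id_sub: "pull \<Gamma> f (id_sub \<Gamma>) = arr \<Gamma> f"
  unfolding pull_def by (rule arr_cong) (simp add: sub_eval_id_sub)

abbreviation weaken :: "ty \<Rightarrow> ty list \<Rightarrow> 'v::set_universe mor \<Rightarrow> 'v mor" where
  "weaken B \<Delta> g \<equiv> arr (B # \<Delta>) (\<lambda>i \<delta>. g i (tl \<delta>))"

definition lift_sub :: "ty \<Rightarrow> ty list \<Rightarrow> 'v::set_universe mor list \<Rightarrow> 'v mor list" where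
  "lift_sub B \<Delta> gs = arr (B # \<Delta>) (\<lambda>i \<delta>. \<delta> ! 0) # map (weaken B \<Delta>) gs"

lemma sub_eval_lift_sub:
  "a \<in> stg (tden B) i \<Longrightarrow> \<delta> \<in> stg (ctx_den \<Delta>) i \<Longrightarrow>
   sub_eval (lift_sub B \<Delta> gs) i (a # \<delta>) = a # sub_eval gs i \<delta>"
  by (simp add: lift_sub_def arr_eq)

lemma funpow_ups: "k < n \<Longrightarrow> (ups ^^ n) \<theta> k = Var k"
  by (induction n arbitrary: k) (auto simp: ups_def split: nat.split)

text \<open>
  The parameter \<open>Q\<close> allows one induction to serve twice: with \<open>Q\<close> restricted to variables it yields
  the weakening that is needed to take for \<open>Q\<close> all terms.
\<close>

locale substitution =
  fixes Q :: "ty list \<Rightarrow> tm \<Rightarrow> ty \<Rightarrow> 'v::set_universe mor \<Rightarrow> bool"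
  assumes Q_denotes: "Q \<Delta> s A g \<Longrightarrow> denotes \<Delta> s A g"
    and Q_Var: "wf_ctx \<Delta> \<Longrightarrow> k < length \<Delta> \<Longrightarrow> Q \<Delta> (Var k) (\<Delta> ! k) (arr \<Delta> (\<lambda>i \<delta>. \<delta> ! k))"
    and Q_weaken: "wf_ctx \<Delta> \<Longrightarrow> wft 0 B \<Longrightarrow> Q \<Delta> s A g \<Longrightarrow>
      Q (B # \<Delta>) (rename Suc s) A (weaken B \<Delta> g)"
begin

definition realizes :: "ty list \<Rightarrow> ty list \<Rightarrow> (nat \<Rightarrow> tm) \<Rightarrow> 'v mor list \<Rightarrow> bool" where
  "realizes \<Delta> \<Gamma> \<theta> gs \<longleftrightarrow> wf_ctx \<Delta> \<and> length gs = length \<Gamma> \<and>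
     (\<forall>k<length \<Gamma>. Q \<Delta> (\<theta> k) (\<Gamma> ! k) (gs ! k))"

lemma realizes_natural_sub: "realizes \<Delta> \<Gamma> \<theta> gs \<Longrightarrow> natural_sub \<Delta> \<Gamma> gs"
  by (auto simp: realizes_def list_all2_conv_all_nth intro: denotes_natural Q_denotes)

lemma realizes_lift_sub:
  "realizes \<Delta> \<Gamma> \<theta> gs \<Longrightarrow> wft 0 B \<Longrightarrow> realizes (B # \<Delta>) (B # \<Gamma>) (ups \<theta>) (lift_sub B \<Delta> gs)"
  using Q_Var[of "B # \<Delta>" 0] Q_weaken
  by (auto simp: realizes_def lift_sub_def ups_def nth_Cons split: nat.split)

lemma realizes_id_sub: "wf_ctx As \<Longrightarrow> realizes As As ((ups ^^ length As) \<theta>) (id_sub As)"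
  using Q_Var by (auto simp: realizes_def id_sub_def funpow_ups)

definition substitutive :: "ty list \<Rightarrow> tm \<Rightarrow> ty \<Rightarrow> 'v mor \<Rightarrow> bool" where
  "substitutive \<Gamma> t A f \<longleftrightarrow>
     (\<forall>\<Delta> \<theta> gs. realizes \<Delta> \<Gamma> \<theta> gs \<longrightarrow> denotes \<Delta> (subst \<theta> t) A (pull \<Delta> f gs))"

lemma substitutiveD:
  "substitutive \<Gamma> t A f \<Longrightarrow> realizes \<Delta> \<Gamma> \<theta> gs \<Longrightarrow> denotes \<Delta> (subst \<theta> t) A (pull \<Delta> f gs)"
  by (simp add: substitutive_def)

lemma substitutive_arrI:
  assumes "\<And>\<Delta> \<theta> gs. realizes \<Delta> \<Gamma> \<theta> gs \<Longrightarrow>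
    denotes \<Delta> (subst \<theta> t) A (arr \<Delta> (\<lambda>i \<delta>. f i (sub_eval gs i \<delta>)))"
  shows "substitutive \<Gamma> t A (arr \<Gamma> f)"
  unfolding substitutive_def using assms by (simp add: pull_arr[OF realizes_natural_sub])

lemma substitutive_Var: "k < length \<Gamma> \<Longrightarrow> substitutive \<Gamma> (Var k) (\<Gamma> ! k) (arr \<Gamma> (\<lambda>i \<gamma>. \<gamma> ! k))"
proof (rule substitutive_arrI)
  fix \<Delta> \<theta> gs assume k: "k < length \<Gamma>" and gs: "realizes \<Delta> \<Gamma> \<theta> gs"
  then have "denotes \<Delta> (\<theta> k) (\<Gamma> ! k) (gs ! k)"
    by (simp add: realizes_def Q_denotes)
  moreover have "arr \<Delta> (\<lambda>i \<delta>. sub_eval gs i \<delta> ! k) = arr \<Delta> (gs ! k)"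
    using k gs by (intro arr_cong) (simp add: realizes_def)
  ultimately show "denotes \<Delta> (subst \<theta> (Var k)) (\<Gamma> ! k) (arr \<Delta> (\<lambda>i \<delta>. sub_eval gs i \<delta> ! k))"
    by (simp add: arr_denotes)
qed

lemma substitutive_Case:
  assumes t: "denotes \<Gamma> t (TSum A B) f" "substitutive \<Gamma> t (TSum A B) f"
    and s1: "substitutive (A # \<Gamma>) s1 C g" and s2: "substitutive (B # \<Gamma>) s2 C h"
  shows "substitutive \<Gamma> (Case t s1 s2) C
    (arr \<Gamma> (\<lambda>i \<gamma>. vcase (\<lambda>a. g i (a # \<gamma>)) (\<lambda>b. h i (b # \<gamma>)) (f i \<gamma>)))"
proof (rule substitutive_arrI)
  fix \<Delta> \<theta> gs assume gs: "realizes \<Delta> \<Gamma> \<theta> gs"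
  note t_subst = substitutiveD[OF t(2) gs]
  have wf: "wf_ctx \<Delta>" "wft 0 A" "wft 0 B"
    using gs denotes_wft[OF t(1)] by (simp_all add: realizes_def)
  have "arr \<Delta> (\<lambda>i \<delta>. vcase (\<lambda>a. pull (A # \<Delta>) g (lift_sub A \<Delta> gs) i (a # \<delta>))
        (\<lambda>b. pull (B # \<Delta>) h (lift_sub B \<Delta> gs) i (b # \<delta>)) (pull \<Delta> f gs i \<delta>)) =
      arr \<Delta> (\<lambda>i \<delta>. vcase (\<lambda>a. g i (a # sub_eval gs i \<delta>)) (\<lambda>b. h i (b # sub_eval gs i \<delta>))
        (f i (sub_eval gs i \<delta>)))"
  proof (rule arr_cong)
    fix i and \<delta> :: "'v list" assume \<delta>: "\<delta> \<in> stg (ctx_den \<Delta>) i"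
    show "vcase (\<lambda>a. pull (A # \<Delta>) g (lift_sub A \<Delta> gs) i (a # \<delta>))
          (\<lambda>b. pull (B # \<Delta>) h (lift_sub B \<Delta> gs) i (b # \<delta>)) (pull \<Delta> f gs i \<delta>) =
        vcase (\<lambda>a. g i (a # sub_eval gs i \<delta>)) (\<lambda>b. h i (b # sub_eval gs i \<delta>))
          (f i (sub_eval gs i \<delta>))"
      using natural_in[OF denotes_natural[OF t_subst wf(1)] \<delta>] \<delta>
      by (auto simp: pull_eq sub_eval_lift_sub)
  qed
  with denotes_Case[OF t_subst substitutiveD[OF s1 realizes_lift_sub[OF gs wf(2)]]
      substitutiveD[OF s2 realizes_lift_sub[OF gs wf(3)]]]
  show "denotes \<Delta> (subst \<theta> (Case t s1 s2)) C (arr \<Delta> (\<lambda>i \<delta>. vcase (\<lambda>a. g i (a # sub_eval gs i \<delta>))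
      (\<lambda>b. h i (b # sub_eval gs i \<delta>)) (f i (sub_eval gs i \<delta>))))"
    by simp
qed

lemma substitutive_Lam:
  assumes t: "substitutive (A # \<Gamma>) t B f" and A: "wft 0 A"
  shows "substitutive \<Gamma> (Lam t) (TFun A B)
    (arr \<Gamma> (\<lambda>i \<gamma>. exp_lam (tden A) i (\<lambda>j a. f j (a # restr (ctx_den \<Gamma>) j i \<gamma>))))"
proof (rule substitutive_arrI)
  fix \<Delta> \<theta> gs assume gs: "realizes \<Delta> \<Gamma> \<theta> gs"
  note lift = realizes_lift_sub[OF gs A] and nat = natural_sub_eval[OF realizes_natural_sub[OF gs]]
  have wf: "wf_ctx \<Delta>" using gs by (simp add: realizes_def)
  have "arr \<Delta> (\<lambda>i \<delta>. exp_lam (tden A) i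
        (\<lambda>j a. pull (A # \<Delta>) f (lift_sub A \<Delta> gs) j (a # restr (ctx_den \<Delta>) j i \<delta>))) =
      arr \<Delta> (\<lambda>i \<delta>. exp_lam (tden A) i (\<lambda>j a. f j (a # restr (ctx_den \<Gamma>) j i (sub_eval gs i \<delta>))))"
    using wf by (intro arr_cong exp_lam_cong)
      (simp add: pull_eq sub_eval_lift_sub restr_ctx_in natural_restr[OF nat res_closed_ctx])
  with denotes_Lam[OF substitutiveD[OF t lift] A]
  show "denotes \<Delta> (subst \<theta> (Lam t)) (TFun A B) (arr \<Delta> (\<lambda>i \<delta>. exp_lam (tden A) i
      (\<lambda>j a. f j (a # restr (ctx_den \<Gamma>) j i (sub_eval gs i \<delta>)))))"
    by simp
qed

lemma denotes_const_sub_subst: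
  assumes "denotes_const_sub \<Gamma> ts As fs" "\<forall>k<length ts. substitutive \<Gamma> (ts ! k) (As ! k) (fs ! k)"
    and "realizes \<Delta> \<Gamma> \<theta> gs"
  shows "denotes_const_sub \<Delta> (map (subst \<theta>) ts) As (map (\<lambda>f. pull \<Delta> f gs) fs)"
  using assms by (auto simp: denotes_const_sub_def intro: substitutiveD)

lemma denotes_subst_bound:
  assumes "denotes_const_sub \<Gamma> ts As fs" "denotes As t A f" "substitutive As t A f"
  shows "denotes As (subst ((ups ^^ length ts) \<theta>) t) A f"
proof -
  have "length As = length ts" using assms(1) by (simp add: denotes_const_sub_def)
  then show ?thesis
    using substitutiveD[OF assms(3) realizes_id_sub[OF denotes_const_sub_wf_ctx[OF assms(1)]]]
    by (simp add: pull_id_sub arr_denotes[OF assms(2)])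
qed

lemma substitutive_const_sub:
  assumes sub: "denotes_const_sub \<Gamma> ts As fs"
      "\<forall>k<length ts. substitutive \<Gamma> (ts ! k) (As ! k) (fs ! k)"
    and t: "denotes As t A f" "substitutive As t A f"
    and rule: "\<And>\<Delta> ts fs t. denotes_const_sub \<Delta> ts As fs \<Longrightarrow> denotes As t A f \<Longrightarrow>
      denotes \<Delta> (con ts t) B (arr \<Delta> (\<lambda>i \<delta>. op i (\<lambda>j. f j (sub_den As fs i j \<delta>))))"
    and subst: "\<And>\<theta>. subst \<theta> (con ts t) = con (map (subst \<theta>) ts) (subst ((ups ^^ length ts) \<theta>) t)"
  shows "substitutive \<Gamma> (con ts t) B (arr \<Gamma> (\<lambda>i \<gamma>. op i (\<lambda>j. f j (sub_den As fs i j \<gamma>))))"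
proof (rule substitutive_arrI)
  show "denotes \<Delta> (subst \<theta> (con ts t)) B
      (arr \<Delta> (\<lambda>i \<delta>. op i (\<lambda>j. f j (sub_den As fs i j (sub_eval gs i \<delta>)))))"
    if "realizes \<Delta> \<Gamma> \<theta> gs" for \<Delta> \<theta> gs
    using rule[OF denotes_const_sub_subst[OF sub that] denotes_subst_bound[OF sub(1) t]] sub(1)
    by (simp add: subst denotes_const_sub_def sub_den_pull cong: arr_cong)
qed

lemma substitutive_unary:
  assumes t: "substitutive \<Gamma> t A f"
    and rule: "\<And>\<Delta> t f. denotes \<Delta> t A f \<Longrightarrow> denotes \<Delta> (con t) B (arr \<Delta> (\<lambda>i \<delta>. op i (f i \<delta>)))"
    and subst: "\<And>\<theta>. subst \<theta> (con t) = con (subst \<theta> t)"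
  shows "substitutive \<Gamma> (con t) B (arr \<Gamma> (\<lambda>i \<gamma>. op i (f i \<gamma>)))"
proof (rule substitutive_arrI)
  show "denotes \<Delta> (subst \<theta> (con t)) B (arr \<Delta> (\<lambda>i \<delta>. op i (f i (sub_eval gs i \<delta>))))"
    if "realizes \<Delta> \<Gamma> \<theta> gs" for \<Delta> \<theta> gs
    using rule[OF substitutiveD[OF t that]] by (simp add: subst pull_eq cong: arr_cong)
qed

lemma substitutive_binary:
  assumes s: "substitutive \<Gamma> s A f" and t: "substitutive \<Gamma> t B g"
    and rule: "\<And>\<Delta> s t f g. denotes \<Delta> s A f \<Longrightarrow> denotes \<Delta> t B g \<Longrightarrow>
      denotes \<Delta> (con s t) C (arr \<Delta> (\<lambda>i \<delta>. op i (f i \<delta>) (g i \<delta>)))"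
    and subst: "\<And>\<theta>. subst \<theta> (con s t) = con (subst \<theta> s) (subst \<theta> t)"
  shows "substitutive \<Gamma> (con s t) C (arr \<Gamma> (\<lambda>i \<gamma>. op i (f i \<gamma>) (g i \<gamma>)))"
proof (rule substitutive_arrI)
  show "denotes \<Delta> (subst \<theta> (con s t)) C
      (arr \<Delta> (\<lambda>i \<delta>. op i (f i (sub_eval gs i \<delta>)) (g i (sub_eval gs i \<delta>))))"
    if "realizes \<Delta> \<Gamma> \<theta> gs" for \<Delta> \<theta> gs
    using rule[OF substitutiveD[OF s that] substitutiveD[OF t that]]
    by (simp add: subst pull_eq cong: arr_cong)
qed

lemma denotes_substitutive: "denotes \<Gamma> t A f \<Longrightarrow> substitutive \<Gamma> t A f"
proof (induction rule: denotes_induct)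
  case (Var k \<Gamma>)
  then show ?case by (simp add: substitutive_Var)
next
  case (Zero \<Gamma>)
  show ?case by (rule substitutive_arrI) (simp add: denotes_Zero)
next
  case (Succ \<Gamma> t f)
  show ?case by (rule substitutive_unary[OF Succ.IH denotes_Succ]) simp_all
next
  case (Unit \<Gamma>)
  show ?case by (rule substitutive_arrI) (simp add: denotes_Unit)
next
  case (Pair \<Gamma> s A f t B g)
  show ?case by (rule substitutive_binary[OF Pair.IH denotes_Pair]) simp_all
next
  case (Fst \<Gamma> t A B f)
  show ?case by (rule substitutive_unary[OF Fst.IH denotes_Fst]) simp_all
next
  case (Snd \<Gamma> t A B f)
  show ?case by (rule substitutive_unary[OF Snd.IH denotes_Snd]) simp_all
next
  case (Abort \<Gamma> t f A)
  show ?case by (rule substitutive_unary[OF Abort.IH denotes_Abort]) (simp_all add: Abort.hyps)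
next
  case (In1 \<Gamma> t A f B)
  show ?case by (rule substitutive_unary[OF In1.IH denotes_In1]) (simp_all add: In1.hyps)
next
  case (In2 \<Gamma> t B f A)
  show ?case by (rule substitutive_unary[OF In2.IH denotes_In2]) (simp_all add: In2.hyps)
next
  case (Case \<Gamma> t A B f s1 C g s2 h)
  then show ?case by (simp add: substitutive_Case)
next
  case (Lam A \<Gamma> t B f)
  then show ?case by (simp add: substitutive_Lam)
next
  case (App \<Gamma> s A B f t g)
  show ?case by (rule substitutive_binary[OF App.IH denotes_App]) simp_all
next
  case (Fold \<Gamma> t A f)
  then show ?case by (simp add: substitutive_def denotes_Fold)
next
  case (Unfold \<Gamma> t A f)
  then show ?case by (simp add: substitutive_def denotes_Unfold)
next
  case (Next \<Gamma> t A f)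
  show ?case by (rule substitutive_unary[OF Next.IH denotes_Next]) simp_all
next
  case (Prev As ts fs \<Gamma> t A f)
  then show ?case
    by (intro substitutive_const_sub[where con = Prev and op = "\<lambda>i x. x (Suc i)"] denotes_Prev)
      (simp_all add: denotes_const_sub_def)
next
  case (LApp \<Gamma> s A B f t g)
  show ?case by (rule substitutive_binary[OF LApp.IH denotes_LApp]) simp_all
next
  case (Box As ts fs \<Gamma> t A f)
  then show ?case
    by (intro substitutive_const_sub[where con = Box and op = "\<lambda>i. vtup UNIV"] denotes_Box)
      (simp_all add: denotes_const_sub_def)
next
  case (Unbox \<Gamma> t A f)
  show ?case by (rule substitutive_unary[OF Unbox.IH denotes_Unbox]) simp_all
next
  case (BoxPlus As ts fs \<Gamma> t B1 B2 f)
  then show ?case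
    by (intro substitutive_const_sub[where con = BoxPlus and op = "\<lambda>i. boxplus_den"]
          denotes_BoxPlus)
      (simp_all add: denotes_const_sub_def)
qed

lemmas denotes_subst_realizes = substitutiveD[OF denotes_substitutive]

end

lemma ups_Var: "ups (Var \<circ> \<rho>) = Var \<circ> upr \<rho>"
  by (auto simp: ups_def upr_def fun_eq_iff split: nat.split)

lemma funpow_ups_Var: "(ups ^^ n) (Var \<circ> \<rho>) = Var \<circ> (upr ^^ n) \<rho>"
  by (induction n) (simp_all add: ups_Var[unfolded comp_def] comp_def)

lemma rename_eq_subst: "rename \<rho> t = subst (Var \<circ> \<rho>) t"
  by (induction t arbitrary: \<rho>) (simp_all add: ups_Var funpow_ups_Var)

lemma arr_Cons_eqI:
  fixes f g :: "'v::set_universe mor"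
  assumes "\<And>i a \<delta>. a \<in> stg (tden B) i \<Longrightarrow> \<delta> \<in> stg (ctx_den \<Delta>) i \<Longrightarrow> f i (a # \<delta>) = g i (a # \<delta>)"
  shows "arr (B # \<Delta>) f = arr (B # \<Delta>) g"
proof (rule arr_cong)
  fix i and \<gamma> :: "'v list"
  assume \<gamma>: "\<gamma> \<in> stg (ctx_den (B # \<Delta>)) i"
  then obtain a \<delta> where "\<gamma> = a # \<delta>" by (cases \<gamma>) (auto dest: length_ctx_den)
  with \<gamma> show "f i \<gamma> = g i \<gamma>" by (simp add: assms)
qed

definition denotes_var :: "ty list \<Rightarrow> tm \<Rightarrow> ty \<Rightarrow> 'v::set_universe mor \<Rightarrow> bool" where
  "denotes_var \<Delta> s A g \<longleftrightarrow> denotes \<Delta> s A g \<and> s \<in> range Var"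

interpretation renaming: substitution "denotes_var :: _ \<Rightarrow> _ \<Rightarrow> _ \<Rightarrow> 'v::set_universe mor \<Rightarrow> bool"
proof
  show "denotes \<Delta> s A g" if "denotes_var \<Delta> s A g" for \<Delta> s A and g :: "'v mor"
    using that by (simp add: denotes_var_def)
  show "denotes_var \<Delta> (Var k) (\<Delta> ! k) (arr \<Delta> (\<lambda>i \<delta>. \<delta> ! k))" if "wf_ctx \<Delta>" "k < length \<Delta>" for \<Delta> k
    using that by (simp add: denotes_var_def denotes_Var wf_ctx_nth)
  show "denotes_var (B # \<Delta>) (rename Suc s) A (weaken B \<Delta> g)"
    if "denotes_var \<Delta> s A g" for \<Delta> B s A and g :: "'v mor"
  proof -
    from that obtain k where s: "s = Var k" and k: "k < length \<Delta>" "wft 0 (\<Delta> ! k)"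
      and A: "A = \<Delta> ! k" and g: "g = arr \<Delta> (\<lambda>i \<gamma>. \<gamma> ! k)"
      by (auto simp: denotes_var_def elim: denotes_VarE)
    have "denotes (B # \<Delta>) (Var (Suc k)) A (arr (B # \<Delta>) (\<lambda>i \<delta>. \<delta> ! Suc k))"
      using k denotes_Var[of "Suc k" "B # \<Delta>"] by (simp add: A)
    moreover have "weaken B \<Delta> g = arr (B # \<Delta>) (\<lambda>i \<delta>. \<delta> ! Suc k)"
      unfolding g by (rule arr_Cons_eqI) (simp add: arr_eq)
    ultimately show ?thesis by (simp add: denotes_var_def s)
  qed
qed

lemma denotes_weaken:
  assumes t: "denotes \<Delta> t A f" and wf: "wf_ctx \<Delta>" "wft 0 B"
  shows "denotes (B # \<Delta>) (rename Suc t) A (weaken B \<Delta> f)"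
proof -
  let ?gs = "map (weaken B \<Delta>) (id_sub \<Delta>)"
  have "renaming.realizes (B # \<Delta>) \<Delta> (Var \<circ> Suc) ?gs"
    using wf renaming.Q_weaken[OF wf renaming.Q_Var[OF wf(1)]]
    by (auto simp: renaming.realizes_def id_sub_def)
  then have "denotes (B # \<Delta>) (rename Suc t) A (pull (B # \<Delta>) f ?gs)"
    unfolding rename_eq_subst by (rule renaming.denotes_subst_realizes[OF t])
  moreover have "pull (B # \<Delta>) f ?gs = weaken B \<Delta> f"
    unfolding pull_def by (rule arr_Cons_eqI) (simp add: arr_eq comp_def sub_eval_id_sub)
  ultimately show ?thesis by simp
qed

interpretation terms: substitution denotes
  by standard (auto intro: denotes_Var denotes_weaken wf_ctx_nth)

lemma denotes_subst:
  assumes "denotes \<Gamma> t A f" "wf_ctx \<Delta>" "length gs = length \<Gamma>"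
    and "\<And>k. k < length \<Gamma> \<Longrightarrow> denotes \<Delta> (\<theta> k) (\<Gamma> ! k) (gs ! k)"
  shows "denotes \<Delta> (subst \<theta> t) A (pull \<Delta> f gs)"
  using assms by (auto simp: terms.realizes_def intro: terms.denotes_subst_realizes)

lemma denotes_inst_sub:
  assumes "denotes_const_sub \<Gamma> ts As fs" "denotes As t A f" "wf_ctx \<Gamma>"
  shows "denotes \<Gamma> (inst t ts) A (pull \<Gamma> f fs)"
  unfolding inst_def by (rule denotes_subst[OF assms(2,3)])
    (use assms(1) in \<open>simp_all add: denotes_const_sub_def\<close>)

lemma denotes_inst_single:
  assumes t: "denotes (B # \<Gamma>) t A f" and s: "denotes \<Gamma> s B g" and wf: "wf_ctx \<Gamma>"
  shows "denotes \<Gamma> (inst t [s]) A (arr \<Gamma> (\<lambda>i \<gamma>. f i (g i \<gamma> # \<gamma>)))"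
proof -
  have "denotes \<Gamma> (inst t [s]) A (pull \<Gamma> f (g # id_sub \<Gamma>))"
    unfolding inst_def
  proof (rule denotes_subst[OF t wf])
    fix k assume "k < length (B # \<Gamma>)"
    then show "denotes \<Gamma> (if k < length [s] then [s] ! k else Var (k - length [s])) ((B # \<Gamma>) ! k)
        ((g # id_sub \<Gamma>) ! k)"
      using s wf by (cases k) (simp_all add: id_sub_def denotes_Var wf_ctx_nth)
  qed (simp add: id_sub_def)
  moreover have "pull \<Gamma> f (g # id_sub \<Gamma>) = arr \<Gamma> (\<lambda>i \<gamma>. f i (g i \<gamma> # \<gamma>))"
    unfolding pull_def by (rule arr_cong) (simp add: sub_eval_id_sub)
  ultimately show ?thesis by simp
qed


section \<open>Soundness\<close>

lemma denotes_Fst_Pair: "denotes \<Gamma> (Fst (Pair s t)) A f \<Longrightarrow> denotes \<Gamma> s A f"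
  by (auto elim!: denotes_FstE denotes_PairE simp: arr_eq arr_denotes cong: arr_cong)

lemma denotes_Snd_Pair: "denotes \<Gamma> (Snd (Pair s t)) A f \<Longrightarrow> denotes \<Gamma> t A f"
  by (auto elim!: denotes_SndE denotes_PairE simp: arr_eq arr_denotes cong: arr_cong)

lemma denotes_Case_In1:
  assumes "denotes \<Gamma> (Case (In1 t) s1 s2) A f" "wf_ctx \<Gamma>"
  shows "denotes \<Gamma> (inst s1 [t]) A f"
  using assms by (auto elim!: denotes_CaseE denotes_In1E simp: arr_eq cong: arr_cong
      intro: denotes_inst_single)

lemma denotes_Case_In2:
  assumes "denotes \<Gamma> (Case (In2 t) s1 s2) A f" "wf_ctx \<Gamma>"
  shows "denotes \<Gamma> (inst s2 [t]) A f"
  using assms by (auto elim!: denotes_CaseE denotes_In2E simp: arr_eq cong: arr_cong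
      intro: denotes_inst_single)

lemma denotes_App_Lam:
  fixes f :: "'v::set_universe mor"
  assumes "denotes \<Gamma> (App (Lam s) t) A f" and wf: "wf_ctx \<Gamma>"
  shows "denotes \<Gamma> (inst s [t]) A f"
proof -
  from assms(1) obtain B h g where "denotes \<Gamma> (Lam s) (TFun B A) h" and t: "denotes \<Gamma> t B g"
    and f: "f = arr \<Gamma> (\<lambda>i \<gamma>. exp_app (h i \<gamma>) i (g i \<gamma>))"
    by (rule denotes_AppE)
  then obtain e where s: "denotes (B # \<Gamma>) s A e" and B: "wft 0 B"
    and h: "h = arr \<Gamma> (\<lambda>i \<gamma>. exp_lam (tden B) i (\<lambda>j a. e j (a # restr (ctx_den \<Gamma>) j i \<gamma>)))"
    by (auto elim: denotes_LamE)
  have "f = arr \<Gamma> (\<lambda>i \<gamma>. e i (g i \<gamma> # \<gamma>))"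
    unfolding f
  proof (rule arr_cong)
    fix i and \<gamma> :: "'v list" assume \<gamma>: "\<gamma> \<in> stg (ctx_den \<Gamma>) i"
    have "exp_app (exp_lam (tden B) i (\<lambda>j a. e j (a # restr (ctx_den \<Gamma>) j i \<gamma>))) i (g i \<gamma>) =
        e i (g i \<gamma> # restr (ctx_den \<Gamma>) i i \<gamma>)"
    proof (rule exp_app_exp_lam)
      show "wf_tree (tden B)" "wf_tree (tden A :: 'v tree)"
        using B denotes_wft[OF s] by (simp_all add: wf_tree_tden)
      show "(\<lambda>a. e i (a # restr (ctx_den \<Gamma>) i i \<gamma>)) \<in> stg (tden B) i \<rightarrow> stg (tden A) i"
        using natural_in[OF denotes_natural[OF s]] B wf \<gamma> by simp
      show "g i \<gamma> \<in> stg (tden B) i"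
        using natural_in[OF denotes_natural[OF t wf] \<gamma>] .
    qed simp
    then show "exp_app (h i \<gamma>) i (g i \<gamma>) = e i (g i \<gamma> # \<gamma>)"
      using \<gamma> by (simp add: h arr_eq)
  qed
  with denotes_inst_single[OF s t wf] show ?thesis by simp
qed

lemma denotes_Unfold_Fold: "denotes \<Gamma> (Unfold (Fold t)) A f \<Longrightarrow> denotes \<Gamma> t A f"
  by (auto elim!: denotes_UnfoldE denotes_FoldE)

lemma denotes_LApp_Next:
  fixes f :: "'v::set_universe mor"
  assumes "denotes \<Gamma> (Next s \<circledast> Next t) A f" and wf: "wf_ctx \<Gamma>"
  shows "denotes \<Gamma> (Next (App s t)) A f"
proof -
  from assms(1) obtain B C h g where A: "A = TLater C"
    and "denotes \<Gamma> (Next s) (TLater (TFun B C)) h" and "denotes \<Gamma> (Next t) (TLater B) g"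
    and f: "f = arr \<Gamma> (\<lambda>i \<gamma>. case i of 0 \<Rightarrow> vunit | Suc j \<Rightarrow> exp_app (h i \<gamma>) j (g i \<gamma>))"
    by (rule denotes_LAppE)
  then obtain h1 g1 where s: "denotes \<Gamma> s (TFun B C) h1" and t: "denotes \<Gamma> t B g1"
    and h: "h = arr \<Gamma> (\<lambda>i \<gamma>. next_map (exp_obj (tden B) (tden C)) i (h1 i \<gamma>))"
    and g: "g = arr \<Gamma> (\<lambda>i \<gamma>. next_map (tden B) i (g1 i \<gamma>))"
    by (auto elim!: denotes_NextE)
  have wf_trees: "wf_tree (tden B :: 'v tree)" "wf_tree (tden C :: 'v tree)"
    using denotes_wft[OF s] by (simp_all add: wf_tree_tden)
  have "f = arr \<Gamma> (\<lambda>i \<gamma>. next_map (tden C) i (exp_app (h1 i \<gamma>) i (g1 i \<gamma>)))"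
    unfolding f
  proof (rule arr_cong)
    fix i and \<gamma> :: "'v list" assume \<gamma>: "\<gamma> \<in> stg (ctx_den \<Gamma>) i"
    show "(case i of 0 \<Rightarrow> vunit | Suc j \<Rightarrow> exp_app (h i \<gamma>) j (g i \<gamma>)) =
        next_map (tden C) i (exp_app (h1 i \<gamma>) i (g1 i \<gamma>))"
    proof (cases i)
      case (Suc j)
      have "h1 i \<gamma> \<in> stg (exp_obj (tden B) (tden C)) (Suc j)" "g1 i \<gamma> \<in> stg (tden B) (Suc j)"
        using natural_in[OF denotes_natural[OF s wf] \<gamma>] natural_in[OF denotes_natural[OF t wf] \<gamma>]
        by (simp_all add: Suc)
      then show ?thesis
        using \<gamma> exp_app_res[OF _ wf_trees] by (simp add: h g arr_eq Suc next_map_def)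
    qed (simp add: next_map_def)
  qed
  with denotes_Next[OF denotes_App[OF s t]] show ?thesis
    by (simp add: A arr_eq cong: arr_cong)
qed

lemma denotes_Unbox_Box:
  assumes "denotes \<Gamma> (Unbox (Box ts t)) A f" and wf: "wf_ctx \<Gamma>"
  shows "denotes \<Gamma> (inst t ts) A f"
proof -
  from assms(1) obtain g where "denotes \<Gamma> (Box ts t) (TBox A) g"
    and f: "f = arr \<Gamma> (\<lambda>i \<gamma>. unbox_map i (g i \<gamma>))"
    by (rule denotes_UnboxE)
  then obtain As fs h where sub: "denotes_const_sub \<Gamma> ts As fs" and t: "denotes As t A h"
    and g: "g = arr \<Gamma> (\<lambda>i \<gamma>. vtup UNIV (\<lambda>j. h j (sub_den As fs i j \<gamma>)))"
    by (auto elim: denotes_BoxE)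
  have "f = pull \<Gamma> h fs"
    unfolding f pull_def using sub
    by (intro arr_cong) (simp add: g arr_eq unbox_map_def denotes_const_sub_def sub_den_self)
  with denotes_inst_sub[OF sub t wf] show ?thesis by simp
qed

lemma denotes_BoxPlus_In1:
  assumes "denotes \<Gamma> (BoxPlus [] (In1 t)) A f"
  shows "denotes \<Gamma> (In1 (Box [] t)) A f"
proof -
  from assms obtain B C g where A: "A = TSum (TBox B) (TBox C)"
    and t: "denotes [] t B g" and C: "wft 0 (TBox C)"
    and f: "f = arr \<Gamma> (\<lambda>i \<gamma>. vinl (vtup UNIV (\<lambda>j. g j [])))"
    by (auto elim!: denotes_BoxPlusE denotes_In1E simp: arr_eq)
  have "denotes \<Gamma> (In1 (Box [] t)) A
      (arr \<Gamma> (\<lambda>i \<gamma>. vinl (arr \<Gamma> (\<lambda>i \<gamma>. vtup UNIV (\<lambda>j. g j [])) i \<gamma>)))"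
    unfolding A by (rule denotes_In1[OF denotes_Box_Nil[OF t] C])
  then show ?thesis by (simp add: f arr_eq cong: arr_cong)
qed

lemma denotes_BoxPlus_In2:
  assumes "denotes \<Gamma> (BoxPlus [] (In2 t)) A f"
  shows "denotes \<Gamma> (In2 (Box [] t)) A f"
proof -
  from assms obtain B C g where A: "A = TSum (TBox B) (TBox C)"
    and t: "denotes [] t C g" and B: "wft 0 (TBox B)"
    and f: "f = arr \<Gamma> (\<lambda>i \<gamma>. vinr (vtup UNIV (\<lambda>j. g j [])))"
    by (auto elim!: denotes_BoxPlusE denotes_In2E simp: arr_eq)
  have "denotes \<Gamma> (In2 (Box [] t)) A
      (arr \<Gamma> (\<lambda>i \<gamma>. vinr (arr \<Gamma> (\<lambda>i \<gamma>. vtup UNIV (\<lambda>j. g j [])) i \<gamma>)))"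
    unfolding A by (rule denotes_In2[OF denotes_Box_Nil[OF t] B])
  then show ?thesis by (simp add: f arr_eq cong: arr_cong)
qed

lemma closed_global_elt: "denotes [] t A f \<Longrightarrow> global_elt (tden A) (\<lambda>j. f j [])"
  using global_elt_natural[OF denotes_natural, of "[]" t A f "\<lambda>_. []"] by (simp add: global_elt_def)

lemma sub_den_closed:
  assumes "denotes_const_sub [] ts As fs"
  shows "sub_den As fs i j [] = sub_eval fs j []"
proof (rule nth_equalityI)
  fix k assume "k < length (sub_den As fs i j [])"
  then have k: "k < length As" "k < length fs" and const: "const_ty (As ! k)"
    and fs: "denotes [] (ts ! k) (As ! k) (fs ! k)"
    using assms by (simp_all add: denotes_const_sub_def)
  then show "sub_den As fs i j [] ! k = sub_eval fs j [] ! k"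
    using transport_global_elt[OF const_tree_tden closed_global_elt, OF denotes_wft[OF fs] const fs]
    by (simp add: sub_den_nth)
qed (use assms in \<open>simp add: denotes_const_sub_def\<close>)

lemma denotes_Prev_inst:
  assumes "denotes [] (Prev ts t) A f"
  shows "denotes [] (Prev [] (inst t ts)) A f"
proof -
  from assms obtain As fs g where sub: "denotes_const_sub [] ts As fs"
    and t: "denotes As t (TLater A) g"
    and f: "f = arr [] (\<lambda>i \<gamma>. g (Suc i) (sub_den As fs i (Suc i) \<gamma>))"
    by (rule denotes_PrevE)
  have "f = arr [] (\<lambda>i \<gamma>. pull [] g fs (Suc i) [])"
    unfolding f by (rule arr_cong) (simp add: pull_eq sub_den_closed[OF sub])
  then show ?thesis
    using denotes_Prev_Nil[OF denotes_inst_sub[OF sub t]] by simp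
qed

lemma denotes_BoxPlus_inst:
  assumes "denotes [] (BoxPlus ts t) A f"
  shows "denotes [] (BoxPlus [] (inst t ts)) A f"
proof -
  from assms obtain As fs B C g where A: "A = TSum (TBox B) (TBox C)"
    and sub: "denotes_const_sub [] ts As fs" and t: "denotes As t (TSum B C) g"
    and f: "f = arr [] (\<lambda>i \<gamma>. boxplus_den (\<lambda>j. g j (sub_den As fs i j \<gamma>)))"
    by (rule denotes_BoxPlusE)
  have "f = arr [] (\<lambda>i \<gamma>. boxplus_den (\<lambda>j. pull [] g fs j []))"
    unfolding f by (rule arr_cong) (simp add: pull_eq sub_den_closed[OF sub])
  then show ?thesis
    using denotes_BoxPlus_Nil[OF denotes_inst_sub[OF sub t]] by (simp add: A)
qed

lemma denotes_Prev_Next: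
  assumes "denotes [] (Prev [] (Next t)) A f"
  shows "denotes [] t A f"
proof -
  from assms obtain h where "denotes [] (Next t) (TLater A) h"
    and f: "f = arr [] (\<lambda>i \<gamma>. h (Suc i) [])"
    by (rule denotes_PrevE) simp
  from this(1) obtain g where t: "denotes [] t A g"
    and h: "h = arr [] (\<lambda>i \<gamma>. next_map (tden A) i (g i \<gamma>))"
    by (rule denotes_NextE) simp
  have "f = arr [] g"
    unfolding f h
    by (rule arr_cong) (simp add: arr_eq next_map_def global_elt_res[OF closed_global_elt[OF t]])
  with t show ?thesis by (simp add: arr_denotes)
qed

lemma denotes_redex: "t \<mapsto>\<^sub>0 u \<Longrightarrow> denotes [] t A f \<Longrightarrow> denotes [] u A f"
  by (induction rule: redex.induct)
    (erule denotes_Fst_Pair denotes_Snd_Pair denotes_Case_In1 denotes_Case_In2 denotes_App_Lam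
      denotes_Unfold_Fold denotes_Prev_Next denotes_Prev_inst denotes_LApp_Next denotes_Unbox_Box
      denotes_BoxPlus_In1 denotes_BoxPlus_In2 denotes_BoxPlus_inst; simp)+

lemmas eval_ctx_induct [consumes 1, case_names Hole Succ Fst Snd Case App Unfold Prev LApp_left
    LApp_right Unbox BoxPlus] = eval_ctx.induct

lemma denotes_eval_ctx:
  fixes f :: "'v::set_universe mor"
  assumes "eval_ctx E"
    and "\<And>A (f :: 'v mor). denotes [] t A f \<Longrightarrow> denotes [] u A f"
    and "denotes [] (E t) A f"
  shows "denotes [] (E u) A f"
  using assms(1,3)
proof (induction arbitrary: A f rule: eval_ctx_induct)
  case Hole
  then show ?case by (rule assms(2))
next
  case (Prev E)
  from Prev.prems obtain g where "denotes [] (E t) (TLater A) g"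
    and "f = arr [] (\<lambda>i \<gamma>. g (Suc i) [])"
    by (rule denotes_PrevE) simp
  then show ?case by (simp add: denotes_Prev_Nil Prev.IH)
next
  case (BoxPlus E)
  from BoxPlus.prems obtain B C g where "A = TSum (TBox B) (TBox C)"
    and "denotes [] (E t) (TSum B C) g" and "f = arr [] (\<lambda>i \<gamma>. boxplus_den (\<lambda>j. g j []))"
    by (rule denotes_BoxPlusE) simp
  then show ?case by (simp add: denotes_BoxPlus_Nil BoxPlus.IH)
qed (auto elim!: denotes_SuccE denotes_FstE denotes_SndE denotes_CaseE denotes_AppE
    denotes_UnfoldE denotes_LAppE denotes_UnboxE
    intro: denotes_Succ denotes_Fst denotes_Snd denotes_Case denotes_App
    denotes_Unfold denotes_LApp denotes_Unbox)

lemma denotes_steps: "t \<Zsurj> u \<Longrightarrow> denotes [] t A f \<Longrightarrow> denotes [] u A f"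
proof (induction rule: rtranclp_induct)
  case (step u u')
  then show ?case by (auto elim!: step.cases intro: denotes_eval_ctx denotes_redex)
qed

lemmas typing_induct [consumes 1, case_names Var Zero Succ Unit Pair Fst Snd Abort In1 In2 Case
    Lam App Fold Unfold Next Prev LApp Box Unbox BoxPlus] = typing.induct

lemma ex_denotes_const_sub:
  assumes "length As = length ts" "\<forall>k<length ts. const_ty (As ! k)"
    and "\<forall>k<length ts. \<exists>f :: 'v::set_universe mor. denotes \<Gamma> (ts ! k) (As ! k) f"
  shows "\<exists>fs :: 'v mor list. denotes_const_sub \<Gamma> ts As fs"
  using assms Skolem_list_nth[of "length ts" "\<lambda>k f. denotes \<Gamma> (ts ! k) (As ! k) f"]
  by (auto simp: denotes_const_sub_def)

lemma typing_denotes: "\<Gamma> \<turnstile> t \<^bold>: A \<Longrightarrow> \<exists>f :: 'v::set_universe mor. denotes \<Gamma> t A f"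
proof (induction rule: typing_induct)
  case (Prev As ts \<Gamma> t A)
  then show ?case
    using ex_denotes_const_sub[of As ts \<Gamma>] by (blast intro: denotes_Prev)
next
  case (Box As ts \<Gamma> t A)
  then show ?case
    using ex_denotes_const_sub[of As ts \<Gamma>] by (blast intro: denotes_Box)
next
  case (BoxPlus As ts \<Gamma> t B1 B2)
  then show ?case
    using ex_denotes_const_sub[of As ts \<Gamma>] by (blast intro: denotes_BoxPlus)
qed (blast intro: denotes.intros)+

lemma den_eq: "denotes [] t A f \<Longrightarrow> den [] t A = f"
  unfolding den_def by (rule the_equality) (auto intro: denotes_unique)

theorem theorem2p9:
  fixes t u :: tm and A :: ty
  assumes "[] \<turnstile> t \<^bold>: A" and "t \<Zsurj> u"
  shows "(den [] t A :: nat \<Rightarrow> 'v::set_universe list \<Rightarrow> 'v) = den [] u A"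
proof -
  obtain f :: "'v mor" where f: "denotes [] t A f"
    using typing_denotes[OF assms(1)] by blast
  then have "denotes [] u A f"
    by (rule denotes_steps[OF assms(2)])
  with f show ?thesis by (simp add: den_eq)
qed

end
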